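(* Let $p\ge5$ be prime and let $\mathfrak{C}=\mathfrak{C}(a_0:\ldots:a_{\frac{p-1}{2}})$ be a regular $H_p$-Clifford algebra. Then the character series of $\mathfrak{C}$ is the same as the character series of the polynomial ring $\mathbb{C}[x_0,\ldots,x_{p-1}]$, where the degree $1$ part of $\mathfrak{C}$ is isomorphic to the degree $1$ part of $\mathbb{C}[x_0,\ldots,x_{p-1}]$ as an $H_p$-representation. That is, $Ch_{\mathfrak{C}}(g,t)=Ch_{\mathbb{C}[x_0,\ldots,x_{p-1}]}(g,t)$ for all $g\in H_p$.
   Context: Let $\omega=e^{2\pi i/p}$; indices of $x_i$ are in $\mathbb{Z}/p\mathbb{Z}$, and $\frac i2$ in an index means $i\cdot2^{-1}$ modulo $p$. $H_p=\langle e_1,e_2,z\mid e_1^p=e_2^p=z^p=1,\ [e_1,e_2]=z,\ z \text{ central}\rangle$ is the Heisenberg group of order $p^3$, acting on $V=\mathbb{C}x_0+\ldots+\mathbb{C}x_{p-1}$ by $e_1\cdot x_i=x_{i-1}$, $e_2\cdot x_i=\omega^ix_i$. It acts by graded algebra automorphisms on the polynomial ring $\mathbb{C}[x_0,\ldots,x_{p-1}]$ and on $\mathfrak{C}$, extending the action on $V$ in degree $1$. For $(a_0:\ldots:a_{\frac{p-1}{2}})\in \mathbb{P}^{\frac{p-1}{2}}$ (over $\mathbb{C}$), the $H_p$-Clifford algebra $\mathfrak{C}(a_0:\ldots:a_{\frac{p-1}{2}})$ is $\mathbb{C}\langle x_0,\ldots,x_{p-1}\rangle$ modulo $a_0(x_jx_{j+i}+x_{j+i}x_j)=a_i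 x_{j+\frac{i}{2}}^2$ ($j\in\mathbb{Z}/p\mathbb{Z}$, $1\le i\le \frac{p-1}{2}$) and (automatic if $a_0\ne0$) $a_m(x_{k-\frac i2}x_{k+\frac i2}+x_{k+\frac i2}x_{k-\frac i2})=a_i(x_{k-\frac m2}x_{k+\frac m2}+x_{k+\frac m2}x_{k-\frac m2})$ ($k\in\mathbb{Z}/p\mathbb{Z}$, $1\le i,m\le\frac{p-1}{2}$). It is called regular if its associated quadric system is base-point free, i.e. the quadrics $q_k=a_0z_k^2+\sum_{i=1}^{(p-1)/2}a_i z_{k-\frac i2}z_{k+\frac i2}$, $k\in\mathbb{Z}/p\mathbb{Z}$, have no common zero in $\mathbb{P}^{p-1}$. (By a known theorem this is equivalent to $\mathfrak{C}$ being a quadratic graded Clifford algebra that is Auslander-regular of global dimension $p$, Cohen-Macaulay and of Hilbert series $\frac1{(1-t)^p}$; it is then also a noetherian domain and Artin-Schelter regular.) For a graded algebra $A$ on which a finite group $G$ acts by graded automorphisms and $g\in G$, the character series is $Ch_A(g,t)=\sum_{n}\chi_{A_n}(g)t^n$, $\chi_{A_n}$ being the character of the $G$-representation $A_n$. *)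

theory Defs
  imports
    "HOL-Library.Poly_Mapping"
    "HOL-Computational_Algebra.Formal_Power_Series"
    "HOL-Algebra.QuotRing"
    "Jordan_Normal_Form.VS_Connect"
    "Berlekamp_Zassenhaus.Finite_Field"
begin

text \<open>
  The prime \<open>p\<close> is the cardinality of a finite type \<open>'p :: prime_card\<close>, and the index set
  $\mathbb{Z}/p\mathbb{Z}$ is the field \<^typ>\<open>'p mod_ring\<close>. The index written $\frac{i}{2}$ is
  literally \<open>of_nat i / 2\<close> in that field.
\<close>


section \<open>Groups given by generators and relators\<close>

text \<open>The letter \<open>(x, True)\<close> stands for the generator \<open>x\<close>, and \<open>(x, False)\<close> for its inverse.\<close>

type_synonym 'g group_word = "('g \<times> bool) list"

inductive word_eq :: "'g group_word set \<Rightarrow> 'g group_word \<Rightarrow> 'g group_word \<Rightarrow> bool"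
  for R :: "'g group_word set" where
  refl: "word_eq R u u"
| sym: "word_eq R u v \<Longrightarrow> word_eq R v u"
| trans: "word_eq R u v \<Longrightarrow> word_eq R v w \<Longrightarrow> word_eq R u w"
| cancel: "word_eq R (u @ [(x, b), (x, \<not> b)] @ v) (u @ v)"
| relator: "r \<in> R \<Longrightarrow> word_eq R (u @ r @ v) (u @ v)"

definition word_class :: "'g group_word set \<Rightarrow> 'g group_word \<Rightarrow> 'g group_word set" where
  "word_class R u = {v. word_eq R u v}"

definition presented_group :: "'g group_word set \<Rightarrow> 'g group_word set monoid" where
  "presented_group R =
    \<lparr>carrier = range (word_class R),
     monoid.mult = (\<lambda>A B. word_class R ((SOME u. u \<in> A) @ (SOME v. v \<in> B))),
     one = word_class R []\<rparr>"

lemma word_class_eq_iff: "word_class R u = word_class R v \<longleftrightarrow> word_eq R u v"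
  unfolding word_class_def by (auto intro: word_eq.intros)

lemma word_eq_append_left: "word_eq R u v \<Longrightarrow> word_eq R (w @ u) (w @ v)"
proof (induction rule: word_eq.induct)
  case (cancel u x b v)
  show ?case using word_eq.cancel[of R "w @ u" x b v] by simp
next
  case (relator r u v)
  then show ?case using word_eq.relator[of r R "w @ u" v] by simp
qed (auto intro: word_eq.refl word_eq.sym word_eq.trans)

lemma word_eq_append_right: "word_eq R u v \<Longrightarrow> word_eq R (u @ w) (v @ w)"
proof (induction rule: word_eq.induct)
  case (cancel u x b v)
  show ?case using word_eq.cancel[of R u x b "v @ w"] by simp
next
  case (relator r u v)
  then show ?case using word_eq.relator[of r R u "v @ w"] by simp
qed (auto intro: word_eq.refl word_eq.sym word_eq.trans)

lemma word_eq_append: "word_eq R u u' \<Longrightarrow> word_eq R v v' \<Longrightarrow> word_eq R (u @ v) (u' @ v')"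
  by (meson word_eq_append_left word_eq_append_right word_eq.trans)

lemma word_eq_some: "word_eq R u (SOME v. v \<in> word_class R u)"
proof -
  have "u \<in> word_class R u" by (simp add: word_class_def word_eq.refl)
  then have "(SOME v. v \<in> word_class R u) \<in> word_class R u" by (rule someI)
  then show ?thesis by (simp add: word_class_def)
qed

lemma presented_group_mult:
  "word_class R u \<otimes>\<^bsub>presented_group R\<^esub> word_class R v = word_class R (u @ v)"
  by (simp add: presented_group_def word_class_eq_iff word_eq.sym[OF word_eq_append]
      word_eq_some)

definition word_inv :: "'g group_word \<Rightarrow> 'g group_word" where
  "word_inv u = rev (map (\<lambda>(x, b). (x, \<not> b)) u)"

lemma word_inv_left: "word_eq R (word_inv u @ u) []"
proof (induction u)
  case Nil
  then show ?case by (simp add: word_inv_def word_eq.refl)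
next
  case (Cons l u)
  obtain x b where l: "l = (x, b)" by (cases l)
  have "word_eq R (word_inv u @ [(x, \<not> b), (x, \<not> \<not> b)] @ u) (word_inv u @ u)"
    by (rule word_eq.cancel)
  then show ?case using Cons by (auto simp: l word_inv_def intro: word_eq.trans)
qed

lemma group_presented_group: "group (presented_group R)"
proof (rule groupI)
  fix A assume "A \<in> carrier (presented_group R)"
  then obtain u where A: "A = word_class R u" by (auto simp: presented_group_def)
  show "\<exists>B\<in>carrier (presented_group R). B \<otimes>\<^bsub>presented_group R\<^esub> A = \<one>\<^bsub>presented_group R\<^esub>"
    by (rule bexI[of _ "word_class R (word_inv u)"])
      (simp_all add: A presented_group_mult, simp_all add: presented_group_def word_class_eq_iff
        word_inv_left rangeI)
next
  show "\<one>\<^bsub>presented_group R\<^esub> \<in> carrier (presented_group R)"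
    by (simp add: presented_group_def)
next
  fix A assume "A \<in> carrier (presented_group R)"
  then obtain u where A: "A = word_class R u" by (auto simp: presented_group_def)
  have "\<one>\<^bsub>presented_group R\<^esub> = word_class R []" by (simp add: presented_group_def)
  then show "\<one>\<^bsub>presented_group R\<^esub> \<otimes>\<^bsub>presented_group R\<^esub> A = A"
    by (simp add: A presented_group_mult)
next
  fix A B assume "A \<in> carrier (presented_group R)" "B \<in> carrier (presented_group R)"
  then obtain u v where "A = word_class R u" "B = word_class R v"
    by (auto simp: presented_group_def)
  then show "A \<otimes>\<^bsub>presented_group R\<^esub> B \<in> carrier (presented_group R)"
    by (simp add: presented_group_mult) (simp add: presented_group_def)
next
  fix A B C
  assume "A \<in> carrier (presented_group R)" "B \<in> carrier (presented_group R)"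
    "C \<in> carrier (presented_group R)"
  then obtain u v w where "A = word_class R u" "B = word_class R v" "C = word_class R w"
    by (auto simp: presented_group_def)
  then show "A \<otimes>\<^bsub>presented_group R\<^esub> B \<otimes>\<^bsub>presented_group R\<^esub> C =
      A \<otimes>\<^bsub>presented_group R\<^esub> (B \<otimes>\<^bsub>presented_group R\<^esub> C)"
    by (simp add: presented_group_mult)
qed


section \<open>The Heisenberg group and its representation on \<open>V\<close>\<close>

datatype heis_gen = E1 | E2 | Z

text \<open>
  The commutator is $[e_1,e_2] = e_1 e_2 e_1^{-1} e_2^{-1}$; since \<open>z\<close> is central, the convention
  $e_1^{-1} e_2^{-1} e_1 e_2$ defines the same group.
\<close>

definition heis_relators :: "nat \<Rightarrow> heis_gen group_word set" where
  "heis_relators p =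
     {replicate p (E1, True), replicate p (E2, True), replicate p (Z, True),
      [(E1, True), (E2, True), (E1, False), (E2, False), (Z, False)],
      [(Z, True), (E1, True), (Z, False), (E1, False)],
      [(Z, True), (E2, True), (Z, False), (E2, False)]}"

definition heisenberg :: "nat \<Rightarrow> heis_gen group_word set monoid" where
  "heisenberg p = presented_group (heis_relators p)"

definition heis_elem :: "nat \<Rightarrow> heis_gen \<Rightarrow> heis_gen group_word set" where
  "heis_elem p x = word_class (heis_relators p) [(x, True)]"

text \<open>
  A vector $\sum_i v_i x_i$ of \<open>V\<close> is represented by its coordinate function \<open>v\<close>.
\<close>

type_synonym 'p heis_space = "'p mod_ring \<Rightarrow> complex"

definition x_vec :: "'p::prime_card mod_ring \<Rightarrow> 'p heis_space" where
  "x_vec i = (\<lambda>j. if j = i then 1 else 0)"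

definition root_unity :: "'p::prime_card itself \<Rightarrow> complex" where
  "root_unity _ = exp (2 * of_real pi * \<i> / of_nat CARD('p))"

text \<open>
  \<^term>\<open>heis_gen_map\<close> is stated on coordinates: $e_1 x_i = x_{i-1}$ becomes
  $(e_1 v)_i = v_{i+1}$. The action of \<open>z\<close> is forced by $z = [e_1,e_2]$
  (see the lemmas \<open>heis_rep_gen\<close> and \<open>heis_rep_mult\<close> below).
\<close>

fun heis_gen_map :: "heis_gen \<Rightarrow> 'p::prime_card heis_space \<Rightarrow> 'p heis_space" where
  "heis_gen_map E1 v = (\<lambda>i. v (i + 1))"
| "heis_gen_map E2 v = (\<lambda>i. root_unity TYPE('p) ^ nat (to_int_mod_ring i) * v i)"
| "heis_gen_map Z v = (\<lambda>i. root_unity TYPE('p) * v i)"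

fun heis_letter_map :: "heis_gen \<times> bool \<Rightarrow> 'p::prime_card heis_space \<Rightarrow> 'p heis_space" where
  "heis_letter_map (x, True) = heis_gen_map x"
| "heis_letter_map (x, False) = inv_into UNIV (heis_gen_map x)"

definition heis_word_map :: "heis_gen group_word \<Rightarrow> 'p::prime_card heis_space \<Rightarrow> 'p heis_space"
  where "heis_word_map w = foldr (\<circ>) (map heis_letter_map w) id"

definition heis_rep ::
  "heis_gen group_word set \<Rightarrow> 'p::prime_card heis_space \<Rightarrow> 'p heis_space" where
  "heis_rep g = heis_word_map (SOME w. w \<in> g)"

lemma root_unity_power_card: "root_unity TYPE('p::prime_card) ^ CARD('p) = 1"
proof -
  have "root_unity TYPE('p) ^ CARD('p) = exp (of_nat CARD('p) * (2 * of_real pi * \<i> / of_nat CARD('p)))"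
    unfolding root_unity_def by (rule exp_of_nat_mult[symmetric])
  also have "of_nat CARD('p) * (2 * of_real pi * \<i> / of_nat CARD('p)) = 2 * of_real pi * \<i>"
    by (simp add: field_simps)
  finally show ?thesis by simp
qed

lemma root_unity_nonzero: "root_unity TYPE('p::prime_card) \<noteq> 0"
  by (simp add: root_unity_def)

lemma root_unity_power_mod:
  "root_unity TYPE('p::prime_card) ^ (n mod CARD('p)) = root_unity TYPE('p) ^ n"
proof -
  have "root_unity TYPE('p) ^ n
      = root_unity TYPE('p) ^ (CARD('p) * (n div CARD('p)) + n mod CARD('p))" by simp
  also have "\<dots> = root_unity TYPE('p) ^ (n mod CARD('p))"
    by (simp only: power_add power_mult root_unity_power_card power_one mult_1)
  finally show ?thesis by simp
qed

lemma root_unity_power_add: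
  fixes i j :: "'p::prime_card mod_ring"
  shows "root_unity TYPE('p) ^ nat (to_int_mod_ring (i + j)) =
    root_unity TYPE('p) ^ nat (to_int_mod_ring i) * root_unity TYPE('p) ^ nat (to_int_mod_ring j)"
proof -
  have nonneg: "0 \<le> to_int_mod_ring k" for k :: "'p mod_ring"
    using range_to_int_mod_ring[where 'a = 'p] by (metis atLeastLessThan_iff rangeI)
  have "to_int_mod_ring (i + j) = (to_int_mod_ring i + to_int_mod_ring j) mod int CARD('p)"
    by (transfer, simp)
  then have "nat (to_int_mod_ring (i + j)) =
      (nat (to_int_mod_ring i) + nat (to_int_mod_ring j)) mod CARD('p)"
    using nonneg[of i] nonneg[of j] by (simp add: nat_mod_distrib nat_add_distrib)
  then show ?thesis by (simp add: root_unity_power_mod power_add)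
qed

lemma root_unity_power_one:
  "root_unity TYPE('p) ^ nat (to_int_mod_ring (1 :: 'p::prime_card mod_ring)) = root_unity TYPE('p)"
  by simp

lemma bij_heis_gen_map: "bij (heis_gen_map x :: 'p::prime_card heis_space \<Rightarrow> _)"
proof (cases x)
  case E1
  show ?thesis unfolding E1
    by (rule o_bij[of "\<lambda>v i. v (i - 1)"]) (auto simp: fun_eq_iff)
next
  case E2
  show ?thesis unfolding E2
    by (rule o_bij[of "\<lambda>v i. v i / root_unity TYPE('p) ^ nat (to_int_mod_ring i)"])
      (auto simp: fun_eq_iff root_unity_nonzero)
next
  case Z
  show ?thesis unfolding Z
    by (rule o_bij[of "\<lambda>v i. v i / root_unity TYPE('p)"])
      (auto simp: fun_eq_iff root_unity_nonzero)
qed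

lemma bij_heis_letter_map: "bij (heis_letter_map l :: 'p::prime_card heis_space \<Rightarrow> _)"
  by (cases l rule: heis_letter_map.cases) (simp_all add: bij_heis_gen_map bij_imp_bij_inv)

lemma heis_word_map_Nil [simp]: "heis_word_map [] = id"
  by (simp add: heis_word_map_def)

lemma heis_word_map_Cons [simp]: "heis_word_map (l # w) = heis_letter_map l \<circ> heis_word_map w"
  by (simp add: heis_word_map_def)

lemma heis_word_map_append: "heis_word_map (u @ v) = heis_word_map u \<circ> heis_word_map v"
  by (induction u) (simp_all add: o_assoc)

lemma heis_word_map_replicate: "heis_word_map (replicate n l) = heis_letter_map l ^^ n"
  by (induction n) simp_all

lemma heis_gen_map_power_card:
  "(heis_gen_map x ^^ CARD('p)) = (id :: 'p::prime_card heis_space \<Rightarrow> _)"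
proof (cases x)
  case E1
  have "(heis_gen_map E1 ^^ n) v = (\<lambda>i. v (i + of_nat n))" for n and v :: "'p heis_space"
    by (induction n) (simp_all add: algebra_simps)
  moreover have "(of_nat CARD('p) :: 'p mod_ring) = 0"
    by (metis of_nat_of_int_mod_ring CARD_mod_ring comp_apply mod_self
      of_int_mod_ring.rep_eq to_int_mod_ring.rep_eq to_int_mod_ring_hom.hom_0_iff)
  ultimately show ?thesis by (auto simp: E1 fun_eq_iff)
next
  case E2
  have "(heis_gen_map E2 ^^ n) v =
      (\<lambda>i. (root_unity TYPE('p) ^ nat (to_int_mod_ring i)) ^ n * v i)" for n and v :: "'p heis_space"
    by (induction n) (simp_all add: algebra_simps)
  moreover have "(root_unity TYPE('p) ^ k) ^ CARD('p) = 1" for k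
    by (metis power_commutes power_mult mult.commute power_one root_unity_power_card)
  ultimately show ?thesis by (auto simp: E2 fun_eq_iff)
next
  case Z
  have "(heis_gen_map Z ^^ n) v = (\<lambda>i. root_unity TYPE('p) ^ n * v i)"
    for n and v :: "'p heis_space"
    by (induction n) (simp_all add: algebra_simps)
  then show ?thesis by (auto simp: Z fun_eq_iff root_unity_power_card)
qed

lemma heis_gen_map_commutator:
  "heis_gen_map E1 \<circ> heis_gen_map E2
     = (heis_gen_map Z \<circ> heis_gen_map E2 \<circ> heis_gen_map E1 :: 'p::prime_card heis_space \<Rightarrow> _)"
  by (auto simp: fun_eq_iff root_unity_power_add)

lemma heis_gen_map_central:
  "heis_gen_map Z \<circ> heis_gen_map x
     = (heis_gen_map x \<circ> heis_gen_map Z :: 'p::prime_card heis_space \<Rightarrow> _)"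
  by (cases x) (auto simp: fun_eq_iff)

lemma heis_word_map_relator:
  assumes "r \<in> heis_relators CARD('p)"
  shows "heis_word_map r = (id :: 'p::prime_card heis_space \<Rightarrow> _)"
proof -
  have inv_r: "heis_gen_map x (inv_into UNIV (heis_gen_map x) v) = v"
    for x and v :: "'p heis_space"
    by (simp add: bij_heis_gen_map bij_is_surj surj_f_inv_f)
  have comm: "heis_gen_map E1 (heis_gen_map E2 v)
      = heis_gen_map Z (heis_gen_map E2 (heis_gen_map E1 v))" for v :: "'p heis_space"
    using fun_cong[OF heis_gen_map_commutator, of v] by (simp del: heis_gen_map.simps)
  have central: "heis_gen_map Z (heis_gen_map x v) = heis_gen_map x (heis_gen_map Z v)"
    for x and v :: "'p heis_space"
    using fun_cong[OF heis_gen_map_central, of x v] by (simp del: heis_gen_map.simps)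
  note [simp del] = heis_gen_map.simps
  show ?thesis
    using assms unfolding heis_relators_def
    by (auto simp: heis_word_map_replicate heis_gen_map_power_card comm central inv_r fun_eq_iff)
qed

lemma heis_word_map_cong:
  "word_eq (heis_relators CARD('p)) u v \<Longrightarrow>
     heis_word_map u = (heis_word_map v :: 'p::prime_card heis_space \<Rightarrow> _)"
proof (induction rule: word_eq.induct)
  case (cancel u x b v)
  have "heis_letter_map (x, b) \<circ> heis_letter_map (x, \<not> b) = (id :: 'p heis_space \<Rightarrow> _)"
    by (cases b) (auto simp: fun_eq_iff bij_heis_gen_map bij_is_surj bij_is_inj surj_f_inv_f
        simp del: heis_gen_map.simps)
  then have "heis_word_map [(x, b), (x, \<not> b)] = (id :: 'p heis_space \<Rightarrow> _)" by simp
  then show ?case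
    by (simp only: heis_word_map_append) simp
next
  case (relator r u v)
  then show ?case by (simp add: heis_word_map_append heis_word_map_relator)
qed simp_all

lemma heis_rep_word_class:
  "heis_rep (word_class (heis_relators CARD('p)) u)
     = (heis_word_map u :: 'p::prime_card heis_space \<Rightarrow> _)"
  unfolding heis_rep_def using heis_word_map_cong[OF word_eq_some] by metis

lemma heis_rep_mult:
  assumes "g \<in> carrier (heisenberg CARD('p))" "h \<in> carrier (heisenberg CARD('p))"
  shows "heis_rep (g \<otimes>\<^bsub>heisenberg CARD('p)\<^esub> h)
     = (heis_rep g \<circ> heis_rep h :: 'p::prime_card heis_space \<Rightarrow> _)"
proof -
  obtain u v where
    "g = word_class (heis_relators CARD('p)) u" "h = word_class (heis_relators CARD('p)) v"
    using assms by (auto simp: heisenberg_def presented_group_def)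
  then show ?thesis
    by (simp add: heisenberg_def presented_group_mult heis_rep_word_class heis_word_map_append)
qed

lemma heis_rep_gen:
  "heis_rep (heis_elem CARD('p) E1) (x_vec i) = x_vec (i - 1 :: 'p::prime_card mod_ring)"
  "heis_rep (heis_elem CARD('p) E2) (x_vec i) =
     (\<lambda>j. root_unity TYPE('p) ^ nat (to_int_mod_ring i) * x_vec i j)"
  by (auto simp: heis_elem_def heis_rep_word_class x_vec_def fun_eq_iff)


section \<open>Free algebras and polynomial rings as monoid algebras\<close>

text \<open>
  \<open>'m \<Rightarrow>\<^sub>0 complex\<close> is the complex monoid algebra of an (additively written) monoid \<open>'m\<close>.
  For the free monoid this is the free algebra, for \<open>'i \<Rightarrow>\<^sub>0 nat\<close> the polynomial ring.
\<close>

datatype 'i free_mon = Free_Mon (letters: "'i list")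

instantiation free_mon :: (type) monoid_add
begin

definition zero_free_mon :: "'i free_mon" where
  "zero_free_mon = Free_Mon []"

definition plus_free_mon :: "'i free_mon \<Rightarrow> 'i free_mon \<Rightarrow> 'i free_mon" where
  "plus_free_mon u v = Free_Mon (letters u @ letters v)"

instance
  by standard (auto simp: zero_free_mon_def plus_free_mon_def)

end

type_synonym 'i free_alg = "'i free_mon \<Rightarrow>\<^sub>0 complex"
type_synonym 'i poly_alg = "('i \<Rightarrow>\<^sub>0 nat) \<Rightarrow>\<^sub>0 complex"

definition scal :: "complex \<Rightarrow> ('m::monoid_add \<Rightarrow>\<^sub>0 complex)" where
  "scal c = Poly_Mapping.single 0 c"

definition free_var :: "'i \<Rightarrow> 'i free_alg" where
  "free_var i = Poly_Mapping.single (Free_Mon [i]) 1"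

definition poly_var :: "'i \<Rightarrow> 'i poly_alg" where
  "poly_var i = Poly_Mapping.single (Poly_Mapping.single i 1) 1"

definition monoid_algebra :: "(complex, 'm::monoid_add \<Rightarrow>\<^sub>0 complex) module" where
  "monoid_algebra =
    \<lparr>carrier = UNIV, monoid.mult = (*), one = 1, zero = 0, add = (+),
     module.smult = (\<lambda>c f. scal c * f)\<rparr>"

definition free_component :: "nat \<Rightarrow> 'i free_alg set" where
  "free_component n = {f. \<forall>w\<in>Poly_Mapping.keys f. length (letters w) = n}"

definition poly_component :: "nat \<Rightarrow> ('i::finite) poly_alg set" where
  "poly_component n = {f. \<forall>m\<in>Poly_Mapping.keys f. (\<Sum>i\<in>UNIV. Poly_Mapping.lookup m i) = n}"

text \<open>The algebra endomorphisms with $x_i \mapsto v_i$.\<close>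

definition free_subst :: "('i \<Rightarrow> 'i free_alg) \<Rightarrow> 'i free_alg \<Rightarrow> 'i free_alg" where
  "free_subst v f =
     (\<Sum>w\<in>Poly_Mapping.keys f. scal (Poly_Mapping.lookup f w) * prod_list (map v (letters w)))"

definition poly_subst ::
  "('i::finite \<Rightarrow> 'i poly_alg) \<Rightarrow> 'i poly_alg \<Rightarrow> 'i poly_alg" where
  "poly_subst v f =
     (\<Sum>m\<in>Poly_Mapping.keys f.
        scal (Poly_Mapping.lookup f m) * (\<Prod>i\<in>UNIV. v i ^ Poly_Mapping.lookup m i))"

definition free_act ::
  "heis_gen group_word set \<Rightarrow> 'p::prime_card mod_ring free_alg \<Rightarrow> 'p mod_ring free_alg" where
  "free_act g = free_subst (\<lambda>i. \<Sum>j\<in>UNIV. scal (heis_rep g (x_vec i) j) * free_var j)"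

definition poly_act ::
  "heis_gen group_word set \<Rightarrow> 'p::prime_card mod_ring poly_alg \<Rightarrow> 'p mod_ring poly_alg" where
  "poly_act g = poly_subst (\<lambda>i. \<Sum>j\<in>UNIV. scal (heis_rep g (x_vec i) j) * poly_var j)"

lemma free_subst_var: "free_subst v (free_var i) = v i"
  by (simp add: free_subst_def free_var_def scal_def single_one)

lemma poly_subst_var: "poly_subst v (poly_var i) = v i"
proof -
  have "(\<Prod>j\<in>UNIV. v j ^ Poly_Mapping.lookup (Poly_Mapping.single i 1) j)
      = (\<Prod>j\<in>UNIV. if j = i then v j else 1)"
    by (rule prod.cong) (auto simp: lookup_single)
  then show ?thesis
    by (simp add: poly_subst_def poly_var_def scal_def single_one)
qed

lemma sum_x_vec: "(\<Sum>j\<in>UNIV. scal (c * x_vec i j) * f j) = scal c * f i"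
proof -
  have "(\<Sum>j\<in>UNIV. scal (c * x_vec i j) * f j) = (\<Sum>j\<in>UNIV. if j = i then scal c * f j else 0)"
    by (rule sum.cong) (auto simp: x_vec_def scal_def)
  then show ?thesis by simp
qed

lemma free_act_gen:
  "free_act (heis_elem CARD('p) E1) (free_var i) = free_var (i - 1 :: 'p::prime_card mod_ring)"
  "free_act (heis_elem CARD('p) E2) (free_var i) =
     scal (root_unity TYPE('p) ^ nat (to_int_mod_ring i)) * free_var i"
  using sum_x_vec[of 1 "i - 1" free_var]
  by (simp_all add: free_act_def free_subst_var heis_rep_gen sum_x_vec scal_def[of 1] single_one)

lemma poly_act_gen:
  "poly_act (heis_elem CARD('p) E1) (poly_var i) = poly_var (i - 1 :: 'p::prime_card mod_ring)"
  "poly_act (heis_elem CARD('p) E2) (poly_var i) =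
     scal (root_unity TYPE('p) ^ nat (to_int_mod_ring i)) * poly_var i"
  using sum_x_vec[of 1 "i - 1" poly_var]
  by (simp_all add: poly_act_def poly_subst_var heis_rep_gen sum_x_vec scal_def[of 1] single_one)

lemma ring_monoid_algebra: "ring monoid_algebra"
  by (rule ringI)
    (auto simp: monoid_algebra_def algebra_simps Units_def
      intro!: abelian_groupI monoidI exI[of _ "- x" for x])

lemma vectorspace_monoid_algebra: "vectorspace class_ring monoid_algebra"
proof -
  interpret ring monoid_algebra by (rule ring_monoid_algebra)
  have "Module.module class_ring monoid_algebra"
    by (rule module.intro)
      (unfold_locales, auto simp: monoid_algebra_def scal_def single_add mult_single
        algebra_simps single_one simp flip: mult.assoc)
  then show ?thesis
    by (simp add: vectorspace_def class_field.field_axioms)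
qed


section \<open>Quotient algebras\<close>

definition quot_algebra :: "('r, 'a) module \<Rightarrow> 'a set \<Rightarrow> ('r, 'a set) module" where
  "quot_algebra A I =
    \<lparr>carrier = carrier (A Quot I), monoid.mult = monoid.mult (A Quot I), one = one (A Quot I),
     zero = zero (A Quot I), add = add (A Quot I),
     module.smult = (\<lambda>c X. \<Union>x\<in>X. I +>\<^bsub>A\<^esub> (c \<odot>\<^bsub>A\<^esub> x))\<rparr>"

definition quot_component :: "('r, 'a) module \<Rightarrow> 'a set \<Rightarrow> (nat \<Rightarrow> 'a set) \<Rightarrow> nat \<Rightarrow> 'a set set" where
  "quot_component A I A_comp n = (\<lambda>x. I +>\<^bsub>A\<^esub> x) ` A_comp n"


section \<open>Clifford algebras\<close>

definition cliff_anticomm :: "'p::prime_card mod_ring \<Rightarrow> 'p mod_ring \<Rightarrow> 'p mod_ring free_alg" where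
  "cliff_anticomm i j = free_var i * free_var j + free_var j * free_var i"

definition clifford_relations :: "(nat \<Rightarrow> complex) \<Rightarrow> 'p::prime_card mod_ring free_alg set" where
  "clifford_relations a =
     {scal (a 0) * cliff_anticomm j (j + of_nat i) - scal (a i) * free_var (j + of_nat i / 2) ^ 2
       | j i. 1 \<le> i \<and> i \<le> (CARD('p) - 1) div 2} \<union>
     {scal (a m) * cliff_anticomm (k - of_nat i / 2) (k + of_nat i / 2)
        - scal (a i) * cliff_anticomm (k - of_nat m / 2) (k + of_nat m / 2)
       | k i m. 1 \<le> i \<and> i \<le> (CARD('p) - 1) div 2 \<and> 1 \<le> m \<and> m \<le> (CARD('p) - 1) div 2}"

definition clifford_ideal :: "(nat \<Rightarrow> complex) \<Rightarrow> 'p::prime_card mod_ring free_alg set" where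
  "clifford_ideal a = Idl\<^bsub>monoid_algebra\<^esub> (clifford_relations a)"

definition clifford :: "(nat \<Rightarrow> complex) \<Rightarrow> (complex, 'p::prime_card mod_ring free_alg set) module"
  where "clifford a = quot_algebra monoid_algebra (clifford_ideal a)"

definition clifford_component ::
  "(nat \<Rightarrow> complex) \<Rightarrow> nat \<Rightarrow> 'p::prime_card mod_ring free_alg set set" where
  "clifford_component a = quot_component monoid_algebra (clifford_ideal a) free_component"

text \<open>
  An element of the Clifford algebra is a coset \<open>f + I\<close>. The action on the free algebra is by
  automorphisms preserving \<open>I\<close>, so its image under \<open>g\<close> is the coset of \<open>g \<cdot> f\<close>.
\<close>

definition clifford_act ::
  "heis_gen group_word set \<Rightarrow> 'p::prime_card mod_ring free_alg set \<Rightarrow> 'p mod_ring free_alg set" where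
  "clifford_act g X = free_act g ` X"

definition clifford_quadric ::
  "(nat \<Rightarrow> complex) \<Rightarrow> 'p::prime_card mod_ring \<Rightarrow> ('p mod_ring \<Rightarrow> complex) \<Rightarrow> complex" where
  "clifford_quadric a k z =
     a 0 * z k ^ 2 + (\<Sum>i = 1..(CARD('p) - 1) div 2. a i * z (k - of_nat i / 2) * z (k + of_nat i / 2))"

text \<open>
  Points of projective space are given by homogeneous coordinates, not all zero. Only the values
  \<open>a 0, \<dots>, a ((p - 1) div 2)\<close> are relevant.
\<close>

definition projective_coords :: "'p::prime_card itself \<Rightarrow> (nat \<Rightarrow> complex) \<Rightarrow> bool" where
  "projective_coords _ a \<longleftrightarrow> (\<exists>i \<le> (CARD('p) - 1) div 2. a i \<noteq> 0)"

definition clifford_regular :: "'p::prime_card itself \<Rightarrow> (nat \<Rightarrow> complex) \<Rightarrow> bool" where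
  "clifford_regular _ a \<longleftrightarrow>
     \<not> (\<exists>z :: 'p mod_ring \<Rightarrow> complex. z \<noteq> (\<lambda>_. 0) \<and> (\<forall>k. clifford_quadric a k z = 0))"


section \<open>Character series\<close>

text \<open>
  Trace of an endomorphism of a finite-dimensional complex vector space: the sum of the diagonal
  coefficients with respect to some (equivalently, any) finite basis.
\<close>

definition basis_coeffs :: "(complex, 'v) module \<Rightarrow> 'v set \<Rightarrow> 'v \<Rightarrow> 'v \<Rightarrow> complex" where
  "basis_coeffs V B v =
     (THE c. c \<in> B \<rightarrow>\<^sub>E UNIV \<and> LinearCombinations.module.lincomb V c B = v)"

definition lin_trace :: "(complex, 'v) module \<Rightarrow> ('v \<Rightarrow> 'v) \<Rightarrow> complex" where
  "lin_trace V f =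
     (let B = (SOME B. finite B \<and> vectorspace.basis class_ring V B)
      in \<Sum>b\<in>B. basis_coeffs V B (f b) b)"

definition char_series ::
  "(complex, 'v) module \<Rightarrow> (nat \<Rightarrow> 'v set) \<Rightarrow> ('g \<Rightarrow> 'v \<Rightarrow> 'v) \<Rightarrow> 'g \<Rightarrow> complex fps" where
  "char_series A A_comp act g = Abs_fps (\<lambda>n. lin_trace (A\<lparr>carrier := A_comp n\<rparr>) (act g))"

definition isomorphic_reps ::
  "('g, 'z) monoid_scheme \<Rightarrow> (complex, 'v) module \<Rightarrow> ('g \<Rightarrow> 'v \<Rightarrow> 'v) \<Rightarrow>
   (complex, 'w) module \<Rightarrow> ('g \<Rightarrow> 'w \<Rightarrow> 'w) \<Rightarrow> bool" where
  "isomorphic_reps G V act_V W act_W \<longleftrightarrow>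
     (\<exists>T. linear_map class_ring V W T \<and> bij_betw T (carrier V) (carrier W) \<and>
       (\<forall>g\<in>carrier G. \<forall>v\<in>carrier V. T (act_V g v) = act_W g (T v)))"

end

theory Submission
  imports Defs "HOL-Computational_Algebra.Fundamental_Theorem_Algebra"
    "HOL-Analysis.Continuum_Not_Denumerable"
begin

text \<open>
  Every element \<open>g\<close> of the Heisenberg group acts on \<open>V\<close> by $x_i \mapsto c_i x_{i-s}$ for a shift \<open>s\<close> and
  certain powers $c_i$ of \<open>\<omega>\<close>. If \<open>ev\<close> is the family of its eigenvalues on \<open>V\<close>, then its trace on the
  polynomials of degree \<open>n\<close> is the sum of $\prod_i ev_i^{e_i}$ over the exponent vectors \<open>e\<close> of sum \<open>n\<close>,
  because the monomials in an eigenbasis of \<open>V\<close> are eigenvectors (\<open>poly_trace\<close>). The theorem holds because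
  the Clifford algebra gives the same sum (\<open>clifford_trace\<close>).
  
  Put \<open>\<alpha> 0 = 2 a\<^sub>0\<close> and let \<open>\<alpha> d\<close> be the parameter with index \<open>d\<close> or \<open>-d\<close> otherwise. The relations say that the
  products \<open>x\<^sub>i x\<^sub>j + x\<^sub>j x\<^sub>i\<close> with the same midpoint are proportional:
  \<open>x\<^sub>i x\<^sub>j + x\<^sub>j x\<^sub>i = \<alpha> (i - j) y\<^sub>k\<close>, where \<open>k = (i + j) / 2\<close> and \<open>y\<^sub>k\<close> has degree two (\<open>anticomm_y\<close>).
  Suppose that the \<open>y\<^sub>k\<close> are central. Then words in the \<open>x\<^sub>i\<close> can be sorted, and the normal monomials, the
  ordered products of the \<open>y\<^sub>i ^ (e\<^sub>i div 2) * x\<^sub>i ^ (e\<^sub>i mod 2)\<close>, span the degree given by the sum of \<open>e\<close>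
  (\<open>generators_span\<close>). They are independent, as one sees in a representation on the exterior algebra over the
  polynomial ring in the \<open>y\<^sub>k\<close>, where \<open>x\<^sub>i\<close> acts as an exterior product plus a contraction (\<open>dual_nmon\<close>).
  The spanning argument works for any linearly transformed generators. Now \<open>g\<close> maps \<open>y\<^sub>i\<close> to a multiple of
  \<open>y\<^sub>i\<^sub>-\<^sub>s\<close> by the factor \<open>c\<^sub>i\<^sup>2\<close>, so that the span of the \<open>y\<^sub>i\<close> has an eigenbasis with the eigenvalues
  \<open>ev\<^sub>i\<^sup>2\<close> (\<open>eigen_matrices\<close>; for a nonzero shift this uses that \<open>p\<close> is odd). The normal monomials in
  eigenvectors are then eigenvectors with the eigenvalues $\prod_i ev_i^{e_i}$, and they form a basis since
  they span and have the same number as the independent family above.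
  
  The point that needs regularity is the centrality of the \<open>y\<^sub>k\<close> (\<open>y_central\<close>). For a linear functional \<open>\<phi>\<close>
  that vanishes on the ideal, the numbers \<open>c k l = \<phi> (y\<^sub>k x\<^sub>l - x\<^sub>l y\<^sub>k)\<close> satisfy, by an identity of Jacobi
  type, \<open>\<Sum>\<^sub>k q\<^sub>k (\<Sum>\<^sub>l c k l z\<^sub>l) = 0\<close>: they are a linear syzygy of the quadrics \<open>q\<^sub>k\<close>. But \<open>p\<close> quadrics in \<open>p\<close>
  variables without a common zero in projective space have no linear syzygies (\<open>no_linear_syzygies\<close>),
  since all syzygies come from the Koszul complex and thus have coefficients of degree at least two. The
  exactness of that complex is derived from the Nullstellensatz, which provides powers of all variables
  in the ideal of the quadrics.
\<close>

section \<open>Traces and eigenvectors\<close>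

locale complex_space = vectorspace "class_ring :: complex ring" W
  for W :: "(complex, 'v) module"
begin

definition linear_form :: "('v \<Rightarrow> complex) \<Rightarrow> bool" where
  "linear_form \<phi> \<longleftrightarrow>
     (\<forall>x\<in>carrier W. \<forall>y\<in>carrier W. \<phi> (x \<oplus>\<^bsub>W\<^esub> y) = \<phi> x + \<phi> y) \<and>
     (\<forall>c. \<forall>x\<in>carrier W. \<phi> (c \<odot>\<^bsub>W\<^esub> x) = c * \<phi> x)"

lemma linear_form_lincomb:
  assumes "linear_form \<phi>" "finite A" "A \<subseteq> carrier W"
  shows "\<phi> (lincomb a A) = (\<Sum>x\<in>A. a x * \<phi> x)"
  using assms(2,3)
proof (induction A)
  case empty
  have "\<phi> (0 \<odot>\<^bsub>W\<^esub> \<zero>\<^bsub>W\<^esub>) = 0 * \<phi> \<zero>\<^bsub>W\<^esub>"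
    using assms(1) unfolding linear_form_def by blast
  then have "\<phi> \<zero>\<^bsub>W\<^esub> = 0" by simp
  then show ?case by (simp add: lincomb_def)
next
  case (insert v A)
  have l: "lincomb a (A \<union> {v}) = a v \<odot>\<^bsub>W\<^esub> v \<oplus>\<^bsub>W\<^esub> lincomb a A"
    by (rule lincomb_insert) (use insert in auto)
  have "lincomb a A \<in> carrier W" using insert by (intro lincomb_closed) auto
  moreover have "a v \<odot>\<^bsub>W\<^esub> v \<in> carrier W" using insert by (intro smult_closed) auto
  ultimately have "\<phi> (a v \<odot>\<^bsub>W\<^esub> v \<oplus>\<^bsub>W\<^esub> lincomb a A) = a v * \<phi> v + \<phi> (lincomb a A)"
    using assms(1) insert.prems unfolding linear_form_def by auto
  then show ?case using l insert by simp
qed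

lemma basis_coeffs_unique:
  assumes "finite B" "basis B" "v \<in> carrier W"
  shows "\<exists>!c. c \<in> B \<rightarrow>\<^sub>E UNIV \<and> lincomb c B = v"
  using basis_criterion[of B] assms by (auto simp: basis_def)

lemma lincomb_basis_coeffs:
  assumes "finite B" "basis B" "v \<in> carrier W"
  shows "lincomb (basis_coeffs W B v) B = v"
  using theI'[OF basis_coeffs_unique[OF assms]] unfolding basis_coeffs_def by blast

lemma basis_coeffs_eqI:
  assumes "finite B" "basis B" "lincomb c B = v" "b \<in> B"
  shows "basis_coeffs W B v b = c b"
proof -
  have B: "B \<subseteq> carrier W" using assms(2) by (simp add: basis_def)
  have eq: "lincomb (restrict c B) B = lincomb c B"
    by (rule lincomb_cong) (use B in auto)
  have v: "v \<in> carrier W" unfolding assms(3)[symmetric] by (rule lincomb_closed) (use B in auto)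
  have "basis_coeffs W B v = restrict c B"
    unfolding basis_coeffs_def
    by (rule the1_equality[OF basis_coeffs_unique[OF assms(1,2) v]]) (use eq assms(3) in auto)
  then show ?thesis using assms(4) by simp
qed

lemma basis_coeffs_linear:
  assumes "finite B" "basis B" "b \<in> B"
  shows "linear_form (\<lambda>v. basis_coeffs W B v b)"
proof -
  have B: "B \<subseteq> carrier W" using assms(2) by (simp add: basis_def)
  show ?thesis unfolding linear_form_def
  proof (intro conjI ballI allI)
    fix x y assume "x \<in> carrier W" "y \<in> carrier W"
    then have "lincomb (\<lambda>v. basis_coeffs W B x v + basis_coeffs W B y v) B = x \<oplus>\<^bsub>W\<^esub> y"
      using lincomb_sum[OF assms(1) B, of "basis_coeffs W B x" "basis_coeffs W B y"]
      by (simp add: lincomb_basis_coeffs assms)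
    then show "basis_coeffs W B (x \<oplus>\<^bsub>W\<^esub> y) b = basis_coeffs W B x b + basis_coeffs W B y b"
      using assms by (intro basis_coeffs_eqI)
  next
    fix c x assume "x \<in> carrier W"
    then have "lincomb (\<lambda>v. c * basis_coeffs W B x v) B = c \<odot>\<^bsub>W\<^esub> x"
      using lincomb_smult[OF B, of "basis_coeffs W B x" c]
      by (simp add: lincomb_basis_coeffs assms)
    then show "basis_coeffs W B (c \<odot>\<^bsub>W\<^esub> x) b = c * basis_coeffs W B x b"
      using assms by (intro basis_coeffs_eqI)
  qed
qed

lemma basis_coeffs_basis:
  assumes "finite B" "basis B" "b \<in> B" "b' \<in> B"
  shows "basis_coeffs W B b b' = (if b = b' then 1 else 0)"
proof (rule basis_coeffs_eqI[OF assms(1,2) _ assms(4)])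
  have B: "B \<subseteq> carrier W" using assms(2) by (simp add: basis_def)
  have "lincomb (\<lambda>b'. if b = b' then 1 else 0) B
      = (\<Oplus>\<^bsub>W\<^esub>v\<in>B. if v = b then v else \<zero>\<^bsub>W\<^esub>)"
    unfolding lincomb_def using B smult_one lmult_0
    by (intro finsum_cong2) auto
  also have "\<dots> = b"
    using M.add.finprod_singleton_swap[of b B "\<lambda>v. v"] assms B by auto
  finally show "lincomb (\<lambda>b'. if b = b' then 1 else 0) B = b" .
qed

text \<open>
  The trace is defined with some unspecified basis \<open>D\<close>. Expanding the elements of \<open>D\<close> in an eigenbasis \<open>B\<close>
  and exchanging the two sums leaves the coefficients of \<open>b\<close> in itself.
\<close>

lemma lin_trace_eigenbasis:
  assumes B: "finite B" "basis B"
    and f: "f \<in> carrier W \<rightarrow> carrier W"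
      "\<And>x y. x \<in> carrier W \<Longrightarrow> y \<in> carrier W \<Longrightarrow> f (x \<oplus>\<^bsub>W\<^esub> y) = f x \<oplus>\<^bsub>W\<^esub> f y"
      "\<And>c x. x \<in> carrier W \<Longrightarrow> f (c \<odot>\<^bsub>W\<^esub> x) = c \<odot>\<^bsub>W\<^esub> f x"
    and eigen: "\<And>b. b \<in> B \<Longrightarrow> f b = ev b \<odot>\<^bsub>W\<^esub> b"
  shows "lin_trace W f = (\<Sum>b\<in>B. ev b)"
proof -
  define D where "D = (SOME B. finite B \<and> basis B)"
  have "finite D \<and> basis D" unfolding D_def by (rule someI[of _ B]) (use B in simp)
  then have D: "finite D" "basis D" by auto
  have BW: "B \<subseteq> carrier W" and DW: "D \<subseteq> carrier W" using B D by (auto simp: basis_def)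
  let ?c = "basis_coeffs W B" and ?d = "basis_coeffs W D"
  have "?d (f d) d = (\<Sum>b\<in>B. ?c d b * (ev b * ?d b d))" if d: "d \<in> D" for d
  proof -
    have lin: "linear_form (\<lambda>v. ?d v d)" by (rule basis_coeffs_linear[OF D d])
    then have "linear_form (\<lambda>v. ?d (f v) d)"
      using f unfolding linear_form_def by (auto simp: Pi_iff)
    from linear_form_lincomb[OF this B(1) BW, of "?c d"]
    have "?d (f d) d = (\<Sum>b\<in>B. ?c d b * ?d (f b) d)"
      using lincomb_basis_coeffs[OF B] d DW by auto
    also have "\<dots> = (\<Sum>b\<in>B. ?c d b * (ev b * ?d b d))"
      using lin BW eigen unfolding linear_form_def by (intro sum.cong) auto
    finally show ?thesis .
  qed
  then have "(\<Sum>d\<in>D. ?d (f d) d) = (\<Sum>d\<in>D. \<Sum>b\<in>B. ?c d b * (ev b * ?d b d))" by simp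
  also have "\<dots> = (\<Sum>b\<in>B. ev b * (\<Sum>d\<in>D. ?d b d * ?c d b))"
    by (subst sum.swap) (simp add: sum_distrib_left mult_ac)
  also have "\<dots> = (\<Sum>b\<in>B. ev b)"
  proof (rule sum.cong[OF HOL.refl])
    fix b assume b: "b \<in> B"
    have "(\<Sum>d\<in>D. ?d b d * ?c d b) = ?c (lincomb (?d b) D) b"
      using linear_form_lincomb[OF basis_coeffs_linear[OF B b] D(1) DW] by simp
    also have "lincomb (?d b) D = b" using lincomb_basis_coeffs[OF D] b BW by auto
    finally show "ev b * (\<Sum>d\<in>D. ?d b d * ?c d b) = ev b"
      using basis_coeffs_basis[OF B b b] by simp
  qed
  finally show ?thesis unfolding lin_trace_def D_def by (simp add: Let_def)
qed

lemma dual_family_independent: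
  assumes E: "finite E" and w: "\<And>e. e \<in> E \<Longrightarrow> w e \<in> carrier W"
    and \<phi>: "\<And>e. e \<in> E \<Longrightarrow> linear_form (\<phi> e)"
    and dual: "\<And>e e'. e \<in> E \<Longrightarrow> e' \<in> E \<Longrightarrow> \<phi> e (w e') = (if e = e' then 1 else 0)"
  shows "inj_on w E \<and> lin_indpt (w ` E)"
proof
  show inj: "inj_on w E"
  proof (rule inj_onI)
    fix e e' assume "e \<in> E" "e' \<in> E" "w e = w e'"
    then show "e = e'" using dual[of e e] dual[of e e'] by (auto split: if_splits)
  qed
  show "lin_indpt (w ` E)"
  proof (rule finite_lin_indpt2)
    fix a assume z: "lincomb a (w ` E) = \<zero>\<^bsub>W\<^esub>"
    have "a (w e) = 0" if e: "e \<in> E" for e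
    proof -
      have "w ` E \<subseteq> carrier W" using w by auto
      then have "\<phi> e (lincomb a (w ` E)) = (\<Sum>x\<in>w ` E. a x * \<phi> e x)"
        using linear_form_lincomb[OF \<phi>[OF e], of "w ` E" a] E by simp
      also have "\<dots> = (\<Sum>e'\<in>E. a (w e') * \<phi> e (w e'))"
        by (simp add: sum.reindex[OF inj])
      also have "\<dots> = (\<Sum>e'\<in>E. if e = e' then a (w e') else 0)"
        using dual[OF e] by (intro sum.cong) auto
      also have "\<dots> = a (w e)" unfolding sum.delta'[OF E] by (simp only: e if_True)
      finally have "a (w e) = \<phi> e \<zero>\<^bsub>W\<^esub>" by (simp only: z)
      also have "\<dots> = 0" using linear_form_lincomb[OF \<phi>[OF e], of "{}" a] by (simp add: lincomb_def)
      finally show ?thesis .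
    qed
    then show "\<forall>v\<in>w ` E. a v = \<zero>\<^bsub>class_ring\<^esub>" by simp
  qed (use w E in auto)
qed

text \<open>
  The eigenvectors \<open>u\<close> span and the unrelated family \<open>w\<close> is independent, as witnessed by dual forms. Both
  are indexed by the same set, so that \<open>u\<close> is a basis by counting. In this way the independence may be
  checked for a family that is more convenient than the eigenvectors.
\<close>

lemma lin_trace_spanning_eigenvectors:
  assumes E: "finite E" and u: "\<And>e. e \<in> E \<Longrightarrow> u e \<in> carrier W"
    and gen: "carrier W \<subseteq> span (u ` E)"
    and w: "\<And>e. e \<in> E \<Longrightarrow> w e \<in> carrier W"
    and \<phi>: "\<And>e. e \<in> E \<Longrightarrow> linear_form (\<phi> e)"
    and dual: "\<And>e e'. e \<in> E \<Longrightarrow> e' \<in> E \<Longrightarrow> \<phi> e (w e') = (if e = e' then 1 else 0)"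
    and f: "f \<in> carrier W \<rightarrow> carrier W"
      "\<And>x y. x \<in> carrier W \<Longrightarrow> y \<in> carrier W \<Longrightarrow> f (x \<oplus>\<^bsub>W\<^esub> y) = f x \<oplus>\<^bsub>W\<^esub> f y"
      "\<And>c x. x \<in> carrier W \<Longrightarrow> f (c \<odot>\<^bsub>W\<^esub> x) = c \<odot>\<^bsub>W\<^esub> f x"
    and eigen: "\<And>e. e \<in> E \<Longrightarrow> f (u e) = ev e \<odot>\<^bsub>W\<^esub> u e"
  shows "lin_trace W f = (\<Sum>e\<in>E. ev e)"
proof -
  have uW: "u ` E \<subseteq> carrier W" using u by auto
  have gen': "span (u ` E) = carrier W"
    using gen span_is_subset2[OF uW] by auto
  have fd: fin_dim unfolding fin_dim_def using E uW gen' by auto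
  have ind: "inj_on w E" "lin_indpt (w ` E)"
    using dual_family_independent[OF E w \<phi> dual] by auto
  have "card E = card (w ` E)" using ind by (simp add: card_image)
  also have "\<dots> \<le> dim" using li_le_dim[OF fd _ ind(2)] w by auto
  finally have le: "card E \<le> dim" .
  have "card (u ` E) \<le> dim" using le card_image_le[OF E, of u] by linarith
  then have bas: "basis (u ` E)" using dim_gen_is_basis[OF _ uW gen'] E by simp
  have "dim = card (u ` E)" using dim_basis[OF _ bas] E by simp
  then have inj: "inj_on u E" using le E card_image_le[OF E, of u] by (intro eq_card_imp_inj_on) auto
  have "lin_trace W f = (\<Sum>b\<in>u ` E. ev (the_inv_into E u b))"
    by (rule lin_trace_eigenbasis[OF _ bas f])
      (use E eigen inj in \<open>auto simp: the_inv_into_f_f\<close>)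
  then show ?thesis by (simp add: sum.reindex[OF inj] the_inv_into_f_f[OF inj])
qed

end

section \<open>Monoid algebras as vector spaces\<close>

lemma poly_mapping_sum_single: "(\<Sum>m\<in>Poly_Mapping.keys f. Poly_Mapping.single m (Poly_Mapping.lookup f m)) = f"
  by (rule poly_mapping_eqI) (simp add: lookup_sum lookup_single when_def in_keys_iff)

lemma scal_0 [simp]: "scal 0 = 0"
  and scal_1 [simp]: "scal 1 = 1"
  and scal_add: "scal (a + b) = scal a + scal b"
  and scal_diff: "scal (a - b) = scal a - scal b"
  and scal_uminus: "scal (- a) = - scal a"
  and scal_mult: "scal (a * b) = scal a * scal b"
  by (simp_all add: scal_def single_add single_diff single_uminus mult_single)

lemma lookup_scal_mult [simp]:
  "Poly_Mapping.lookup (scal c * f) m = c * Poly_Mapping.lookup f m"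
  unfolding scal_def mult_map_scale_conv_mult[symmetric]
  by (simp add: Poly_Mapping.map.rep_eq when_def)

lemma scal_single: "scal c * Poly_Mapping.single m d = Poly_Mapping.single m (c * d)"
  by (simp add: scal_def mult_single)

lemma scal_commute: "f * scal c = scal c * (f :: 'm::monoid_add \<Rightarrow>\<^sub>0 complex)"
proof -
  let ?g = "\<lambda>m. Poly_Mapping.single m (Poly_Mapping.lookup f m)"
  have "(\<Sum>m\<in>Poly_Mapping.keys f. ?g m) * scal c = scal c * (\<Sum>m\<in>Poly_Mapping.keys f. ?g m)"
    by (simp add: sum_distrib_left sum_distrib_right scal_def mult_single mult.commute)
  then show ?thesis using poly_mapping_sum_single[of f] by simp
qed

interpretation alg: vector_space "\<lambda>c (f :: 'm::monoid_add \<Rightarrow>\<^sub>0 complex). scal c * f"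
  by unfold_locales (simp_all add: distrib_left distrib_right scal_add scal_mult mult.assoc)

declare alg.scale_scale [simp del]

section \<open>Hilbert's Nullstellensatz over the complex numbers\<close>

interpretation idl: Modules.module "(*) :: 'a::comm_ring_1 \<Rightarrow> 'a \<Rightarrow> 'a"
  by unfold_locales (simp_all add: distrib_left distrib_right mult.assoc)

declare idl.scale_scale [simp del]

lemma maximal_ideal_exists:
  fixes I :: "'a::comm_ring_1 set"
  assumes "idl.subspace I" "1 \<notin> I"
  obtains K where "idl.subspace K" "I \<subseteq> K" "1 \<notin> K"
    "\<And>L. idl.subspace L \<Longrightarrow> K \<subseteq> L \<Longrightarrow> 1 \<notin> L \<Longrightarrow> L = K"
proof -
  let ?A = "{K. idl.subspace K \<and> I \<subseteq> K \<and> 1 \<notin> K}"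
  have "\<exists>M\<in>?A. \<forall>X\<in>?A. M \<subseteq> X \<longrightarrow> X = M"
  proof (rule subset_Zorn_nonempty)
    have "I \<in> ?A" using assms by simp
    then show "?A \<noteq> {}" by blast
    fix C assume C: "C \<noteq> {}" "subset.chain ?A C"
    from C(2) have sub: "C \<subseteq> ?A" unfolding subset_chain_def by blast
    from C(2) have ch: "X \<subseteq> Y \<or> Y \<subseteq> X" if "X \<in> C" "Y \<in> C" for X Y
      using that unfolding subset_chain_def by blast
    obtain X0 where X0: "X0 \<in> C" using C(1) by blast
    have "idl.subspace (\<Union>C)"
      unfolding idl.subspace_def
    proof (intro conjI ballI allI)
      have "idl.subspace X0" using X0 sub by blast
      then show "0 \<in> \<Union>C" using X0 idl.subspace_0[of X0] by blast
      fix x y assume "x \<in> \<Union>C" "y \<in> \<Union>C"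
      then obtain X Y where "X \<in> C" "x \<in> X" "Y \<in> C" "y \<in> Y" by auto
      then obtain Z where "Z \<in> C" "x \<in> Z" "y \<in> Z" using ch[of X Y] by blast
      moreover from this(1) have "idl.subspace Z" using sub by blast
      ultimately show "x + y \<in> \<Union>C" using idl.subspace_add[of Z x y] by blast
    next
      fix c x assume "x \<in> \<Union>C"
      then obtain X where "X \<in> C" "x \<in> X" by auto
      moreover from this(1) have "idl.subspace X" using sub by blast
      ultimately show "c * x \<in> \<Union>C" using idl.subspace_scale[of X x c] by blast
    qed
    moreover have "I \<subseteq> \<Union>C" using X0 sub by blast
    moreover have "1 \<notin> \<Union>C" using sub by blast
    ultimately show "\<Union>C \<in> ?A" by (intro CollectI conjI)
  qed
  then obtain K where K: "K \<in> ?A" and max: "\<forall>X\<in>?A. K \<subseteq> X \<longrightarrow> X = K" by (rule bexE)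
  show thesis
  proof (rule that[of K])
    fix L assume L: "idl.subspace L" "K \<subseteq> L" "1 \<notin> L"
    have "L \<in> ?A" using L K by blast
    then show "L = K" using L(2) max by (metis (no_types, lifting))
  qed (use K in simp_all)
qed

lemma maximal_ideal_inverse:
  fixes K :: "'a::comm_ring_1 set"
  assumes K: "idl.subspace K"
    and max: "\<And>L. idl.subspace L \<Longrightarrow> K \<subseteq> L \<Longrightarrow> 1 \<notin> L \<Longrightarrow> L = K"
    and t: "t \<notin> K"
  shows "\<exists>u. u * t - 1 \<in> K"
proof -
  let ?L = "{x. \<exists>u. u * t - x \<in> K}"
  have "idl.subspace ?L" unfolding idl.subspace_def
  proof safe
    show "\<exists>u. u * t - 0 \<in> K" using idl.subspace_0[OF K] by (intro exI[of _ 0]) simp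
    fix x y u v assume "u * t - x \<in> K" "v * t - y \<in> K"
    from idl.subspace_add[OF K this] show "\<exists>u. u * t - (x + y) \<in> K"
      by (intro exI[of _ "u + v"]) (simp add: algebra_simps)
  next
    fix c x u assume "u * t - x \<in> K"
    from idl.subspace_scale[OF K this, of c] show "\<exists>u. u * t - c * x \<in> K"
      by (intro exI[of _ "c * u"]) (simp add: algebra_simps)
  qed
  moreover have "K \<subseteq> ?L"
    using idl.subspace_neg[OF K] by (auto intro!: exI[of _ 0])
  moreover have "t \<in> ?L" using idl.subspace_0[OF K] by (auto intro!: exI[of _ 1])
  ultimately have "1 \<in> ?L" using max t by blast
  then show ?thesis by simp
qed

lemma maximal_ideal_prime:
  fixes K :: "'a::comm_ring_1 set"
  assumes K: "idl.subspace K"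
    and max: "\<And>L. idl.subspace L \<Longrightarrow> K \<subseteq> L \<Longrightarrow> 1 \<notin> L \<Longrightarrow> L = K"
    and st: "s * t \<in> K"
  shows "s \<in> K \<or> t \<in> K"
proof (rule disjCI)
  assume "t \<notin> K"
  then obtain u where "u * t - 1 \<in> K" using maximal_ideal_inverse[OF K max] by blast
  then have "s * (u * t - 1) \<in> K" by (rule idl.subspace_scale[OF K])
  moreover have "u * (s * t) \<in> K" by (rule idl.subspace_scale[OF K st])
  ultimately have "u * (s * t) - s * (u * t - 1) \<in> K" by (rule idl.subspace_diff[OF K, rotated])
  then show "s \<in> K" by (simp add: algebra_simps)
qed

interpretation scal_hom: comm_ring_hom "scal :: complex \<Rightarrow> 'm::comm_monoid_add \<Rightarrow>\<^sub>0 complex"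
  by unfold_locales (simp_all add: scal_add scal_mult)

interpretation scal_poly: map_poly_comm_ring_hom "scal :: complex \<Rightarrow> 'm::comm_monoid_add \<Rightarrow>\<^sub>0 complex" ..

lemma map_poly_scal_linear: "map_poly scal [:- r, 1:] = [:- scal r, 1:]"
  by (simp add: map_poly_pCons scal_uminus)

lemma map_poly_scal_const: "map_poly scal [:c:] = [:scal c:]"
  by (cases "c = 0") (simp_all add: map_poly_pCons)

text \<open>
  \<open>K\<close> is prime and \<open>P\<close> splits into linear factors, so that \<open>K\<close> contains one of the factors evaluated at \<open>t\<close>.
\<close>

lemma maximal_ideal_root:
  fixes K :: "('m::comm_monoid_add \<Rightarrow>\<^sub>0 complex) set"
  assumes K: "idl.subspace K" "1 \<notin> K"
    and max: "\<And>L. idl.subspace L \<Longrightarrow> K \<subseteq> L \<Longrightarrow> 1 \<notin> L \<Longrightarrow> L = K"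
    and P: "P \<noteq> 0" "poly (map_poly scal P) t \<in> K"
  shows "\<exists>r. t - scal r \<in> K"
  using P
proof (induction "degree P" arbitrary: P)
  case 0
  then obtain c where c: "P = [:c:]" by (metis degree_0_id)
  then have "scal c \<in> K" "c \<noteq> 0" using 0 by auto
  then have "scal (inverse c) * scal c \<in> K" using idl.subspace_scale[OF K(1)] by blast
  then show ?case using K(2) \<open>c \<noteq> 0\<close> by (simp flip: scal_mult)
next
  case (Suc n)
  then have "\<not> constant (poly P)" by (simp add: constant_degree)
  then obtain r where "poly P r = 0" using fundamental_theorem_of_algebra by blast
  then obtain Q where Q: "P = [:- r, 1:] * Q" by (auto simp: poly_eq_0_iff_dvd)
  have "poly (map_poly scal P) t = (t - scal r) * poly (map_poly scal Q) t"
    unfolding Q scal_poly.hom_mult poly_mult map_poly_scal_linear by simp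
  then have "t - scal r \<in> K \<or> poly (map_poly scal Q) t \<in> K"
    using maximal_ideal_prime[OF K(1) max] Suc.prems(2) by metis
  moreover have "n = degree Q" "Q \<noteq> 0" using Suc.hyps(2) Suc.prems(1) unfolding Q
    by (auto simp: degree_mult_eq simp del: mult_pCons_left)
  ultimately show ?case using Suc.hyps(1)[of Q] by blast
qed

abbreviation mdeg :: "('i::finite \<Rightarrow>\<^sub>0 nat) \<Rightarrow> nat" where
  "mdeg m \<equiv> \<Sum>i\<in>UNIV. Poly_Mapping.lookup m i"

lemma finite_mdeg_le: "finite {m :: 'i::finite \<Rightarrow>\<^sub>0 nat. mdeg m \<le> d}"
proof (rule finite_imageD)
  have "Poly_Mapping.lookup m i \<le> d" if "mdeg m \<le> d" for m :: "'i \<Rightarrow>\<^sub>0 nat" and i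
    using member_le_sum[of i UNIV "Poly_Mapping.lookup m"] that by simp
  then have "Poly_Mapping.lookup ` {m :: 'i \<Rightarrow>\<^sub>0 nat. mdeg m \<le> d} \<subseteq> Pi\<^sub>E UNIV (\<lambda>_. {..d})"
    by (simp add: image_subset_iff PiE_iff)
  then show "finite (Poly_Mapping.lookup ` {m :: 'i \<Rightarrow>\<^sub>0 nat. mdeg m \<le> d})"
    by (rule finite_subset) (simp add: finite_PiE)
  show "inj_on Poly_Mapping.lookup {m :: 'i \<Rightarrow>\<^sub>0 nat. mdeg m \<le> d}"
    by (rule inj_onI) (simp only: poly_mapping_eq_iff)
qed

text \<open>
  Polynomials of bounded degree lie in a space of finite dimension.
\<close>

lemma infinite_bounded_degree_dependent:
  fixes S :: "'i::finite poly_alg set"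
  assumes "infinite S" "\<And>f m. f \<in> S \<Longrightarrow> m \<in> Poly_Mapping.keys f \<Longrightarrow> mdeg m \<le> d"
  shows "alg.dependent S"
proof (rule ccontr)
  assume ind: "alg.independent S"
  let ?T = "(\<lambda>m. Poly_Mapping.single m 1) ` {m :: 'i \<Rightarrow>\<^sub>0 nat. mdeg m \<le> d} :: 'i poly_alg set"
  have "f \<in> alg.span ?T" if "f \<in> S" for f
  proof -
    have "(\<Sum>m\<in>Poly_Mapping.keys f. scal (Poly_Mapping.lookup f m) * Poly_Mapping.single m 1) \<in> alg.span ?T"
      by (intro alg.span_sum alg.span_scale alg.span_base imageI) (simp add: assms(2)[OF that])
    also have "(\<Sum>m\<in>Poly_Mapping.keys f. scal (Poly_Mapping.lookup f m) * Poly_Mapping.single m 1) = f"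
      by (simp add: scal_single poly_mapping_sum_single)
    finally show ?thesis .
  qed
  then have "S \<subseteq> alg.span ?T" by blast
  from alg.independent_span_bound[OF finite_imageI[OF finite_mdeg_le] ind this] assms(1)
  show False by simp
qed

lemma uncountable_complex: "uncountable (UNIV :: complex set)"
proof
  assume "countable (UNIV :: complex set)"
  then have "countable (range Re)" by blast
  moreover have "range Re = UNIV" using Re_complex_of_real by (metis surjI)
  ultimately show False using uncountable_UNIV_real by simp
qed

text \<open>
  The residue field is $\mathbb{C}$, by counting. If no \<open>t - r\<close> lies in \<open>K\<close>, then each has an inverse \<open>u r\<close>
  modulo \<open>K\<close>. As there are uncountably many \<open>r\<close>, infinitely many of the \<open>u r\<close> have degree at most some \<open>d\<close> and
  thus satisfy a linear relation. Clearing the denominators in $\sum_r c_r / (t - r) = 0$ gives a polynomial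
  equation for \<open>t\<close> modulo \<open>K\<close>, which forces some \<open>t - r\<close> to lie in \<open>K\<close>.
\<close>

lemma maximal_ideal_residue_field:
  fixes K :: "'i::finite poly_alg set"
  assumes K: "idl.subspace K" "1 \<notin> K"
    and max: "\<And>L. idl.subspace L \<Longrightarrow> K \<subseteq> L \<Longrightarrow> 1 \<notin> L \<Longrightarrow> L = K"
  shows "\<exists>r. t - scal r \<in> K"
proof (rule ccontr)
  assume "\<not> (\<exists>r. t - scal r \<in> K)"
  then have "\<forall>r. \<exists>u. u * (t - scal r) - 1 \<in> K"
    using maximal_ideal_inverse[OF K(1) max] by blast
  then obtain u where u: "\<And>r. u r * (t - scal r) - 1 \<in> K" by metis
  have inj: "inj u"
  proof (rule injI, rule ccontr)
    fix r s assume eq: "u r = u s" and ne: "r \<noteq> s"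
    have "(u r * (t - scal r) - 1) - (u s * (t - scal s) - 1) \<in> K"
      by (rule idl.subspace_diff[OF K(1) u u])
    then have "scal (s - r) * u s \<in> K" by (simp add: eq algebra_simps scal_diff)
    then have "scal (inverse (s - r)) * (scal (s - r) * u s) \<in> K" by (rule idl.subspace_scale[OF K(1)])
    then have "u s \<in> K" using ne by (simp flip: mult.assoc scal_mult)
    then have "(t - scal s) * u s - (u s * (t - scal s) - 1) \<in> K"
      by (rule idl.subspace_diff[OF K(1) idl.subspace_scale[OF K(1)] u])
    then show False using K(2) by (simp add: mult.commute)
  qed
  let ?B = "\<lambda>d. {r. \<forall>m\<in>Poly_Mapping.keys (u r). mdeg m \<le> d}"
  have "r \<in> ?B (\<Sum>m\<in>Poly_Mapping.keys (u r). mdeg m)" for r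
    by (auto intro: member_le_sum)
  then have "(\<Union>d. ?B d) = UNIV" by blast
  then have "uncountable (\<Union>d. ?B d)" using uncountable_complex by simp
  moreover have "countable (\<Union>d. ?B d)" if "\<And>d. finite (?B d)"
    by (rule countable_UN[OF countableI_type]) (rule countable_finite[OF that])
  ultimately obtain d where "infinite (?B d)" by blast
  then have "infinite (u ` ?B d)" using inj by (meson finite_imageD inj_on_subset subset_UNIV)
  then have "alg.dependent (u ` ?B d)"
    by (rule infinite_bounded_degree_dependent[of _ d]) auto
  then obtain S c v where S: "finite S" "S \<subseteq> u ` ?B d" "(\<Sum>v\<in>S. scal (c v) * v) = 0" "v \<in> S" "c v \<noteq> 0"
    unfolding alg.dependent_explicit by blast
  obtain R where R: "finite R" "S = u ` R" using finite_subset_image[OF S(1,2)] by blast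
  obtain r0 where r0: "r0 \<in> R" "c (u r0) \<noteq> 0" using S(4,5) R(2) by blast
  have rel: "(\<Sum>r\<in>R. scal (c (u r)) * u r) = 0"
    using S(3) unfolding R(2) by (simp add: sum.reindex[OF inj_on_subset[OF inj subset_UNIV]])
  \<comment> \<open>The numerator of \<open>\<Sum>r\<in>R. c (u r) / (X - r)\<close>. It is not zero because its value at \<open>r0\<close> is not.\<close>
  define P where "P = (\<Sum>r\<in>R. [:c (u r):] * (\<Prod>s\<in>R - {r}. [:- s, 1:]))"
  define pr where "pr A = (\<Prod>s\<in>A. t - scal s)" for A
  have "poly P r0 = (\<Sum>r\<in>R. if r = r0 then c (u r0) * (\<Prod>s\<in>R - {r0}. r0 - s) else 0)"
    unfolding P_def poly_sum
  proof (rule sum.cong[OF HOL.refl])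
    fix r assume "r \<in> R"
    show "poly ([:c (u r):] * (\<Prod>s\<in>R - {r}. [:- s, 1:])) r0
        = (if r = r0 then c (u r0) * (\<Prod>s\<in>R - {r0}. r0 - s) else 0)"
      using R(1) r0(1) by (auto simp: poly_prod)
  qed
  then have "poly P r0 = c (u r0) * (\<Prod>s\<in>R - {r0}. r0 - s)" using r0 R by simp
  moreover have "(\<Prod>s\<in>R - {r0}. r0 - s) \<noteq> 0" using R by simp
  ultimately have P0: "P \<noteq> 0" using r0(2) by (metis mult_eq_0_iff poly_0)
  have ev: "poly (map_poly scal P) t = (\<Sum>r\<in>R. scal (c (u r)) * pr (R - {r}))"
    unfolding P_def pr_def scal_poly.hom_sum scal_poly.hom_mult scal_poly.hom_prod
      map_poly_scal_linear map_poly_scal_const poly_sum poly_mult poly_prod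
    by simp
  have "scal (c (u r)) * (u r * pr R - pr (R - {r})) \<in> K" if "r \<in> R" for r
  proof -
    have e: "pr R = (t - scal r) * pr (R - {r})" unfolding pr_def using R that by (simp add: prod.remove)
    have "u r * pr R - pr (R - {r}) = pr (R - {r}) * (u r * (t - scal r) - 1)"
      unfolding e by (simp add: algebra_simps)
    then show ?thesis using u K(1) by (simp add: idl.subspace_scale)
  qed
  then have "(\<Sum>r\<in>R. scal (c (u r)) * (u r * pr R - pr (R - {r}))) \<in> K"
    by (rule idl.subspace_sum[OF K(1)])
  moreover have "(\<Sum>r\<in>R. scal (c (u r)) * (u r * pr R - pr (R - {r}))) =
      (\<Sum>r\<in>R. scal (c (u r)) * u r) * pr R - poly (map_poly scal P) t"
    by (simp add: ev right_diff_distrib sum_subtractf sum_distrib_right mult.assoc)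
  ultimately have "- poly (map_poly scal P) t \<in> K" using rel by simp
  then have "poly (map_poly scal P) t \<in> K" using idl.subspace_neg[OF K(1)] by fastforce
  then have "\<exists>r. t - scal r \<in> K" using maximal_ideal_root[OF K max P0] by blast
  then show False using \<open>\<not> (\<exists>r. t - scal r \<in> K)\<close> by blast
qed

lemma weak_nullstellensatz:
  fixes I :: "'i::finite poly_alg set"
  assumes "idl.subspace I" "1 \<notin> I"
  obtains K z where "idl.subspace K" "I \<subseteq> K" "1 \<notin> K" "\<And>i. poly_var i - scal (z i) \<in> K"
proof -
  obtain K where K: "idl.subspace K" "I \<subseteq> K" "1 \<notin> K"
    "\<And>L. idl.subspace L \<Longrightarrow> K \<subseteq> L \<Longrightarrow> 1 \<notin> L \<Longrightarrow> L = K"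
    using maximal_ideal_exists[OF assms] by blast
  have "\<forall>i. \<exists>r. poly_var i - scal r \<in> K" using maximal_ideal_residue_field K by blast
  then show thesis using that K by metis
qed

section \<open>Substitution homomorphisms and homogeneous components\<close>

text \<open>
  The linear extension of a function on the monoid; it is multiplicative if the function is.
\<close>

definition monoid_lift ::
  "('m::monoid_add \<Rightarrow> 'n::monoid_add \<Rightarrow>\<^sub>0 complex) \<Rightarrow> ('m \<Rightarrow>\<^sub>0 complex) \<Rightarrow> 'n \<Rightarrow>\<^sub>0 complex" where
  "monoid_lift h f = (\<Sum>m\<in>Poly_Mapping.keys f. scal (Poly_Mapping.lookup f m) * h m)"

lemma monoid_lift_superset:
  assumes "finite S" "Poly_Mapping.keys f \<subseteq> S"
  shows "monoid_lift h f = (\<Sum>m\<in>S. scal (Poly_Mapping.lookup f m) * h m)"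
  unfolding monoid_lift_def
  by (rule sum.mono_neutral_left) (use assms in \<open>auto simp: in_keys_iff\<close>)

lemma monoid_lift_single [simp]: "monoid_lift h (Poly_Mapping.single m c) = scal c * h m"
  using monoid_lift_superset[of "{m}" "Poly_Mapping.single m c" h] by simp

lemma monoid_lift_0 [simp]: "monoid_lift h 0 = 0"
  by (simp add: monoid_lift_def)

lemma monoid_lift_add: "monoid_lift h (f + g) = monoid_lift h f + monoid_lift h g"
proof -
  let ?S = "Poly_Mapping.keys f \<union> Poly_Mapping.keys g"
  have "Poly_Mapping.keys (f + g) \<subseteq> ?S" by (rule keys_add)
  then show ?thesis
    by (simp add: monoid_lift_superset[of ?S] lookup_add scal_add distrib_right sum.distrib)
qed

lemma monoid_lift_sum: "monoid_lift h (sum f A) = (\<Sum>a\<in>A. monoid_lift h (f a))"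
  by (induction A rule: infinite_finite_induct) (simp_all add: monoid_lift_add)

lemma monoid_lift_scal: "monoid_lift h (scal c * f) = scal c * monoid_lift h f"
proof -
  have "Poly_Mapping.keys (scal c * f) \<subseteq> Poly_Mapping.keys f"
    by (rule subsetI) (simp add: in_keys_iff)
  then show ?thesis
    by (simp add: monoid_lift_superset[of "Poly_Mapping.keys f"] scal_mult mult.assoc sum_distrib_left)
qed

lemma monoid_lift_diff: "monoid_lift h (f - g) = monoid_lift h f - monoid_lift h g"
  using monoid_lift_add[of h "f - g" g] by (simp add: algebra_simps)

lemma monoid_lift_mult:
  assumes "\<And>m n. h (m + n) = h m * h n"
  shows "monoid_lift h (f * g) = monoid_lift h f * monoid_lift h g"
proof -
  let ?c = "Poly_Mapping.lookup"
  have "monoid_lift h (f * g) = monoid_lift h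
      ((\<Sum>m\<in>Poly_Mapping.keys f. Poly_Mapping.single m (?c f m)) *
       (\<Sum>n\<in>Poly_Mapping.keys g. Poly_Mapping.single n (?c g n)))"
    by (simp only: poly_mapping_sum_single)
  also have "\<dots> = (\<Sum>m\<in>Poly_Mapping.keys f. \<Sum>n\<in>Poly_Mapping.keys g.
      scal (?c f m * ?c g n) * h (m + n))"
    by (simp only: sum_product mult_single monoid_lift_sum monoid_lift_single)
  also have "\<dots> = (\<Sum>m\<in>Poly_Mapping.keys f. \<Sum>n\<in>Poly_Mapping.keys g.
      (scal (?c f m) * h m) * (scal (?c g n) * h n))"
  proof (intro sum.cong HOL.refl)
    fix m n
    have "scal (?c f m) * h m * (scal (?c g n) * h n)
        = scal (?c f m) * (h m * scal (?c g n)) * h n" by (simp only: mult.assoc)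
    also have "\<dots> = scal (?c f m) * (scal (?c g n) * h m) * h n" by (simp only: scal_commute)
    finally show "scal (?c f m * ?c g n) * h (m + n) = scal (?c f m) * h m * (scal (?c g n) * h n)"
      by (simp only: assms scal_mult mult.assoc)
  qed
  also have "\<dots> = monoid_lift h f * monoid_lift h g"
    by (simp only: monoid_lift_def sum_product)
  finally show ?thesis .
qed

definition poly_mon :: "('i::finite \<Rightarrow> 'i poly_alg) \<Rightarrow> ('i \<Rightarrow>\<^sub>0 nat) \<Rightarrow> 'i poly_alg" where
  "poly_mon v m = (\<Prod>i\<in>UNIV. v i ^ Poly_Mapping.lookup m i)"

lemma poly_subst_monoid_lift: "poly_subst v = monoid_lift (poly_mon v)"
  by (rule ext) (simp add: poly_subst_def monoid_lift_def poly_mon_def)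

lemma poly_mon_add: "poly_mon v (m + n) = poly_mon v m * poly_mon v n"
  by (simp add: poly_mon_def lookup_add power_add prod.distrib)

lemma poly_subst_hom:
  "poly_subst v (f + g) = poly_subst v f + poly_subst v g"
  "poly_subst v (f - g) = poly_subst v f - poly_subst v g"
  "poly_subst v (f * g) = poly_subst v f * poly_subst v g"
  "poly_subst v (scal c * f) = scal c * poly_subst v f"
  "poly_subst v (sum F A) = (\<Sum>a\<in>A. poly_subst v (F a))"
  unfolding poly_subst_monoid_lift
  by (simp_all add: monoid_lift_add monoid_lift_diff monoid_lift_scal monoid_lift_sum
      monoid_lift_mult poly_mon_add)

lemma poly_var_power: "poly_var i ^ n = Poly_Mapping.single (Poly_Mapping.single i n) 1"
  by (induction n) (simp_all add: poly_var_def mult_single single_one flip: single_add)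

lemma poly_mon_var: "poly_mon poly_var m = Poly_Mapping.single m 1"
proof -
  have "(\<Prod>i\<in>A. poly_var i ^ Poly_Mapping.lookup m i)
      = Poly_Mapping.single (\<Sum>i\<in>A. Poly_Mapping.single i (Poly_Mapping.lookup m i)) 1" for A :: "'a set"
    by (induction A rule: infinite_finite_induct) (simp_all add: poly_var_power mult_single)
  moreover have "(\<Sum>i\<in>UNIV. Poly_Mapping.single i (Poly_Mapping.lookup m i)) = m"
    by (rule poly_mapping_eqI) (simp add: lookup_sum lookup_single when_def)
  ultimately show ?thesis by (simp add: poly_mon_def)
qed

lemma poly_subst_poly_var: "poly_subst poly_var f = f"
  unfolding poly_subst_monoid_lift monoid_lift_def
  by (simp add: poly_mon_var scal_single poly_mapping_sum_single)

lemma ideal_congruent_subst: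
  fixes K :: "'i::finite poly_alg set"
  assumes K: "idl.subspace K" and v: "\<And>i. v i - w i \<in> K"
  shows "poly_subst v f - poly_subst w f \<in> K"
proof -
  have mult: "a * b - a' * b' \<in> K" if "a - a' \<in> K" "b - b' \<in> K" for a a' b b'
  proof -
    have "b * (a - a') + a' * (b - b') \<in> K"
      by (rule idl.subspace_add[OF K idl.subspace_scale[OF K that(1)] idl.subspace_scale[OF K that(2)]])
    then show ?thesis by (simp add: algebra_simps)
  qed
  have one: "1 - 1 \<in> K" using idl.subspace_0[OF K] by simp
  have pow: "v i ^ n - w i ^ n \<in> K" for i n
    by (induction n) (simp_all only: power_0 power_Suc one mult v)
  have "(\<Prod>i\<in>A. v i ^ e i) - (\<Prod>i\<in>A. w i ^ e i) \<in> K" for A and e :: "'i \<Rightarrow> nat"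
    by (induction A rule: infinite_finite_induct) (simp_all only: prod.infinite prod.empty prod.insert one mult pow if_False not_False_eq_True)
  then have "poly_mon v m - poly_mon w m \<in> K" for m unfolding poly_mon_def .
  then have "(\<Sum>m\<in>Poly_Mapping.keys f. scal (Poly_Mapping.lookup f m) * (poly_mon v m - poly_mon w m)) \<in> K"
    by (intro idl.subspace_sum[OF K] idl.subspace_scale[OF K])
  then show ?thesis
    unfolding poly_subst_monoid_lift monoid_lift_def by (simp only: right_diff_distrib sum_subtractf)
qed

lemma poly_subst_scal: "\<exists>c. poly_subst (\<lambda>i. scal (z i)) f = scal c"
proof
  show "poly_subst (\<lambda>i. scal (z i)) f = scal (\<Sum>m\<in>Poly_Mapping.keys f.
      Poly_Mapping.lookup f m * (\<Prod>i\<in>UNIV. z i ^ Poly_Mapping.lookup m i))"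
    unfolding poly_subst_def
    by (simp add: scal_hom.hom_sum scal_hom.hom_mult scal_hom.hom_prod scal_hom.hom_power)
qed

lemma nullstellensatz_poly_subst:
  fixes I :: "'i::finite poly_alg set"
  assumes I: "idl.subspace I" "1 \<notin> I"
  obtains z where "\<And>f. f \<in> I \<Longrightarrow> poly_subst (\<lambda>i. scal (z i)) f = 0"
proof -
  obtain K z where K: "idl.subspace K" "I \<subseteq> K" "1 \<notin> K" and z: "\<And>i. poly_var i - scal (z i) \<in> K"
    using weak_nullstellensatz[OF I] by blast
  show thesis
  proof (rule that)
    fix f assume "f \<in> I"
    obtain c where c: "poly_subst (\<lambda>i. scal (z i)) f = scal c" using poly_subst_scal by blast
    have "poly_subst poly_var f - poly_subst (\<lambda>i. scal (z i)) f \<in> K"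
      by (rule ideal_congruent_subst[OF K(1) z])
    then have "f - scal c \<in> K" by (simp only: poly_subst_poly_var c)
    moreover have "f \<in> K" using K(2) \<open>f \<in> I\<close> by (rule subsetD)
    ultimately have "f - (f - scal c) \<in> K" by (rule idl.subspace_diff[OF K(1), rotated])
    then have c_in: "scal c \<in> K" by simp
    have "c = 0"
    proof (rule ccontr)
      assume "c \<noteq> 0"
      moreover have "scal (inverse c) * scal c \<in> K" by (rule idl.subspace_scale[OF K(1) c_in])
      ultimately show False using K(3) by (simp flip: scal_mult)
    qed
    then show "poly_subst (\<lambda>i. scal (z i)) f = 0" using c by simp
  qed
qed

text \<open>
  The homogeneous component of degree \<open>d\<close>.
\<close>

definition hcomp :: "nat \<Rightarrow> 'i::finite poly_alg \<Rightarrow> 'i poly_alg" where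
  "hcomp d f = (\<Sum>m | m \<in> Poly_Mapping.keys f \<and> mdeg m = d. Poly_Mapping.single m (Poly_Mapping.lookup f m))"

lemma lookup_hcomp:
  "Poly_Mapping.lookup (hcomp d f) m = (if mdeg m = d then Poly_Mapping.lookup f m else 0)"
  by (simp add: hcomp_def lookup_sum lookup_single when_def in_keys_iff)

lemma hcomp_0 [simp]: "hcomp d 0 = 0"
  and hcomp_add: "hcomp d (f + g) = hcomp d f + hcomp d g"
  and hcomp_diff: "hcomp d (f - g) = hcomp d f - hcomp d g"
  by (rule poly_mapping_eqI, simp add: lookup_hcomp lookup_add lookup_minus)+

lemma hcomp_sum: "hcomp d (sum f A) = (\<Sum>a\<in>A. hcomp d (f a))"
  by (induction A rule: infinite_finite_induct) (simp_all add: hcomp_add)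

lemma hcomp_single: "hcomp d (Poly_Mapping.single m c) = (if mdeg m = d then Poly_Mapping.single m c else 0)"
  by (rule poly_mapping_eqI) (auto simp: lookup_hcomp lookup_single when_def)

lemma mdeg_add: "mdeg (m + n) = mdeg m + mdeg n"
  by (simp add: lookup_add sum.distrib)

lemma hcomp_eventually_0: "\<exists>D. \<forall>d\<ge>D. hcomp d f = 0"
proof (intro exI allI impI)
  fix d assume d: "Suc (\<Sum>m\<in>Poly_Mapping.keys f. mdeg m) \<le> d"
  have "mdeg m \<noteq> d" if "m \<in> Poly_Mapping.keys f" for m
    using member_le_sum[OF that, of mdeg] d by simp
  then show "hcomp d f = 0" unfolding hcomp_def by (intro sum.neutral) blast
qed

lemma poly_component_homogeneous: "f \<in> poly_component d \<Longrightarrow> hcomp e f = (if e = d then f else 0)"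
  by (rule poly_mapping_eqI) (auto simp: lookup_hcomp poly_component_def in_keys_iff)

lemma hcomp_mult:
  assumes g: "g \<in> poly_component r"
  shows "hcomp d (f * g) = (if r \<le> d then hcomp (d - r) f * g else 0)"
proof -
  let ?c = "Poly_Mapping.lookup"
  have single: "hcomp d (Poly_Mapping.single m a * g)
      = (if r \<le> d then hcomp (d - r) (Poly_Mapping.single m a) * g else 0)" for m a
  proof -
    have "hcomp d (Poly_Mapping.single m a * g) = hcomp d (Poly_Mapping.single m a *
        (\<Sum>n\<in>Poly_Mapping.keys g. Poly_Mapping.single n (?c g n)))"
      by (simp only: poly_mapping_sum_single)
    also have "\<dots> = (\<Sum>n\<in>Poly_Mapping.keys g.
        if mdeg m + mdeg n = d then Poly_Mapping.single (m + n) (a * ?c g n) else 0)"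
      by (simp only: sum_distrib_left mult_single hcomp_sum hcomp_single mdeg_add)
    also have "\<dots> = (\<Sum>n\<in>Poly_Mapping.keys g.
        if mdeg m + r = d then Poly_Mapping.single m a * Poly_Mapping.single n (?c g n) else 0)"
      by (rule sum.cong) (use g in \<open>auto simp: poly_component_def mult_single\<close>)
    also have "\<dots> = (if mdeg m + r = d then Poly_Mapping.single m a *
        (\<Sum>n\<in>Poly_Mapping.keys g. Poly_Mapping.single n (?c g n)) else 0)"
      by (simp add: sum_distrib_left)
    also have "\<dots> = (if mdeg m + r = d then Poly_Mapping.single m a * g else 0)"
      by (simp only: poly_mapping_sum_single)
    finally show ?thesis by (auto simp: hcomp_single)
  qed
  have "hcomp d (f * g) = hcomp d ((\<Sum>m\<in>Poly_Mapping.keys f. Poly_Mapping.single m (?c f m)) * g)"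
    by (simp only: poly_mapping_sum_single)
  also have "\<dots> = (\<Sum>m\<in>Poly_Mapping.keys f.
      if r \<le> d then hcomp (d - r) (Poly_Mapping.single m (?c f m)) * g else 0)"
    by (simp only: sum_distrib_right hcomp_sum single)
  also have "\<dots> = (if r \<le> d then hcomp (d - r) (\<Sum>m\<in>Poly_Mapping.keys f. Poly_Mapping.single m (?c f m)) * g else 0)"
    by (simp add: hcomp_sum sum_distrib_right)
  finally show ?thesis by (simp only: poly_mapping_sum_single)
qed

lemma poly_var_component: "poly_var i \<in> poly_component 1"
  by (simp add: poly_var_def poly_component_def lookup_single when_def)

text \<open>
  The trick of Rabinowitsch, in a homogeneous form. The ideal generated by the \<open>q k\<close> and by \<open>x\<^sub>i - 1\<close> has no
  zero, because the only common zero of the \<open>q k\<close> is the origin. In the resulting equation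
  \<open>1 = (\<Sum>k. g k * q k) + h * (x\<^sub>i - 1)\<close> the homogeneous components of \<open>h\<close> are determined recursively: modulo the
  ideal of the \<open>q k\<close>, the component of degree \<open>d\<close> is \<open>- x\<^sub>i ^ d\<close>. It vanishes for large \<open>d\<close>.
\<close>

lemma homogeneous_nullstellensatz:
  fixes q :: "'k::finite \<Rightarrow> 'i::finite poly_alg"
  assumes hom: "\<And>k. q k \<in> poly_component r"
    and bpf: "\<And>z. (\<And>k. poly_subst (\<lambda>i. scal (z i)) (q k) = 0) \<Longrightarrow> z = (\<lambda>_. 0)"
  shows "\<exists>n g. poly_var i ^ n = (\<Sum>k\<in>UNIV. g k * q k)"
proof -
  let ?I = "{f. \<exists>g h. f = (\<Sum>k\<in>UNIV. g k * q k) + h * (poly_var i - 1)}"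
  have I: "idl.subspace ?I" unfolding idl.subspace_def
  proof (intro conjI ballI allI)
    show "0 \<in> ?I" by (rule CollectI, rule exI[of _ "\<lambda>_. 0"], rule exI[of _ 0]) simp
  next
    fix x y assume "x \<in> ?I" "y \<in> ?I"
    then obtain g h g' h' where "x = (\<Sum>k\<in>UNIV. g k * q k) + h * (poly_var i - 1)"
      "y = (\<Sum>k\<in>UNIV. g' k * q k) + h' * (poly_var i - 1)" by blast
    then have "x + y = (\<Sum>k\<in>UNIV. (g k + g' k) * q k) + (h + h') * (poly_var i - 1)"
      by (simp add: distrib_right sum.distrib)
    then show "x + y \<in> ?I" by (intro CollectI exI)
  next
    fix c x assume "x \<in> ?I"
    then obtain g h where "x = (\<Sum>k\<in>UNIV. g k * q k) + h * (poly_var i - 1)" by blast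
    then have "c * x = (\<Sum>k\<in>UNIV. (c * g k) * q k) + (c * h) * (poly_var i - 1)"
      by (simp add: distrib_left sum_distrib_left mult.assoc)
    then show "c * x \<in> ?I" by (intro CollectI exI)
  qed
  have "1 \<in> ?I"
  proof (rule ccontr)
    assume "1 \<notin> ?I"
    then obtain z where z: "\<And>f. f \<in> ?I \<Longrightarrow> poly_subst (\<lambda>i. scal (z i)) f = 0"
      using nullstellensatz_poly_subst[OF I] by blast
    have "q k \<in> ?I" for k
    proof -
      have "q k = (\<Sum>j\<in>UNIV. (if j = k then 1 else 0) * q j) + 0 * (poly_var i - 1)"
        by (simp add: if_distrib[of "\<lambda>x. x * _"] cong: if_cong)
      then show ?thesis by (intro CollectI exI)
    qed
    then have z0: "z = (\<lambda>_. 0)" using bpf z by blast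
    have "poly_var i - 1 = (\<Sum>j\<in>UNIV. 0 * q j) + 1 * (poly_var i - 1)" by simp
    then have "poly_var i - 1 \<in> ?I" by (intro CollectI exI)
    then have "poly_subst (\<lambda>i. scal (z i)) (poly_var i - 1) = 0" by (rule z)
    moreover have "poly_subst (\<lambda>i. scal (z i)) 1 = (1 :: 'i poly_alg)"
      by (simp add: poly_subst_def)
    ultimately have "scal (z i) - 1 = (0 :: 'i poly_alg)" by (simp only: poly_subst_hom poly_subst_var)
    then show False by (simp add: z0)
  qed
  then obtain g h where gh: "1 = (\<Sum>k\<in>UNIV. g k * q k) + h * (poly_var i - 1)" by blast
  have var: "poly_var i \<in> poly_component (Suc 0)" using poly_var_component by simp
  have one: "1 \<in> poly_component 0" by (simp add: poly_component_def)
  have step: "hcomp d h = hcomp d (h * poly_var i) - hcomp d 1 + (\<Sum>k\<in>UNIV. hcomp d (g k * q k))" for d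
    using arg_cong[OF gh, of "hcomp d"] by (simp add: hcomp_add hcomp_diff hcomp_sum algebra_simps)
  have "\<exists>s. hcomp d h = (\<Sum>k\<in>UNIV. s k * q k) - poly_var i ^ d" for d
  proof (induction d)
    case 0
    show ?case
      using step[of 0] by (auto simp: hcomp_mult[OF hom] hcomp_mult[OF var]
          poly_component_homogeneous[OF one] intro!: exI[of _ "\<lambda>k. if r = 0 then hcomp 0 (g k) else 0"] sum.cong)
  next
    case (Suc d)
    then obtain s where s: "hcomp d h = (\<Sum>k\<in>UNIV. s k * q k) - poly_var i ^ d" by blast
    let ?t = "\<lambda>k. s k * poly_var i + (if r \<le> Suc d then hcomp (Suc d - r) (g k) else 0)"
    have "hcomp (Suc d) h = hcomp d h * poly_var i + (\<Sum>k\<in>UNIV. hcomp (Suc d) (g k * q k))"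
      using step[of "Suc d"] by (simp add: hcomp_mult[OF var] poly_component_homogeneous[OF one])
    also have "(\<Sum>k\<in>UNIV. hcomp (Suc d) (g k * q k))
        = (\<Sum>k\<in>UNIV. (if r \<le> Suc d then hcomp (Suc d - r) (g k) else 0) * q k)"
      by (rule sum.cong) (simp_all add: hcomp_mult[OF hom])
    also have "hcomp d h * poly_var i = (\<Sum>k\<in>UNIV. (s k * poly_var i) * q k) - poly_var i ^ Suc d"
      unfolding s by (simp add: right_diff_distrib sum_distrib_left mult_ac)
    finally have "hcomp (Suc d) h = (\<Sum>k\<in>UNIV. ?t k * q k) - poly_var i ^ Suc d"
      by (simp add: distrib_right sum.distrib)
    then show ?case by (intro exI[of _ ?t])
  qed
  moreover obtain d where "hcomp d h = 0" using hcomp_eventually_0[of h] by blast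
  ultimately obtain s where "0 = (\<Sum>k\<in>UNIV. s k * q k) - poly_var i ^ d" by (metis (no_types))
  then have "poly_var i ^ d = (\<Sum>k\<in>UNIV. s k * q k)" by simp
  then show ?thesis by blast
qed

section \<open>The Koszul complex\<close>

text \<open>
  Elements of the Koszul complex in degree \<open>i\<close> are represented by their coordinates, alternating functions
  on lists of length \<open>i\<close>. A single function on all lists carries all degrees at once. The differential
  contracts with \<open>q\<close>, and \<open>koszul_wedge\<close> is the exterior product with \<open>g\<close>.
\<close>

definition koszul_d :: "('k::finite \<Rightarrow> 'a::comm_ring_1) \<Rightarrow> ('k list \<Rightarrow> 'a) \<Rightarrow> 'k list \<Rightarrow> 'a" where
  "koszul_d q c v = (\<Sum>k\<in>UNIV. q k * c (k # v))"

primrec koszul_wedge :: "('k \<Rightarrow> 'a::comm_ring_1) \<Rightarrow> 'k list \<Rightarrow> ('k list \<Rightarrow> 'a) \<Rightarrow> 'a" where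
  "koszul_wedge g [] c = 0"
| "koszul_wedge g (k # v) c = g k * c v - koszul_wedge g v (\<lambda>w. c (k # w))"

definition alternating :: "('k list \<Rightarrow> 'a::comm_ring_1) \<Rightarrow> bool" where
  "alternating c \<longleftrightarrow> (\<forall>u k l v. c (u @ k # l # v) = - c (u @ l # k # v))"

lemma alternatingD: "alternating c \<Longrightarrow> c (u @ k # l # v) = - c (u @ l # k # v)"
  unfolding alternating_def by blast

lemma alternating_Cons: "alternating c \<Longrightarrow> alternating (\<lambda>w. c (m # w))"
  unfolding alternating_def by (metis append_Cons)

lemma koszul_wedge_uminus: "koszul_wedge g v (\<lambda>w. - c w) = - koszul_wedge g v c"
  by (induction v arbitrary: c) simp_all

lemma koszul_wedge_sum:
  "koszul_wedge g v (\<lambda>w. \<Sum>k\<in>A. q k * c k w) = (\<Sum>k\<in>A. q k * koszul_wedge g v (c k))"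
proof (induction v arbitrary: c)
  case (Cons m v)
  have "koszul_wedge g v (\<lambda>w. \<Sum>k\<in>A. q k * c k (m # w))
      = (\<Sum>k\<in>A. q k * koszul_wedge g v (\<lambda>w. c k (m # w)))"
    by (rule Cons.IH)
  then show ?case
    by (simp add: right_diff_distrib sum_subtractf sum_distrib_left mult.left_commute)
qed simp

text \<open>
  The exterior product with \<open>g\<close> is a null homotopy for the multiplication by \<open>\<Sum>k. g k * q k\<close>. Elements of the
  ideal of \<open>q\<close> hence annihilate the homology.
\<close>

lemma koszul_homotopy:
  "koszul_d q (\<lambda>v. koszul_wedge g v c) v
     = (\<Sum>k\<in>UNIV. g k * q k) * c v - koszul_wedge g v (koszul_d q c)"
proof -
  have "koszul_wedge g v (koszul_d q c) = koszul_wedge g v (\<lambda>w. \<Sum>k\<in>UNIV. q k * c (k # w))"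
    by (simp add: koszul_d_def[abs_def])
  also have "\<dots> = (\<Sum>k\<in>UNIV. q k * koszul_wedge g v (\<lambda>w. c (k # w)))"
    by (rule koszul_wedge_sum)
  finally show ?thesis
    unfolding koszul_d_def[of q "\<lambda>v. koszul_wedge g v c"]
    by (simp add: right_diff_distrib sum_subtractf sum_distrib_left mult_ac)
qed

lemma alternating_wedge: "alternating c \<Longrightarrow> alternating (\<lambda>v. koszul_wedge g v c)"
  unfolding alternating_def[of "\<lambda>v. koszul_wedge g v c"]
proof (intro allI)
  fix u k l v
  show "alternating c \<Longrightarrow> koszul_wedge g (u @ k # l # v) c = - koszul_wedge g (u @ l # k # v) c"
  proof (induction u arbitrary: c)
    case Nil
    have "c (k # l # w) = - c (l # k # w)" for w
      using alternatingD[OF Nil, of "[]" k l w] by simp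
    then have "koszul_wedge g v (\<lambda>w. c (k # l # w)) = - koszul_wedge g v (\<lambda>w. c (l # k # w))"
      by (simp only: koszul_wedge_uminus)
    then show ?case by simp
  next
    case (Cons m u)
    then show ?case
      using alternatingD[OF Cons.prems, of u k l v] Cons.IH[OF alternating_Cons[OF Cons.prems]]
      by simp
  qed
qed

lemma koszul_wedge_in_ideal:
  assumes J: "idl.subspace J" and c: "\<And>w. length w + 1 = length v \<Longrightarrow> c w \<in> J"
  shows "koszul_wedge g v c \<in> J"
  using c
proof (induction v arbitrary: c)
  case Nil
  then show ?case using idl.subspace_0[OF J] by simp
next
  case (Cons k v)
  have "g k * c v \<in> J" using Cons.prems by (intro idl.subspace_scale[OF J]) simp
  moreover have "koszul_wedge g v (\<lambda>w. c (k # w)) \<in> J" by (rule Cons.IH) (simp add: Cons.prems)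
  ultimately show ?case unfolding koszul_wedge.simps by (rule idl.subspace_diff[OF J])
qed

lemma koszul_d_diff: "koszul_d q (\<lambda>v. c v - b v) v = koszul_d q c v - koszul_d q b v"
  by (simp add: koszul_d_def right_diff_distrib sum_subtractf)

lemma koszul_d_scale: "koszul_d q (\<lambda>v. f * c v) v = f * koszul_d q c v"
  by (simp add: koszul_d_def sum_distrib_left mult.left_commute)

lemma koszul_d_in_ideal:
  assumes "idl.subspace J" "\<And>k. c (k # v) \<in> J"
  shows "koszul_d q c v \<in> J"
  unfolding koszul_d_def
  by (intro idl.subspace_sum[OF assms(1)] idl.subspace_scale[OF assms(1)] assms(2))

lemma alternating_koszul_d: "alternating c \<Longrightarrow> alternating (koszul_d q c)"
  unfolding alternating_def[of "koszul_d q c"]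
proof (intro allI)
  fix u k l v assume "alternating c"
  then have "c (m # u @ k # l # v) = - c (m # u @ l # k # v)" for m
    using alternatingD[of c "m # u" k l v] by simp
  then show "koszul_d q c (u @ k # l # v) = - koszul_d q c (u @ l # k # v)"
    by (simp add: koszul_d_def sum_negf)
qed

lemma eq_uminus_imp_0:
  fixes r :: "'m::comm_monoid_add \<Rightarrow>\<^sub>0 complex"
  shows "r = - r \<Longrightarrow> r = 0"
proof -
  assume "r = - r"
  then have "Poly_Mapping.lookup r m = - Poly_Mapping.lookup r m" for m
    by (metis lookup_uminus)
  then show "r = 0" by (intro poly_mapping_eqI) simp
qed

lemma koszul_d_d:
  fixes q :: "'k::finite \<Rightarrow> ('m::comm_monoid_add \<Rightarrow>\<^sub>0 complex)"
  assumes "alternating c"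
  shows "koszul_d q (koszul_d q c) v = 0"
proof -
  let ?s = "\<Sum>k\<in>UNIV. \<Sum>l\<in>UNIV. q k * (q l * c (l # k # v))"
  have "?s = (\<Sum>l\<in>UNIV. \<Sum>k\<in>UNIV. q k * (q l * c (l # k # v)))" by (rule sum.swap)
  also have "\<dots> = (\<Sum>l\<in>UNIV. \<Sum>k\<in>UNIV. - (q l * (q k * c (k # l # v))))"
  proof (intro sum.cong HOL.refl)
    fix k l
    have "c (l # k # v) = - c (k # l # v)" using alternatingD[OF assms, of "[]" l k v] by simp
    then show "q k * (q l * c (l # k # v)) = - (q l * (q k * c (k # l # v)))"
      by (simp add: mult.left_commute)
  qed
  also have "\<dots> = - ?s" by (simp add: sum_negf)
  finally have "?s = 0" by (rule eq_uminus_imp_0)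
  then show ?thesis by (simp add: koszul_d_def sum_distrib_left)
qed

lemma alternating_not_distinct:
  fixes c :: "'k list \<Rightarrow> ('m::comm_monoid_add \<Rightarrow>\<^sub>0 complex)"
  assumes c: "alternating c" and "\<not> distinct v"
  shows "c v = 0"
proof -
  have repeat: "c (xs @ y # ys @ y # zs) = 0" for xs y ys zs
  proof (induction ys arbitrary: xs)
    case Nil
    show ?case using alternatingD[OF c, of xs y y zs] by (intro eq_uminus_imp_0) simp
  next
    case (Cons a ys)
    show ?case using alternatingD[OF c, of xs y a "ys @ y # zs"] Cons.IH[of "xs @ [a]"] by simp
  qed
  obtain xs ys zs y where "v = xs @ [y] @ ys @ [y] @ zs" using not_distinct_decomp[OF assms(2)] by blast
  then show ?thesis using repeat by simp
qed

text \<open>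
  The ideal generated by the \<open>N\<close>-th powers of the variables in \<open>A\<close>.
\<close>

definition mon_ideal :: "nat \<Rightarrow> 'i set \<Rightarrow> 'i poly_alg set" where
  "mon_ideal N A = {f. \<forall>m\<in>Poly_Mapping.keys f. \<exists>i\<in>A. N \<le> Poly_Mapping.lookup m i}"

lemma subspace_mon_ideal: "idl.subspace (mon_ideal N A)"
  unfolding idl.subspace_def
proof (intro conjI ballI allI)
  show "0 \<in> mon_ideal N A" by (simp add: mon_ideal_def)
  fix f g assume "f \<in> mon_ideal N A" "g \<in> mon_ideal N A"
  then show "f + g \<in> mon_ideal N A" using keys_add[of f g] unfolding mon_ideal_def by blast
next
  fix f g :: "'a poly_alg" assume g: "g \<in> mon_ideal N A"
  show "f * g \<in> mon_ideal N A" unfolding mon_ideal_def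
  proof (intro CollectI ballI)
    fix m assume "m \<in> Poly_Mapping.keys (f * g)"
    then obtain a b where "m = a + b" "b \<in> Poly_Mapping.keys g" using keys_mult[of f g] by blast
    moreover from this obtain i where "i \<in> A" "N \<le> Poly_Mapping.lookup b i"
      using g unfolding mon_ideal_def by blast
    ultimately show "\<exists>i\<in>A. N \<le> Poly_Mapping.lookup m i"
      by (intro bexI[of _ i]) (simp_all add: lookup_add)
  qed
qed

lemma lookup_single_mult:
  fixes h :: "('i \<Rightarrow>\<^sub>0 nat) \<Rightarrow>\<^sub>0 complex"
  shows "Poly_Mapping.lookup (Poly_Mapping.single a 1 * h) (a + m) = Poly_Mapping.lookup h m"
proof -
  have "Poly_Mapping.single a 1 * h = Poly_Mapping.single a 1 *
      (\<Sum>n\<in>Poly_Mapping.keys h. Poly_Mapping.single n (Poly_Mapping.lookup h n))"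
    by (simp only: poly_mapping_sum_single)
  also have "\<dots> = (\<Sum>n\<in>Poly_Mapping.keys h. Poly_Mapping.single (a + n) (Poly_Mapping.lookup h n))"
    by (simp add: sum_distrib_left mult_single)
  finally show ?thesis
    by (simp add: lookup_sum lookup_single when_def in_keys_iff)
qed

text \<open>
  The power of a further variable is not a zero divisor modulo \<open>mon_ideal N A\<close>.
\<close>

lemma mon_ideal_regular:
  assumes "x \<notin> A" "poly_var x ^ N * h \<in> mon_ideal N A"
  shows "h \<in> mon_ideal N A"
  unfolding mon_ideal_def
proof (intro CollectI ballI)
  fix m assume "m \<in> Poly_Mapping.keys h"
  then have "Poly_Mapping.single x N + m \<in> Poly_Mapping.keys (poly_var x ^ N * h)"
    by (simp add: in_keys_iff poly_var_power lookup_single_mult)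
  then obtain i where "i \<in> A" "N \<le> Poly_Mapping.lookup (Poly_Mapping.single x N + m) i"
    using assms(2) unfolding mon_ideal_def by blast
  moreover from this(1) have "x \<noteq> i" using assms(1) by blast
  ultimately show "\<exists>i\<in>A. N \<le> Poly_Mapping.lookup m i"
    by (intro bexI[of _ i]) (simp_all add: lookup_add lookup_single when_def)
qed

text \<open>
  The part of \<open>f\<close> that is divisible by the \<open>N\<close>-th power of the variable \<open>x\<close>, divided by this power. Being given
  by a formula, the quotient is linear, so that quotients of alternating functions are alternating.
\<close>

definition var_quotient :: "nat \<Rightarrow> 'i \<Rightarrow> 'i poly_alg \<Rightarrow> 'i poly_alg" where
  "var_quotient N x f = Poly_Mapping.map_key ((+) (Poly_Mapping.single x N)) f"

lemma lookup_var_quotient: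
  "Poly_Mapping.lookup (var_quotient N x f) m = Poly_Mapping.lookup f (Poly_Mapping.single x N + m)"
proof -
  have "inj ((+) (Poly_Mapping.single x N))" by (rule injI) simp
  then show ?thesis by (simp add: var_quotient_def Poly_Mapping.map_key.rep_eq)
qed

lemma var_quotient_uminus: "var_quotient N x (- f) = - var_quotient N x f"
  by (rule poly_mapping_eqI) (simp add: lookup_var_quotient)

lemma var_quotient_mod_mon_ideal:
  assumes "f \<in> mon_ideal N (insert x A)"
  shows "f - poly_var x ^ N * var_quotient N x f \<in> mon_ideal N A"
  unfolding mon_ideal_def
proof (intro CollectI ballI)
  let ?a = "Poly_Mapping.single x N"
  let ?g = "Poly_Mapping.single ?a 1 * var_quotient N x f"
  fix m assume "m \<in> Poly_Mapping.keys (f - poly_var x ^ N * var_quotient N x f)"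
  then have m: "Poly_Mapping.lookup f m \<noteq> Poly_Mapping.lookup ?g m"
    by (simp add: in_keys_iff lookup_minus poly_var_power)
  have lt: "\<not> N \<le> Poly_Mapping.lookup m x"
  proof
    assume N: "N \<le> Poly_Mapping.lookup m x"
    have "m = ?a + (m - ?a)"
      using N by (intro poly_mapping_eqI) (auto simp: lookup_add lookup_minus lookup_single when_def)
    then obtain n where n: "m = ?a + n" by blast
    show False using m unfolding n lookup_single_mult lookup_var_quotient by simp
  qed
  have "m \<notin> Poly_Mapping.keys ?g"
  proof
    assume "m \<in> Poly_Mapping.keys ?g"
    then obtain b where "m = ?a + b" using keys_mult[of "Poly_Mapping.single ?a 1" "var_quotient N x f"] by auto
    then show False using lt by (simp add: lookup_add)
  qed
  then have "m \<in> Poly_Mapping.keys f" using m by (simp add: in_keys_iff)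
  then obtain i where "i \<in> insert x A" "N \<le> Poly_Mapping.lookup m i"
    using assms unfolding mon_ideal_def by blast
  then show "\<exists>i\<in>A. N \<le> Poly_Mapping.lookup m i" using lt by blast
qed

lemma mon_ideal_mono: "A \<subseteq> B \<Longrightarrow> mon_ideal N A \<subseteq> mon_ideal N B"
  unfolding mon_ideal_def by blast

text \<open>
  The Koszul complex of \<open>q\<close> over $R / (x^N : x \in A)$ is exact in the degrees \<open>i\<close> above \<open>card A\<close>. The induction
  enlarges \<open>A\<close>. If \<open>A\<close> contains all variables, there are no nonzero alternating functions in these degrees.
  Otherwise multiplication by \<open>f = x ^ N\<close>, for a variable \<open>x\<close> outside \<open>A\<close>, is injective on
  $R / (x^N : x \in A)$ but zero on homology. By the long exact sequence, the homology in degree \<open>i\<close> is the image of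
  the homology in degree \<open>i + 1\<close> over the quotient with \<open>x\<close> adjoined to \<open>A\<close>, which vanishes by induction. The
  proof follows this connecting map on representatives.
\<close>

lemma koszul_acyclic_mod:
  fixes q :: "'i::finite \<Rightarrow> 'i poly_alg"
  assumes pow: "\<And>x. \<exists>g. poly_var x ^ N = (\<Sum>k\<in>UNIV. g k * q k)"
    and "alternating c" "card A < i" "\<And>v. length v + 1 = i \<Longrightarrow> koszul_d q c v \<in> mon_ideal N A"
  shows "\<exists>b. alternating b \<and> (\<forall>v. length v = i \<longrightarrow> c v - koszul_d q b v \<in> mon_ideal N A)"
  using assms(2-)
proof (induction "card (- A)" arbitrary: A i c)
  case 0
  then have A: "A = UNIV" by auto
  have "c v = 0" if "length v = i" for v
  proof (rule alternating_not_distinct[OF 0(2)], rule notI)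
    assume "distinct v"
    then have "length v = card (set v)" by (simp add: distinct_card)
    also have "\<dots> \<le> CARD('i)" by (rule card_mono) auto
    finally show False using 0(3) that A by simp
  qed
  then have "\<forall>v. length v = i \<longrightarrow> c v - koszul_d q (\<lambda>_. 0) v \<in> mon_ideal N A"
    using idl.subspace_0[OF subspace_mon_ideal[of N A]] by (simp add: koszul_d_def)
  moreover have "alternating (\<lambda>_. 0 :: 'i poly_alg)" by (simp add: alternating_def)
  ultimately show ?case by blast
next
  case (Suc n)
  note c = Suc.prems(1) and i = Suc.prems(2) and cyc = Suc.prems(3)
  note J = subspace_mon_ideal[of N A]
  have "- A \<noteq> {}" using Suc.hyps(2) by (metis card.empty nat.distinct(1))
  then obtain x where x: "x \<notin> A" by blast
  let ?A = "insert x A"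
  let ?f = "poly_var x ^ N :: 'i poly_alg"
  obtain g where g: "?f = (\<Sum>k\<in>UNIV. g k * q k)" using pow by blast
  let ?b = "\<lambda>v. koszul_wedge g v c"
  have b: "alternating ?b" by (rule alternating_wedge[OF c])
  \<comment> \<open>\<open>f * c\<close> is the boundary of \<open>b = g \<and> c\<close>, and therefore \<open>b\<close> is a cycle modulo \<open>f\<close>.\<close>
  have db: "?f * c v - koszul_d q ?b v \<in> mon_ideal N A" if v: "length v = i" for v
  proof -
    have "koszul_wedge g v (koszul_d q c) \<in> mon_ideal N A"
      by (rule koszul_wedge_in_ideal[OF J]) (simp add: v cyc)
    then show ?thesis unfolding koszul_homotopy g by simp
  qed
  have f_in: "?f * h \<in> mon_ideal N ?A" for h
  proof -
    have "?f \<in> mon_ideal N ?A" by (simp add: mon_ideal_def poly_var_power)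
    then have "h * ?f \<in> mon_ideal N ?A" by (rule idl.subspace_scale[OF subspace_mon_ideal])
    then show ?thesis by (simp only: mult.commute)
  qed
  have "- A = insert x (- ?A)" using x by blast
  then have "card (- A) = Suc (card (- ?A))" by simp
  then have n: "n = card (- ?A)" using Suc.hyps(2) by simp
  have i': "card ?A < Suc i" using i x by simp
  have "koszul_d q ?b v \<in> mon_ideal N ?A" if "length v + 1 = Suc i" for v
  proof -
    have "?f * c v - koszul_d q ?b v \<in> mon_ideal N ?A"
      using db[of v] that mon_ideal_mono[of A ?A N] by auto
    from idl.subspace_diff[OF subspace_mon_ideal f_in[of "c v"] this] show ?thesis by simp
  qed
  from Suc.hyps(1)[OF n b i' this]
  obtain e where e: "alternating e"
    "\<And>v. length v = Suc i \<Longrightarrow> ?b v - koszul_d q e v \<in> mon_ideal N ?A" by blast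
  \<comment> \<open>Modulo \<open>f\<close> the cycle \<open>b\<close> bounds \<open>e\<close>. Then \<open>b - d e = f * h\<close>, and \<open>f * c = d b = f * d h\<close>
    gives \<open>c = d h\<close>, all modulo the powers of the variables in \<open>A\<close>.\<close>
  let ?r = "\<lambda>v. ?b v - koszul_d q e v"
  let ?h = "\<lambda>v. var_quotient N x (?r v)"
  have r: "?r (u @ k # l # v) = - ?r (u @ l # k # v)" for u k l v
    unfolding alternatingD[OF b, of u k l v] alternatingD[OF alternating_koszul_d[OF e(1)], of q u k l v]
    by simp
  have h: "alternating ?h"
    unfolding alternating_def
  proof (intro allI)
    fix u k l v
    show "?h (u @ k # l # v) = - ?h (u @ l # k # v)"
      by (simp only: r[of u k l v] var_quotient_uminus)
  qed
  have "c v - koszul_d q ?h v \<in> mon_ideal N A" if v: "length v = i" for v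
  proof (rule mon_ideal_regular[OF x])
    have "koszul_d q (\<lambda>v. ?r v - ?f * ?h v) v \<in> mon_ideal N A"
      by (rule koszul_d_in_ideal[OF J], rule var_quotient_mod_mon_ideal, rule e(2)) (simp add: v)
    then have "koszul_d q ?b v - ?f * koszul_d q ?h v \<in> mon_ideal N A"
      by (simp only: koszul_d_diff koszul_d_scale koszul_d_d[OF e(1)] diff_zero)
    from idl.subspace_add[OF J db[OF v] this]
    show "?f * (c v - koszul_d q ?h v) \<in> mon_ideal N A" by (simp add: right_diff_distrib)
  qed
  then show ?case using h by blast
qed

text \<open>
  A syzygy is a cycle of degree one in the Koszul complex, hence a boundary by \<open>koszul_acyclic_mod\<close> with \<open>A\<close>
  empty. Its entries are then combinations of the quadrics and have no component of degree one.
\<close>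

theorem no_linear_syzygies:
  fixes q :: "'i::finite \<Rightarrow> 'i poly_alg"
  assumes hom: "\<And>k. q k \<in> poly_component 2"
    and bpf: "\<And>z. (\<And>k. poly_subst (\<lambda>i. scal (z i)) (q k) = 0) \<Longrightarrow> z = (\<lambda>_. 0)"
    and lin: "\<And>k. l k \<in> poly_component 1" and syz: "(\<Sum>k\<in>UNIV. q k * l k) = 0"
  shows "l k = 0"
proof -
  have "\<forall>x. \<exists>n g. poly_var x ^ n = (\<Sum>k\<in>UNIV. g k * q k)"
  proof
    fix x show "\<exists>n g. poly_var x ^ n = (\<Sum>k\<in>UNIV. g k * q k)"
    proof (rule homogeneous_nullstellensatz)
      show "q k \<in> poly_component 2" for k by (rule hom)
    qed (rule bpf)
  qed
  then have "\<exists>n. \<forall>x. \<exists>g. poly_var x ^ n x = (\<Sum>k\<in>UNIV. g k * q k)" by (rule choice)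
  then obtain n where n: "\<And>x. \<exists>g. poly_var x ^ n x = (\<Sum>k\<in>UNIV. g k * q k)" by blast
  define N where "N = (\<Sum>x\<in>UNIV. n x)"
  have pow: "\<exists>g. poly_var x ^ N = (\<Sum>k\<in>UNIV. g k * q k)" for x
  proof -
    obtain g where g: "poly_var x ^ n x = (\<Sum>k\<in>UNIV. g k * q k)" using n by blast
    have "n x \<le> N" unfolding N_def by (rule member_le_sum) auto
    then have "poly_var x ^ N = poly_var x ^ (N - n x) * (poly_var x ^ n x :: 'i poly_alg)"
      by (simp flip: power_add)
    also have "\<dots> = (\<Sum>k\<in>UNIV. poly_var x ^ (N - n x) * g k * q k)"
      unfolding g by (simp add: sum_distrib_left mult.assoc)
    finally show ?thesis by (rule exI[of _ "\<lambda>k. poly_var x ^ (N - n x) * g k"])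
  qed
  let ?c = "\<lambda>v. if length v = 1 then l (hd v) else 0"
  have "alternating ?c" by (simp add: alternating_def)
  moreover have "koszul_d q ?c v \<in> mon_ideal N {}" if "length v + 1 = 1" for v
    using that syz by (simp add: koszul_d_def mon_ideal_def)
  ultimately have "\<exists>b. alternating b \<and> (\<forall>v. length v = 1 \<longrightarrow> ?c v - koszul_d q b v \<in> mon_ideal N {})"
    by (intro koszul_acyclic_mod[OF pow]) simp_all
  then obtain b where b: "\<And>v. length v = 1 \<Longrightarrow> ?c v - koszul_d q b v \<in> mon_ideal N {}" by blast
  have "l k = koszul_d q b [k]"
    using b[of "[k]"] by (simp add: mon_ideal_def)
  then have "hcomp 1 (l k) = (\<Sum>m\<in>UNIV. hcomp 1 (b [m, k] * q m))"
    by (simp add: koszul_d_def hcomp_sum mult.commute)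
  also have "\<dots> = 0" by (rule sum.neutral) (simp add: hcomp_mult[OF hom])
  finally show ?thesis using poly_component_homogeneous[OF lin, of 1 k] by simp
qed

section \<open>The defining ideal of the Clifford algebra\<close>

definition two_sided_ideal :: "'a::ring_1 set \<Rightarrow> bool" where
  "two_sided_ideal J \<longleftrightarrow> 0 \<in> J \<and> (\<forall>x\<in>J. \<forall>y\<in>J. x + y \<in> J) \<and> (\<forall>f. \<forall>x\<in>J. f * x \<in> J \<and> x * f \<in> J)"

lemma ideal_monoid_algebra_iff:
  "ideal J monoid_algebra \<longleftrightarrow> two_sided_ideal (J :: ('m::monoid_add \<Rightarrow>\<^sub>0 complex) set)"
proof
  assume "ideal J monoid_algebra"
  then interpret ideal J "monoid_algebra :: (complex, 'm \<Rightarrow>\<^sub>0 complex) module" .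
  have "0 \<in> J" using additive_subgroup.zero_closed[OF is_additive_subgroup]
    by (simp add: monoid_algebra_def)
  moreover have "x + y \<in> J" if "x \<in> J" "y \<in> J" for x y
    using additive_subgroup.a_closed[OF is_additive_subgroup that] by (simp add: monoid_algebra_def)
  moreover have "f * x \<in> J \<and> x * f \<in> J" if "x \<in> J" for f x
    using I_l_closed[OF that, of f] I_r_closed[OF that, of f] by (simp add: monoid_algebra_def)
  ultimately show "two_sided_ideal J" unfolding two_sided_ideal_def by blast
next
  assume J: "two_sided_ideal J"
  interpret R: ring "monoid_algebra :: (complex, 'm \<Rightarrow>\<^sub>0 complex) module" by (rule ring_monoid_algebra)
  have neg: "- x \<in> J" if "x \<in> J" for x
  proof -
    have "(- 1) * x \<in> J" using J that unfolding two_sided_ideal_def by blast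
    then show ?thesis by simp
  qed
  have add: "x \<oplus>\<^bsub>monoid_algebra\<^esub> y = x + y" for x y :: "'m \<Rightarrow>\<^sub>0 complex"
    by (simp add: monoid_algebra_def)
  show "ideal J monoid_algebra"
  proof (rule idealI[OF ring_monoid_algebra])
    show "subgroup J (add_monoid monoid_algebra)"
    proof (rule R.add.subgroupI)
      show "J \<subseteq> carrier monoid_algebra" by (simp add: monoid_algebra_def)
      show "J \<noteq> {}" using J by (auto simp: two_sided_ideal_def)
      show "\<ominus>\<^bsub>monoid_algebra\<^esub> x \<in> J" if "x \<in> J" for x
      proof -
        have "\<ominus>\<^bsub>monoid_algebra\<^esub> x = - x"
          by (rule R.minus_equality) (simp_all add: monoid_algebra_def)
        then show ?thesis using neg[OF that] by simp
      qed
      show "x \<oplus>\<^bsub>monoid_algebra\<^esub> y \<in> J" if "x \<in> J" "y \<in> J" for x y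
        using J that unfolding two_sided_ideal_def add by blast
    qed
  qed (use J in \<open>simp_all add: monoid_algebra_def two_sided_ideal_def\<close>)
qed

lemma two_sided_clifford_ideal: "two_sided_ideal (clifford_ideal a)"
proof -
  interpret R: ring "monoid_algebra :: (complex, 'a mod_ring free_alg) module" by (rule ring_monoid_algebra)
  show ?thesis unfolding clifford_ideal_def ideal_monoid_algebra_iff[symmetric]
    by (rule R.genideal_ideal) (simp add: monoid_algebra_def)
qed

lemma clifford_relations_in_ideal: "clifford_relations a \<subseteq> clifford_ideal a"
proof -
  interpret R: ring "monoid_algebra :: (complex, 'a mod_ring free_alg) module" by (rule ring_monoid_algebra)
  show ?thesis unfolding clifford_ideal_def
    by (rule R.genideal_self) (simp add: monoid_algebra_def)
qed

lemma clifford_ideal_minimal: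
  assumes "two_sided_ideal K" "clifford_relations a \<subseteq> K"
  shows "clifford_ideal a \<subseteq> K"
proof -
  interpret R: ring "monoid_algebra :: (complex, 'a mod_ring free_alg) module" by (rule ring_monoid_algebra)
  show ?thesis unfolding clifford_ideal_def
    by (rule R.genideal_minimal) (use assms in \<open>simp_all add: ideal_monoid_algebra_iff\<close>)
qed

context
  fixes J :: "'a::ring_1 set"
  assumes J: "two_sided_ideal J"
begin

lemma tsi_0: "0 \<in> J"
  and tsi_add: "x \<in> J \<Longrightarrow> y \<in> J \<Longrightarrow> x + y \<in> J"
  and tsi_left: "x \<in> J \<Longrightarrow> f * x \<in> J"
  and tsi_right: "x \<in> J \<Longrightarrow> x * f \<in> J"
  using J unfolding two_sided_ideal_def by blast+

lemma tsi_uminus: "x \<in> J \<Longrightarrow> - x \<in> J"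
  using tsi_left[of x "- 1"] by simp

lemma tsi_diff: "x \<in> J \<Longrightarrow> y \<in> J \<Longrightarrow> x - y \<in> J"
  using tsi_add[OF _ tsi_uminus, of x y] by simp

lemma tsi_sum: "(\<And>i. i \<in> A \<Longrightarrow> f i \<in> J) \<Longrightarrow> sum f A \<in> J"
  by (induction A rule: infinite_finite_induct) (simp_all add: tsi_0 tsi_add)

lemma tsi_trans: "x - y \<in> J \<Longrightarrow> y - z \<in> J \<Longrightarrow> x - z \<in> J"
  using tsi_add[of "x - y" "y - z"] by simp

lemma tsi_sym: "x - y \<in> J \<Longrightarrow> y - x \<in> J"
  using tsi_uminus[of "x - y"] by simp

lemma tsi_mult_left: "x - y \<in> J \<Longrightarrow> f * x - f * y \<in> J"
  using tsi_left[of "x - y" f] by (simp add: right_diff_distrib)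

lemma tsi_mult_right: "x - y \<in> J \<Longrightarrow> x * f - y * f \<in> J"
  using tsi_right[of "x - y" f] by (simp add: left_diff_distrib)

end

section \<open>Indices modulo an odd prime\<close>

locale odd_prime =
  fixes P :: "'p::prime_card itself"
  assumes two_lt_p: "2 < CARD('p)"
begin

definition half :: nat where "half = (CARD('p) - 1) div 2"

lemma card_odd: "CARD('p) = 2 * half + 1"
proof -
  have "prime CARD('p)" by (rule prime_card)
  then have "odd CARD('p)" using two_lt_p prime_odd_nat by blast
  then show ?thesis unfolding half_def by presburger
qed

lemma of_nat_nonzero: "0 < n \<Longrightarrow> n < CARD('p) \<Longrightarrow> (of_nat n :: 'p mod_ring) \<noteq> 0"
  using of_nat_0_mod_ring_dvd[where 'a = 'p, of n] nat_dvd_not_less by blast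

lemma two_nonzero [simp]: "(2 :: 'p mod_ring) \<noteq> 0"
  using of_nat_nonzero[of 2] two_lt_p by simp

lemma index_cases:
  fixes d :: "'p mod_ring"
  obtains "d = 0" | i where "1 \<le> i" "i \<le> half" "d = of_nat i" | i where "1 \<le> i" "i \<le> half" "d = - of_nat i"
proof (cases "d = 0")
  case True
  then show ?thesis using that(1) by blast
next
  case False
  obtain j where j: "j < CARD('p)" "d = of_nat j" using surj_of_nat_mod_ring[of d] by blast
  then have "j \<noteq> 0" using False by (metis of_nat_0)
  show ?thesis
  proof (cases "j \<le> half")
    case True
    then show ?thesis using that(2)[of j] j \<open>j \<noteq> 0\<close> by simp
  next
    case False
    have "(of_nat CARD('p) :: 'p mod_ring) = of_nat (CARD('p) - j) + of_nat j"
      using j(1) by (simp flip: of_nat_add)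
    then have "d = - of_nat (CARD('p) - j)" using j(2) by (simp add: eq_neg_iff_add_eq_0 add.commute)
    moreover have "CARD('p) - j \<le> half" "1 \<le> CARD('p) - j" using False j(1) card_odd by auto
    ultimately show ?thesis using that(3) by blast
  qed
qed

lemma of_nat_half_inj:
  assumes "i \<le> half" "j \<le> half" "(of_nat i :: 'p mod_ring) = of_nat j"
  shows "i = j"
proof -
  have *: "k = l" if "k \<le> l" "l \<le> half" "(of_nat k :: 'p mod_ring) = of_nat l" for k l
  proof -
    have z: "(of_nat (l - k) :: 'p mod_ring) = 0" using that by (simp add: of_nat_diff)
    show ?thesis
    proof (rule ccontr)
      assume "k \<noteq> l"
      then have "0 < l - k" "l - k < CARD('p)" using that(1,2) card_odd by linarith+
      then show False using of_nat_nonzero[of "l - k"] z by blast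
    qed
  qed
  show ?thesis
  proof (cases "i \<le> j")
    case True
    then show ?thesis using assms(2,3) by (rule *)
  next
    case False
    then show ?thesis using *[of j i] assms(1,3) by simp
  qed
qed

lemma of_nat_half_neg:
  assumes "1 \<le> i" "i \<le> half" "j \<le> half"
  shows "(of_nat i :: 'p mod_ring) \<noteq> - of_nat j"
proof
  assume "(of_nat i :: 'p mod_ring) = - of_nat j"
  then have "(of_nat (i + j) :: 'p mod_ring) = 0" by simp
  then show False using of_nat_nonzero[of "i + j"] assms card_odd by simp
qed

text \<open>
  The nonzero residues are \<open>i\<close> and \<open>-i\<close> for \<open>1 \<le> i \<le> half\<close>.
\<close>

lemma sum_index:
  fixes f :: "'p mod_ring \<Rightarrow> 'b::comm_monoid_add"
  shows "(\<Sum>d\<in>UNIV. f d) = f 0 + (\<Sum>i = 1..half. f (of_nat i) + f (- of_nat i))"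
proof -
  let ?A = "(of_nat :: nat \<Rightarrow> 'p mod_ring) ` {1..half}" and ?B = "(\<lambda>i. - of_nat i :: 'p mod_ring) ` {1..half}"
  have inj: "inj_on (of_nat :: nat \<Rightarrow> 'p mod_ring) {1..half}" "inj_on (\<lambda>i. - of_nat i :: 'p mod_ring) {1..half}"
    using of_nat_half_inj by (auto simp: inj_on_def)
  have U: "UNIV = insert 0 (?A \<union> ?B)"
  proof -
    have "d \<in> insert 0 (?A \<union> ?B)" for d :: "'p mod_ring" by (cases d rule: index_cases) auto
    then show ?thesis by blast
  qed
  have zero: "0 \<notin> ?A \<union> ?B" using of_nat_nonzero card_odd by fastforce
  have disj: "?A \<inter> ?B = {}" using of_nat_half_neg by fastforce
  have "sum f UNIV = sum f (insert 0 (?A \<union> ?B))" by (rule arg_cong[OF U])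
  also have "\<dots> = f 0 + sum f (?A \<union> ?B)" by (rule sum.insert[OF _ zero]) simp
  also have "sum f (?A \<union> ?B) = sum f ?A + sum f ?B"
    by (rule sum.union_disjoint[OF _ _ disj]) simp_all
  also have "sum f ?A + sum f ?B = (\<Sum>i = 1..half. f (of_nat i) + f (- of_nat i))"
    by (simp only: sum.reindex[OF inj(1)] sum.reindex[OF inj(2)] sum.distrib o_def)
  finally show ?thesis .
qed

text \<open>
  The parameters as an even function on the residues. The value at \<open>0\<close> is doubled because the
  anticommutator of \<open>x\<^sub>k\<close> with itself is \<open>2 x\<^sub>k\<^sup>2\<close>; with it both families of relations take the same form.
\<close>

definition cliff_coeff :: "(nat \<Rightarrow> complex) \<Rightarrow> 'p mod_ring \<Rightarrow> complex" where
  "cliff_coeff a d = (if d = 0 then 2 * a 0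
     else a (THE i. 1 \<le> i \<and> i \<le> half \<and> (d = of_nat i \<or> d = - of_nat i)))"

lemma cliff_coeff_0 [simp]: "cliff_coeff a 0 = 2 * a 0"
  by (simp add: cliff_coeff_def)

lemma cliff_coeff_of_nat:
  assumes "1 \<le> i" "i \<le> half"
  shows "cliff_coeff a (of_nat i) = a i" "cliff_coeff a (- of_nat i) = a i"
proof -
  have "(THE j. 1 \<le> j \<and> j \<le> half \<and> (of_nat i = (of_nat j :: 'p mod_ring) \<or> of_nat i = (- of_nat j :: 'p mod_ring))) = i"
    "(THE j. 1 \<le> j \<and> j \<le> half \<and> (- of_nat i = (of_nat j :: 'p mod_ring) \<or> - of_nat i = (- of_nat j :: 'p mod_ring))) = i"
    using assms of_nat_half_inj of_nat_half_neg
    by (intro the_equality; force simp: minus_equation_iff)+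
  moreover have "(of_nat i :: 'p mod_ring) \<noteq> 0" using of_nat_nonzero assms card_odd by simp
  ultimately show "cliff_coeff a (of_nat i) = a i" "cliff_coeff a (- of_nat i) = a i"
    by (simp_all add: cliff_coeff_def)
qed

lemma half_add_half: "d / 2 + d / 2 = (d :: 'p mod_ring)"
  using two_nonzero by (simp add: field_simps)

lemma cliff_coeff_minus: "cliff_coeff a (- d) = cliff_coeff a d"
  by (cases d rule: index_cases) (simp_all add: cliff_coeff_of_nat)

abbreviation x :: "'p mod_ring \<Rightarrow> 'p mod_ring free_alg" where "x \<equiv> free_var"

text \<open>
  The anticommutator of the two generators with midpoint \<open>k\<close> and difference \<open>d\<close>.
\<close>

definition pair :: "'p mod_ring \<Rightarrow> 'p mod_ring \<Rightarrow> 'p mod_ring free_alg" where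
  "pair k d = cliff_anticomm (k - d / 2) (k + d / 2)"

lemma cliff_anticomm_commute: "cliff_anticomm i j = cliff_anticomm j i"
  by (simp add: cliff_anticomm_def add.commute)

lemma pair_minus: "pair k (- d) = pair k d"
  unfolding pair_def by (subst cliff_anticomm_commute) simp

lemma pair_0: "pair k 0 = scal 2 * x k ^ 2"
proof -
  have "scal 2 = (2 :: 'p mod_ring free_alg)" using scal_add[of 1 1] by simp
  then show ?thesis by (simp add: pair_def cliff_anticomm_def power2_eq_square mult_2)
qed

lemma anticomm_pair: "cliff_anticomm i j = pair ((i + j) / 2) (i - j)"
proof -
  have "(i + j) / 2 - (i - j) / 2 = j" "(i + j) / 2 + (i - j) / 2 = i"
    by (simp_all add: field_simps flip: diff_divide_distrib add_divide_distrib)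
  then show ?thesis unfolding pair_def by (simp add: cliff_anticomm_commute)
qed

lemma clifford_relations_pair:
  "scal (cliff_coeff a d) * pair k e - scal (cliff_coeff a e) * pair k d \<in> clifford_ideal a"
proof -
  let ?J = "clifford_ideal a :: 'p mod_ring free_alg set"
  note J = two_sided_clifford_ideal[of a, where 'a = 'p]
  let ?R = "\<lambda>d e. scal (cliff_coeff a d) * pair k e - scal (cliff_coeff a e) * pair k d \<in> ?J"
  have sym: "?R e d" if "?R d e" for d e using tsi_sym[OF J that] .
  have zero: "?R 0 (of_nat i)" if i: "1 \<le> i" "i \<le> half" for i
  proof -
    have "scal (a 0) * cliff_anticomm j (j + of_nat i) - scal (a i) * x (j + of_nat i / 2) ^ 2 \<in> ?J" for j
      using clifford_relations_in_ideal[of a] i unfolding clifford_relations_def half_def by blast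
    from this[of "k - of_nat i / 2"]
    moreover have "k - of_nat i / 2 + of_nat i = k + of_nat i / 2"
      using half_add_half[of "of_nat i"] by (simp add: algebra_simps)
    ultimately have "scal (a 0) * pair k (of_nat i) - scal (a i) * x k ^ 2 \<in> ?J"
      by (simp add: pair_def)
    from tsi_left[OF J this, of "scal 2"] show ?thesis
      by (simp add: cliff_coeff_of_nat[OF i] pair_0 right_diff_distrib scal_mult mult.assoc
          alg.scale_left_commute[of 2 "a i"])
  qed
  have zero': "?R (of_nat i) 0" if "1 \<le> i" "i \<le> half" for i
    by (rule sym[OF zero[OF that]])
  have pos: "?R (of_nat m) (of_nat i)" if i: "1 \<le> i" "i \<le> half" and m: "1 \<le> m" "m \<le> half" for i m
    using clifford_relations_in_ideal[of a] i m
    unfolding clifford_relations_def half_def pair_def cliff_coeff_of_nat[OF i] cliff_coeff_of_nat[OF m]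
    by blast
  show ?thesis
    by (cases d rule: index_cases; cases e rule: index_cases)
      (simp_all add: cliff_coeff_minus pair_minus zero zero' pos tsi_0[OF J]
        del: cliff_coeff_0)
qed

text \<open>
  The form in which the defining relations are checked throughout: modulo \<open>K\<close> all anticommutators with
  the same midpoint are multiples of one element, with the prescribed coefficients.
\<close>

lemma clifford_ideal_subset:
  assumes K: "two_sided_ideal K"
    and y: "\<And>i j. cliff_anticomm i j - scal (cliff_coeff a (i - j)) * y ((i + j) / 2) \<in> K"
  shows "clifford_ideal a \<subseteq> (K :: 'p mod_ring free_alg set)"
proof (rule clifford_ideal_minimal[OF K])
  have pair: "pair k d - scal (cliff_coeff a d) * y k \<in> K" for k d
    using y[of "k - d / 2" "k + d / 2"] cliff_coeff_minus[of a d] by (simp add: pair_def)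
  have rel: "scal (cliff_coeff a d) * pair k e - scal (cliff_coeff a e) * pair k d \<in> K" for k d e
  proof -
    have "scal (cliff_coeff a d) * (pair k e - scal (cliff_coeff a e) * y k)
        - scal (cliff_coeff a e) * (pair k d - scal (cliff_coeff a d) * y k) \<in> K"
      by (intro tsi_diff[OF K] tsi_left[OF K] pair)
    then show ?thesis
      by (simp add: right_diff_distrib mult.commute flip: mult.assoc scal_mult)
  qed
  show "clifford_relations a \<subseteq> K" unfolding clifford_relations_def
  proof (intro Un_least subsetI)
    fix f :: "'p mod_ring free_alg" assume "f \<in> {scal (a 0) * cliff_anticomm j (j + of_nat i) - scal (a i) * x (j + of_nat i / 2) ^ 2
       | j i. 1 \<le> i \<and> i \<le> (CARD('p) - 1) div 2}"
    then obtain j i where i: "1 \<le> i" "i \<le> half"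
      and f: "f = scal (a 0) * cliff_anticomm j (j + of_nat i) - scal (a i) * x (j + of_nat i / 2) ^ 2"
      unfolding half_def by blast
    have "pair (j + of_nat i / 2) (of_nat i) = cliff_anticomm j (j + of_nat i)"
      by (simp add: pair_def add.assoc flip: add_divide_distrib)
    then have e: "f = scal (1 / 2) * (scal (cliff_coeff a 0) * pair (j + of_nat i / 2) (of_nat i)
        - scal (cliff_coeff a (of_nat i)) * pair (j + of_nat i / 2) 0)"
      unfolding f by (simp add: cliff_coeff_of_nat[OF i] pair_0 right_diff_distrib flip: mult.assoc scal_mult)
    show "f \<in> K" unfolding e by (rule tsi_left[OF K rel])
  next
    fix f :: "'p mod_ring free_alg" assume "f \<in> {scal (a m) * cliff_anticomm (k - of_nat i / 2) (k + of_nat i / 2)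
        - scal (a i) * cliff_anticomm (k - of_nat m / 2) (k + of_nat m / 2)
       | k i m. 1 \<le> i \<and> i \<le> (CARD('p) - 1) div 2 \<and> 1 \<le> m \<and> m \<le> (CARD('p) - 1) div 2}"
    then obtain k i m where i: "1 \<le> i" "i \<le> half" and m: "1 \<le> m" "m \<le> half"
      and f: "f = scal (a m) * pair k (of_nat i) - scal (a i) * pair k (of_nat m)"
      unfolding half_def pair_def by blast
    show "f \<in> K" using rel[of "of_nat m" k "of_nat i"] unfolding f
      by (simp only: cliff_coeff_of_nat[OF i] cliff_coeff_of_nat[OF m])
  qed
qed

end

section \<open>Centrality of the degree two generators\<close>

lemma poly_component_0: "0 \<in> poly_component n"
  and poly_component_add: "f \<in> poly_component n \<Longrightarrow> g \<in> poly_component n \<Longrightarrow> f + g \<in> poly_component n"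
  and poly_component_mult: "f \<in> poly_component m \<Longrightarrow> h \<in> poly_component k \<Longrightarrow> f * h \<in> poly_component (m + k)"
  and poly_component_scal: "f \<in> poly_component n \<Longrightarrow> scal c * f \<in> poly_component n"
proof -
  show "0 \<in> poly_component n" by (simp add: poly_component_def)
  show "f + g \<in> poly_component n" if "f \<in> poly_component n" "g \<in> poly_component n"
    using that keys_add[of f g] unfolding poly_component_def by blast
  show "f * h \<in> poly_component (m + k)" if f: "f \<in> poly_component m" and h: "h \<in> poly_component k"
    unfolding poly_component_def
  proof (intro CollectI ballI)
    fix w assume "w \<in> Poly_Mapping.keys (f * h)"
    then obtain u v where "w = u + v" "u \<in> Poly_Mapping.keys f" "v \<in> Poly_Mapping.keys h"
      using keys_mult[of f h] by blast
    then show "mdeg w = m + k" using f h mdeg_add[of u v] by (simp add: poly_component_def)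
  qed
  show "scal c * f \<in> poly_component n" if "f \<in> poly_component n"
    using that unfolding poly_component_def by (simp add: in_keys_iff)
qed

lemma poly_component_sum: "(\<And>i. i \<in> A \<Longrightarrow> f i \<in> poly_component n) \<Longrightarrow> sum f A \<in> poly_component n"
  by (induction A rule: infinite_finite_induct) (simp_all add: poly_component_0 poly_component_add)

lemma poly_subst_of_scal: "poly_subst v (scal c) = scal c"
  unfolding poly_subst_monoid_lift scal_def[of c] monoid_lift_single
  by (simp add: poly_mon_def scal_def)

text \<open>
  The Jacobi identity for three odd elements of a superalgebra.
\<close>

lemma commutator_jacobi:
  fixes u v w :: "'a::ring"
  shows "((u * v + v * u) * w - w * (u * v + v * u)) + ((v * w + w * v) * u - u * (v * w + w * v))
    + ((w * u + u * w) * v - v * (w * u + u * w)) = 0"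
  by (simp add: algebra_simps)

lemma scal_separating_functional:
  fixes J :: "('m::monoid_add \<Rightarrow>\<^sub>0 complex) set"
  assumes J: "two_sided_ideal J" and w: "w \<notin> J"
  shows "\<exists>\<phi>. (\<forall>f g. \<phi> (f + g) = \<phi> f + \<phi> g) \<and> (\<forall>c f. \<phi> (scal c * f) = c * \<phi> f)
    \<and> (\<forall>f\<in>J. \<phi> f = 0) \<and> \<phi> w = (1 :: complex)"
proof -
  interpret cc: vector_space "(*) :: complex \<Rightarrow> complex \<Rightarrow> complex"
    by unfold_locales (simp_all add: distrib_left distrib_right)
  interpret pr: vector_space_pair "\<lambda>c (f :: 'm \<Rightarrow>\<^sub>0 complex). scal c * f" "(*) :: complex \<Rightarrow> complex \<Rightarrow> complex" ..
  have sub: "alg.subspace J" unfolding alg.subspace_def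
    using tsi_0[OF J] tsi_add[OF J] tsi_left[OF J] by blast
  obtain B where B: "B \<subseteq> J" "alg.independent B" "J \<subseteq> alg.span B"
    using alg.maximal_independent_subset[of J] by blast
  have "alg.span B = J" using B(1,3) alg.span_minimal[OF B(1) sub] by blast
  then have "w \<notin> alg.span B" using w by simp
  then have "alg.independent (insert w B)" by (simp add: alg.independent_insert B(2))
  from pr.linear_independent_extend[OF this, of "\<lambda>b. if b = w then 1 else 0"]
  obtain \<phi> where lin: "Vector_Spaces.linear (\<lambda>c f. scal c * f) (*) \<phi>"
    and \<phi>: "\<forall>b\<in>insert w B. \<phi> b = (if b = w then 1 else 0)" by blast
  interpret lin: Vector_Spaces.linear "\<lambda>c (f :: 'm \<Rightarrow>\<^sub>0 complex). scal c * f" "(*)" \<phi> by (rule lin)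
  have zero: "\<phi> f = 0" if "f \<in> J" for f
  proof -
    have "\<phi> b = 0" if "b \<in> B" for b using \<phi> that w B(1) by auto
    moreover have "f \<in> alg.span B" using that B(3) by blast
    ultimately show ?thesis using lin.eq_0_on_span[of B f] by blast
  qed
  then show ?thesis using lin.add lin.scale \<phi> by (intro exI[of _ \<phi>]) simp
qed

locale regular_clifford = odd_prime P for P :: "'p::prime_card itself" +
  fixes a :: "nat \<Rightarrow> complex"
  assumes proj: "projective_coords TYPE('p) a"
    and reg: "clifford_regular TYPE('p) a"
begin

abbreviation J :: "'p mod_ring free_alg set" where "J \<equiv> clifford_ideal a"

abbreviation \<alpha> :: "'p mod_ring \<Rightarrow> complex" where "\<alpha> \<equiv> cliff_coeff a"

lemmas J = two_sided_clifford_ideal[of a, where 'a = 'p]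

text \<open>
  A difference with a nonzero parameter. Dividing by this parameter defines the elements \<open>y\<close> uniformly,
  whether or not \<open>a 0\<close> vanishes.
\<close>

definition d0 :: "'p mod_ring" where "d0 = (SOME d. \<alpha> d \<noteq> 0)"

lemma coeff_d0: "\<alpha> d0 \<noteq> 0"
proof -
  obtain i where i: "i \<le> half" "a i \<noteq> 0" using proj unfolding projective_coords_def half_def by blast
  then have "\<alpha> (of_nat i) \<noteq> 0" by (cases "i = 0") (simp_all add: cliff_coeff_of_nat)
  then show ?thesis unfolding d0_def by (rule someI)
qed

definition y :: "'p mod_ring \<Rightarrow> 'p mod_ring free_alg" where
  "y k = scal (1 / \<alpha> d0) * pair k d0"

lemma anticomm_y: "cliff_anticomm i j - scal (\<alpha> (i - j)) * y ((i + j) / 2) \<in> J"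
proof -
  have "scal (1 / \<alpha> d0) * (scal (\<alpha> d0) * pair k e - scal (\<alpha> e) * pair k d0) \<in> J" for k e
    by (rule tsi_left[OF J clifford_relations_pair])
  then have "pair k e - scal (\<alpha> e) * y k \<in> J" for k e
    using coeff_d0 unfolding y_def alg.scale_left_commute[of "\<alpha> e" "1 / \<alpha> d0"]
    by (simp add: right_diff_distrib alg.scale_scale)
  then show ?thesis unfolding anticomm_pair .
qed

text \<open>
  The quadric \<open>clifford_quadric a k\<close> as a polynomial, as a sum over all differences of two indices with
  midpoint \<open>k\<close>. As \<open>d\<close> and \<open>-d\<close> contribute the same term, the coefficients are halved.
\<close>

definition quadric :: "'p mod_ring \<Rightarrow> 'p mod_ring poly_alg" where
  "quadric k = (\<Sum>d\<in>UNIV. scal (\<alpha> d / 2) * (poly_var (k + d / 2) * poly_var (k - d / 2)))"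

lemma quadric_component: "quadric k \<in> poly_component 2"
  unfolding quadric_def
  using poly_component_mult[OF poly_var_component poly_var_component]
  by (intro poly_component_sum poly_component_scal) (simp only: one_add_one)

lemma quadric_eval: "poly_subst (\<lambda>i. scal (z i)) (quadric k) = scal (clifford_quadric a k z)"
proof -
  have "(\<Sum>d\<in>UNIV. \<alpha> d / 2 * (z (k + d / 2) * z (k - d / 2))) = clifford_quadric a k z"
    unfolding sum_index clifford_quadric_def half_def[symmetric]
    by (simp add: cliff_coeff_of_nat power2_eq_square mult_ac)
  moreover have "poly_subst (\<lambda>i. scal (z i)) (quadric k)
      = (\<Sum>d\<in>UNIV. scal (\<alpha> d / 2) * (scal (z (k + d / 2)) * scal (z (k - d / 2))))"
    unfolding quadric_def poly_subst_hom poly_subst_var poly_subst_of_scal by (rule HOL.refl)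
  ultimately show ?thesis by (simp only: flip: scal_hom.hom_sum scal_mult)
qed

lemma no_quadric_syzygy:
  assumes "(\<Sum>k\<in>UNIV. quadric k * (\<Sum>j\<in>UNIV. scal (c k j) * poly_var j)) = 0"
  shows "c k j = 0"
proof -
  have "(\<Sum>j\<in>UNIV. scal (c k j) * poly_var j) = (0 :: 'p mod_ring poly_alg)"
  proof (rule no_linear_syzygies[OF quadric_component _ _ assms])
    show "(\<Sum>j\<in>UNIV. scal (c k j) * poly_var j) \<in> poly_component 1" for k
      by (intro poly_component_sum poly_component_scal poly_var_component)
    fix z :: "'p mod_ring \<Rightarrow> complex"
    assume z: "\<And>k. poly_subst (\<lambda>i. scal (z i)) (quadric k) = 0"
    have "clifford_quadric a k z = 0" for k
    proof -
      have "Poly_Mapping.lookup (scal (clifford_quadric a k z) :: 'p mod_ring poly_alg) 0 = 0"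
        using z[of k] unfolding quadric_eval by simp
      then show ?thesis by (simp add: scal_def)
    qed
    then show "z = (\<lambda>_. 0)" using reg unfolding clifford_regular_def by blast
  qed
  then have "Poly_Mapping.lookup (\<Sum>j\<in>UNIV. scal (c k j) * poly_var j :: 'p mod_ring poly_alg)
      (Poly_Mapping.single j 1) = 0" by simp
  moreover have "Poly_Mapping.single i (Suc 0) = Poly_Mapping.single j (Suc 0) \<longleftrightarrow> i = j" for i
    by (metis lookup_single_eq lookup_single_not_eq nat.distinct(1))
  ultimately show ?thesis
    by (simp add: lookup_sum poly_var_def lookup_single when_def if_distrib[of "(*) _"] cong: if_cong)
qed

lemma midpoint_sum: "(k + d / 2 + (k - d / 2)) / 2 = (k :: 'p mod_ring)"
proof -
  have "k + h + (k - h) = k + k" for h by simp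
  then have "(k + d / 2 + (k - d / 2)) / 2 = (k + k) / 2" by (simp only:)
  then show ?thesis by (simp only: add_divide_distrib half_add_half)
qed

lemma midpoint_diff: "k + d / 2 - (k - d / 2) = (d :: 'p mod_ring)"
proof -
  have "k + h - (k - h) = h + h" for h by simp
  then have "k + d / 2 - (k - d / 2) = d / 2 + d / 2" by (simp only:)
  then show ?thesis by (simp only: half_add_half)
qed

lemma midpoint_ends: "(i + j) / 2 - (i - j) / 2 = (j :: 'p mod_ring)" "(i + j) / 2 + (i - j) / 2 = i"
proof -
  have "h + l - (h - l) = l + l" "h + l + (h - l) = h + h" for h l :: "'p mod_ring" by simp_all
  from this[of "i / 2" "j / 2"]
  show "(i + j) / 2 - (i - j) / 2 = j" "(i + j) / 2 + (i - j) / 2 = i"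
    by (simp_all only: add_divide_distrib diff_divide_distrib half_add_half)
qed

lemma sum_midpoints:
  fixes f :: "'p mod_ring \<Rightarrow> 'p mod_ring \<Rightarrow> 'b::comm_monoid_add"
  shows "(\<Sum>k\<in>UNIV. \<Sum>d\<in>UNIV. f (k + d / 2) (k - d / 2)) = (\<Sum>i\<in>UNIV. \<Sum>j\<in>UNIV. f i j)"
  unfolding sum.cartesian_product UNIV_Times_UNIV
proof (rule sum.reindex_bij_witness[of _ "\<lambda>(i, j). ((i + j) / 2, i - j)" "\<lambda>(k, d). (k + d / 2, k - d / 2)"])
  fix u :: "'p mod_ring \<times> 'p mod_ring"
  obtain i j where u: "u = (i, j)" by (cases u)
  show "(case case u of (i, j) \<Rightarrow> ((i + j) / 2, i - j) of (k, d) \<Rightarrow> (k + d / 2, k - d / 2)) = u"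
    by (simp only: u prod.case midpoint_ends)
  show "(case case u of (k, d) \<Rightarrow> (k + d / 2, k - d / 2) of (i, j) \<Rightarrow> ((i + j) / 2, i - j)) = u"
    by (simp only: u prod.case midpoint_sum midpoint_diff)
qed auto

text \<open>
  A functional that separates a commutator from the ideal would yield a linear syzygy of the quadrics.
  With \<open>G i j l\<close> the value of the functional on the commutator of \<open>x\<^sub>i x\<^sub>j + x\<^sub>j x\<^sub>i\<close> with \<open>x\<^sub>l\<close>, the polynomial
  \<open>S = (\<Sum>i j l. G i j l z\<^sub>i z\<^sub>j z\<^sub>l)\<close> is twice the value of the syzygy. It is invariant under cyclic rotation of
  the indices, and the sum of the three rotations is zero by the Jacobi identity.
\<close>

lemma y_central: "y k * x j - x j * y k \<in> J"
proof (rule ccontr)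
  assume "y k * x j - x j * y k \<notin> J"
  then obtain \<phi> where add: "\<And>f g. \<phi> (f + g) = \<phi> f + \<phi> g" and scale: "\<And>c f. \<phi> (scal c * f) = c * \<phi> f"
    and zero: "\<And>f. f \<in> J \<Longrightarrow> \<phi> f = 0" and one: "\<phi> (y k * x j - x j * y k) = 1"
    using scal_separating_functional[OF J] by blast
  have diff: "\<phi> f = \<phi> g" if "f - g \<in> J" for f g
    using add[of "f - g" g] zero[OF that] by simp
  define c where "c k j = \<phi> (y k * x j - x j * y k)" for k j
  have comm: "\<phi> (cliff_anticomm i j * x l - x l * cliff_anticomm i j) = \<alpha> (i - j) * c ((i + j) / 2) l" for i j l
  proof -
    let ?s = "scal (\<alpha> (i - j))" and ?y = "y ((i + j) / 2)"
    have "(cliff_anticomm i j - ?s * ?y) * x l - x l * (cliff_anticomm i j - ?s * ?y) \<in> J"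
      by (intro tsi_diff[OF J] tsi_left[OF J] tsi_right[OF J] anticomm_y)
    moreover have "x l * (?s * ?y) = ?s * (x l * ?y)"
      by (simp only: scal_commute flip: mult.assoc)
    ultimately have "(cliff_anticomm i j * x l - x l * cliff_anticomm i j)
        - ?s * (?y * x l - x l * ?y) \<in> J"
      by (simp add: left_diff_distrib right_diff_distrib algebra_simps mult.assoc)
    from diff[OF this] show ?thesis by (simp only: scale c_def)
  qed
  define G where "G i j l = \<alpha> (i - j) * c ((i + j) / 2) l" for i j l
  have cyc: "G i j l + G j l i + G l i j = 0" for i j l
  proof -
    have "(cliff_anticomm i j * x l - x l * cliff_anticomm i j)
        + (cliff_anticomm j l * x i - x i * cliff_anticomm j l)
        + (cliff_anticomm l i * x j - x j * cliff_anticomm l i) = 0"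
      unfolding cliff_anticomm_def by (rule commutator_jacobi)
    then have "\<phi> ((cliff_anticomm i j * x l - x l * cliff_anticomm i j)
        + (cliff_anticomm j l * x i - x i * cliff_anticomm j l)
        + (cliff_anticomm l i * x j - x j * cliff_anticomm l i)) = 0"
      using zero[OF tsi_0[OF J]] by simp
    then show ?thesis by (simp only: add comm G_def)
  qed
  let ?z = "poly_var :: 'p mod_ring \<Rightarrow> 'p mod_ring poly_alg"
  let ?m = "\<lambda>i j l. ?z i * ?z j * ?z l"
  define S where "S = (\<Sum>i\<in>UNIV. \<Sum>j\<in>UNIV. \<Sum>l\<in>UNIV. scal (G i j l) * ?m i j l)"
  have rot1: "S = (\<Sum>i\<in>UNIV. \<Sum>j\<in>UNIV. \<Sum>l\<in>UNIV. scal (G j l i) * ?m i j l)"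
  proof -
    have "S = (\<Sum>j\<in>UNIV. \<Sum>l\<in>UNIV. \<Sum>i\<in>UNIV. scal (G j l i) * ?m j l i)" unfolding S_def ..
    also have "\<dots> = (\<Sum>j\<in>UNIV. \<Sum>i\<in>UNIV. \<Sum>l\<in>UNIV. scal (G j l i) * ?m j l i)"
      by (rule sum.cong[OF HOL.refl], rule sum.swap)
    also have "\<dots> = (\<Sum>i\<in>UNIV. \<Sum>j\<in>UNIV. \<Sum>l\<in>UNIV. scal (G j l i) * ?m j l i)" by (rule sum.swap)
    finally show ?thesis by (simp only: mult_ac)
  qed
  have rot2: "S = (\<Sum>i\<in>UNIV. \<Sum>j\<in>UNIV. \<Sum>l\<in>UNIV. scal (G l i j) * ?m i j l)"
  proof -
    have "S = (\<Sum>l\<in>UNIV. \<Sum>i\<in>UNIV. \<Sum>j\<in>UNIV. scal (G l i j) * ?m l i j)" unfolding S_def ..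
    also have "\<dots> = (\<Sum>i\<in>UNIV. \<Sum>l\<in>UNIV. \<Sum>j\<in>UNIV. scal (G l i j) * ?m l i j)" by (rule sum.swap)
    also have "\<dots> = (\<Sum>i\<in>UNIV. \<Sum>j\<in>UNIV. \<Sum>l\<in>UNIV. scal (G l i j) * ?m l i j)"
      by (rule sum.cong[OF HOL.refl], rule sum.swap)
    finally show ?thesis by (simp only: mult_ac)
  qed
  have "S + S + S = (\<Sum>i\<in>UNIV. \<Sum>j\<in>UNIV. \<Sum>l\<in>UNIV.
      scal (G i j l) * ?m i j l + scal (G j l i) * ?m i j l + scal (G l i j) * ?m i j l)"
    unfolding sum.distrib S_def[symmetric] rot1[symmetric] rot2[symmetric] by (rule HOL.refl)
  also have "\<dots> = 0" by (simp only: cyc scal_0 mult_zero_left sum.neutral_const flip: distrib_right scal_add)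
  finally have S3: "S + S + S = 0" .
  have S0: "S = 0"
  proof (rule poly_mapping_eqI)
    fix m
    have "Poly_Mapping.lookup S m + Poly_Mapping.lookup S m + Poly_Mapping.lookup S m = 0"
      using arg_cong[OF S3, of "\<lambda>f. Poly_Mapping.lookup f m"] by (simp only: lookup_add lookup_zero)
    then show "Poly_Mapping.lookup S m = Poly_Mapping.lookup 0 m" by simp
  qed
  have "(\<Sum>k\<in>UNIV. quadric k * (\<Sum>j\<in>UNIV. scal (c k j) * ?z j))
      = (\<Sum>k\<in>UNIV. \<Sum>d\<in>UNIV. \<Sum>l\<in>UNIV. scal (\<alpha> d / 2 * c k l) * ?m (k + d / 2) (k - d / 2) l)"
    unfolding quadric_def sum_product by (simp only: scal_mult mult_ac)
  also have "\<dots> = (\<Sum>k\<in>UNIV. \<Sum>d\<in>UNIV. (\<lambda>i j. \<Sum>l\<in>UNIV.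
      scal (\<alpha> (i - j) / 2 * c ((i + j) / 2) l) * ?m i j l) (k + d / 2) (k - d / 2))"
  proof (intro sum.cong HOL.refl)
    fix k d l :: "'p mod_ring"
    show "scal (\<alpha> d / 2 * c k l) * ?m (k + d / 2) (k - d / 2) l =
      scal (\<alpha> (k + d / 2 - (k - d / 2)) / 2 * c ((k + d / 2 + (k - d / 2)) / 2) l) * ?m (k + d / 2) (k - d / 2) l"
      by (simp only: midpoint_sum midpoint_diff times_divide_eq_left)
  qed
  also have "\<dots> = (\<Sum>i\<in>UNIV. \<Sum>j\<in>UNIV. \<Sum>l\<in>UNIV. scal (\<alpha> (i - j) / 2 * c ((i + j) / 2) l) * ?m i j l)"
    by (rule sum_midpoints)
  also have "\<dots> = scal (1 / 2) * S"
    unfolding S_def sum_distrib_left G_def by (simp add: alg.scale_scale)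
  finally have "(\<Sum>k\<in>UNIV. quadric k * (\<Sum>j\<in>UNIV. scal (c k j) * ?z j)) = 0" by (simp add: S0)
  then have "c k j = 0" by (rule no_quadric_syzygy)
  then show False using one by (simp add: c_def)
qed

end

section \<open>Normal monomials span\<close>

lemma free_word: "prod_list (map free_var w) = Poly_Mapping.single (Free_Mon w) 1"
  by (induction w) (simp_all add: free_var_def mult_single plus_free_mon_def single_one flip: zero_free_mon_def)

text \<open>
  Normal monomials are indexed by exponent vectors like ordinary monomials: \<open>u i\<close> plays the role of the
  square of \<open>v i\<close>.
\<close>

definition nfactor :: "('i \<Rightarrow> 'a::monoid_mult) \<Rightarrow> ('i \<Rightarrow> 'a) \<Rightarrow> 'i \<Rightarrow> nat \<Rightarrow> 'a" where
  "nfactor u v i n = u i ^ (n div 2) * v i ^ (n mod 2)"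

definition nmon :: "('i \<Rightarrow> 'a::monoid_mult) \<Rightarrow> ('i \<Rightarrow> 'a) \<Rightarrow> 'i list \<Rightarrow> ('i \<Rightarrow> nat) \<Rightarrow> 'a" where
  "nmon u v L e = prod_list (map (\<lambda>i. nfactor u v i (e i)) L)"

lemma nmon_Nil [simp]: "nmon u v [] e = 1"
  and nmon_Cons [simp]: "nmon u v (i # L) e = nfactor u v i (e i) * nmon u v L e"
  by (simp_all add: nmon_def)

lemma nmon_upd: "i \<notin> set L \<Longrightarrow> nmon u v L (e(i := n)) = nmon u v L e"
  by (induction L) auto

lemma nfactor_simps [simp]: "nfactor u v i 0 = 1" "nfactor u v i (Suc 0) = v i"
  "nfactor u v i (Suc (Suc n)) = u i * nfactor u v i n"
  by (simp_all add: nfactor_def mult.assoc)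

locale clifford_generators =
  fixes J :: "('m::monoid_add \<Rightarrow>\<^sub>0 complex) set" and u v :: "'i::finite \<Rightarrow> 'm \<Rightarrow>\<^sub>0 complex"
  assumes ideal: "two_sided_ideal J"
    and central: "\<And>i f. u i * f - f * u i \<in> J"
    and anticomm: "\<And>i j. \<exists>E. v i * v j + v j * v i - (\<Sum>k\<in>UNIV. scal (E k) * u k) \<in> J"
begin

definition ymon :: "'i list \<Rightarrow> 'm \<Rightarrow>\<^sub>0 complex" where "ymon ks = prod_list (map u ks)"
definition xmon :: "'i list \<Rightarrow> 'm \<Rightarrow>\<^sub>0 complex" where "xmon is = prod_list (map v is)"

text \<open>
  Products of central generators with sorted words. Sorted words are subsequences of the list \<open>L\<close> that
  gives the order, which makes them accessible to induction on \<open>L\<close>.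
\<close>

definition ordered_gens :: "'i list \<Rightarrow> nat \<Rightarrow> ('m \<Rightarrow>\<^sub>0 complex) set" where
  "ordered_gens L n = {ymon ks * xmon is | ks is. is \<in> set (subseqs L) \<and> 2 * length ks + length is = n}"

definition ordered_span :: "'i list \<Rightarrow> nat \<Rightarrow> ('m \<Rightarrow>\<^sub>0 complex) set" where
  "ordered_span L n = alg.span (J \<union> ordered_gens L n)"

lemma ordered_gensI:
  "is \<in> set (subseqs L) \<Longrightarrow> 2 * length ks + length is = n \<Longrightarrow> ymon ks * xmon is \<in> ordered_gens L n"
  unfolding ordered_gens_def by blast

lemma ordered_spanI:
  "is \<in> set (subseqs L) \<Longrightarrow> 2 * length ks + length is = n \<Longrightarrow> ymon ks * xmon is \<in> ordered_span L n"
  unfolding ordered_span_def by (intro alg.span_base UnI2 ordered_gensI)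

lemma span_mod: "f - g \<in> J \<Longrightarrow> g \<in> alg.span (J \<union> X) \<Longrightarrow> f \<in> alg.span (J \<union> X)"
  using alg.span_add[of g "J \<union> X" "f - g"] alg.span_base[of "f - g" "J \<union> X"] by simp

lemma ideal_in_span: "f \<in> J \<Longrightarrow> f \<in> alg.span (J \<union> X)"
  by (rule alg.span_base) simp

lemma span_left_mult:
  assumes gen: "\<And>g. g \<in> X \<Longrightarrow> h * g \<in> alg.span (J \<union> Y)" and f: "f \<in> alg.span (J \<union> X)"
  shows "h * f \<in> alg.span (J \<union> Y)"
  using f
proof (induction rule: alg.span_induct_alt)
  case base
  show ?case using alg.span_zero by simp
next
  case (step c g f)
  have "h * g \<in> alg.span (J \<union> Y)"
    using step(1) gen ideal_in_span[OF tsi_left[OF ideal]] by blast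
  then have "scal c * (h * g) + h * f \<in> alg.span (J \<union> Y)"
    by (intro alg.span_add alg.span_scale step)
  moreover have "scal c * (h * g) + h * f = h * (scal c * g + f)"
    by (simp only: distrib_left scal_commute flip: mult.assoc)
  ultimately show ?case by simp
qed

lemma span_ideal_mono: "X \<subseteq> Y \<Longrightarrow> f \<in> alg.span (J \<union> X) \<Longrightarrow> f \<in> alg.span (J \<union> Y)"
  using alg.span_mono[of "J \<union> X" "J \<union> Y"] by blast

lemma ymon_central: "f * ymon ks - ymon ks * f \<in> J"
proof (induction ks)
  case Nil
  then show ?case using tsi_0[OF ideal] by (simp add: ymon_def)
next
  case (Cons k ks)
  have "f * u k * ymon ks - u k * f * ymon ks \<in> J"
    by (rule tsi_mult_right[OF ideal tsi_sym[OF ideal central]])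
  moreover have "u k * (f * ymon ks) - u k * (ymon ks * f) \<in> J"
    by (rule tsi_mult_left[OF ideal Cons])
  ultimately show ?case
    using tsi_trans[OF ideal] by (fastforce simp: ymon_def mult.assoc)
qed

lemma ymon_ordered_span:
  assumes "f \<in> ordered_span L n"
  shows "ymon js * f \<in> ordered_span L (2 * length js + n)"
  unfolding ordered_span_def
proof (rule span_left_mult[OF _ assms[unfolded ordered_span_def]])
  fix g assume "g \<in> ordered_gens L n"
  then obtain ks "is" where g: "g = ymon ks * xmon is" "is \<in> set (subseqs L)" "2 * length ks + length is = n"
    unfolding ordered_gens_def by blast
  have "ymon js * g = ymon (js @ ks) * xmon is" by (simp add: g(1) ymon_def mult.assoc)
  moreover have "\<dots> \<in> ordered_span L (2 * length js + n)"
    using g(2,3) by (intro ordered_spanI) simp_all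
  ultimately show "ymon js * g \<in> alg.span (J \<union> ordered_gens L (2 * length js + n))"
    by (simp add: ordered_span_def)
qed

lemma ordered_span_mod: "f - g \<in> J \<Longrightarrow> g \<in> ordered_span L n \<Longrightarrow> f \<in> ordered_span L n"
  unfolding ordered_span_def by (rule span_mod)

lemma ordered_span_Cons: "f \<in> ordered_span L n \<Longrightarrow> f \<in> ordered_span (j # L) n"
  unfolding ordered_span_def
  by (erule span_ideal_mono[rotated]) (auto simp: ordered_gens_def Let_def)

lemma gen_left_ordered_span:
  assumes "f \<in> ordered_span L n"
  shows "v j * f \<in> ordered_span (j # L) (Suc n)"
  unfolding ordered_span_def
proof (rule span_left_mult[OF _ assms[unfolded ordered_span_def]])
  fix g assume "g \<in> ordered_gens L n"
  then obtain ks "is" where g: "g = ymon ks * xmon is" "is \<in> set (subseqs L)" "2 * length ks + length is = n"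
    unfolding ordered_gens_def by blast
  have "v j * ymon ks * xmon is - ymon ks * v j * xmon is \<in> J"
    by (rule tsi_mult_right[OF ideal ymon_central])
  then have "v j * g - ymon ks * xmon (j # is) \<in> J" by (simp add: g(1) xmon_def mult.assoc)
  moreover have "ymon ks * xmon (j # is) \<in> ordered_span (j # L) (Suc n)"
    using g(2,3) by (intro ordered_spanI) (simp_all add: Let_def)
  ultimately show "v j * g \<in> alg.span (J \<union> ordered_gens (j # L) (Suc n))"
    using ordered_span_mod by (simp add: ordered_span_def)
qed

lemma central_sum_in_ordered_span:
  assumes "is \<in> set (subseqs L)"
  shows "(\<Sum>k\<in>UNIV. scal (E k) * u k) * xmon is \<in> ordered_span L (2 + length is)"
proof -
  have "u k * xmon is \<in> ordered_span L (2 + length is)" for k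
    using ordered_spanI[OF assms, of "[k]"] by (simp add: ymon_def)
  then have "(\<Sum>k\<in>UNIV. scal (E k) * (u k * xmon is)) \<in> ordered_span L (2 + length is)"
    unfolding ordered_span_def by (intro alg.span_sum alg.span_scale)
  then show ?thesis by (simp add: sum_distrib_right mult.assoc)
qed

text \<open>
  Sorting. If \<open>i\<close> comes after the first letter \<open>j\<close> of the word, the two are exchanged at the expense of a
  term in which both are replaced by a central generator; if \<open>i = j\<close>, half of that term is all that remains.
\<close>

lemma gen_xmon_ordered_span:
  assumes "i \<in> set L" "is \<in> set (subseqs L)"
  shows "v i * xmon is \<in> ordered_span L (Suc (length is))"
  using assms
proof (induction L arbitrary: "is")
  case Nil
  then show ?case by simp
next
  case (Cons j L)
  obtain E where E: "v i * v j + v j * v i - (\<Sum>k\<in>UNIV. scal (E k) * u k) \<in> J"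
    using anticomm by blast
  consider (new) "is \<in> set (subseqs L)" "i = j" | (skip) "is \<in> set (subseqs L)" "i \<noteq> j"
    | (head) js where "is = j # js" "js \<in> set (subseqs L)"
    using Cons.prems(2) by (auto simp: Let_def)
  then show ?case
  proof cases
    case new
    then show ?thesis using ordered_spanI[of "i # is" "j # L" "[]" "Suc (length is)"]
      by (simp add: Let_def ymon_def xmon_def)
  next
    case skip
    then show ?thesis using Cons.IH[of "is"] Cons.prems(1) by (intro ordered_span_Cons) simp
  next
    case head
    have js: "js \<in> set (subseqs (j # L))" using head(2) by (simp add: Let_def)
    let ?c = "(\<Sum>k\<in>UNIV. scal (E k) * u k) * xmon js"
    have c: "?c \<in> ordered_span (j # L) (2 + length js)" by (rule central_sum_in_ordered_span[OF js])
    have rel: "(v i * v j + v j * v i) * xmon js - ?c \<in> J" by (rule tsi_mult_right[OF ideal E])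
    have len: "2 + length js = Suc (length is)" using head(1) by simp
    show ?thesis
    proof (cases "i = j")
      case True
      have "scal (1 / 2) * ((v i * v j + v j * v i) * xmon js) \<in> ordered_span (j # L) (2 + length js)"
        using ordered_span_mod[OF rel c] unfolding ordered_span_def by (rule alg.span_scale)
      moreover have "scal (1 / 2) * (f + f) = f" for f :: "'m \<Rightarrow>\<^sub>0 complex"
        by (rule poly_mapping_eqI) (simp only: lookup_scal_mult lookup_add, simp)
      then have "scal (1 / 2) * ((v i * v j + v j * v i) * xmon js) = v i * xmon is"
        by (simp only: True head(1) xmon_def list.map prod_list.Cons distrib_right mult.assoc)
      ultimately show ?thesis using len by simp
    next
      case False
      then have "v i * xmon js \<in> ordered_span L (Suc (length js))"
        using Cons.IH[OF _ head(2)] Cons.prems(1) by simp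
      then have "v j * (v i * xmon js) \<in> ordered_span (j # L) (2 + length js)"
        using gen_left_ordered_span by fastforce
      then have "?c - v j * (v i * xmon js) \<in> ordered_span (j # L) (2 + length js)"
        using c unfolding ordered_span_def by (intro alg.span_diff)
      moreover have "v i * xmon is - (?c - v j * (v i * xmon js)) \<in> J"
        using rel by (simp add: head(1) xmon_def distrib_right mult.assoc algebra_simps)
      ultimately show ?thesis using ordered_span_mod len by metis
    qed
  qed
qed

lemma gen_ordered_span:
  assumes i: "i \<in> set L" and f: "f \<in> ordered_span L n"
  shows "v i * f \<in> ordered_span L (Suc n)"
  unfolding ordered_span_def
proof (rule span_left_mult[OF _ f[unfolded ordered_span_def]])
  fix g assume "g \<in> ordered_gens L n"
  then obtain ks "is" where g: "g = ymon ks * xmon is" "is \<in> set (subseqs L)" "2 * length ks + length is = n"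
    unfolding ordered_gens_def by blast
  have "v i * ymon ks * xmon is - ymon ks * v i * xmon is \<in> J"
    by (rule tsi_mult_right[OF ideal ymon_central])
  then have "v i * g - ymon ks * (v i * xmon is) \<in> J" by (simp add: g(1) mult.assoc)
  moreover have "ymon ks * (v i * xmon is) \<in> ordered_span L (Suc n)"
    using ymon_ordered_span[OF gen_xmon_ordered_span[OF i g(2)], of ks] g(3) by simp
  ultimately show "v i * g \<in> alg.span (J \<union> ordered_gens L (Suc n))"
    using ordered_span_mod by (simp add: ordered_span_def)
qed

lemma xmon_nmon:
  "distinct L \<Longrightarrow> is \<in> set (subseqs L) \<Longrightarrow>
     \<exists>e. xmon is = nmon u v L e \<and> (\<Sum>i\<in>set L. e i) = length is \<and> (\<forall>i. i \<notin> set L \<longrightarrow> e i = 0)"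
proof (induction L arbitrary: "is")
  case Nil
  then show ?case by (intro exI[of _ "\<lambda>_. 0"]) (simp add: xmon_def)
next
  case (Cons j L)
  consider (skip) "is \<in> set (subseqs L)" | (head) js where "is = j # js" "js \<in> set (subseqs L)"
    using Cons.prems(2) by (auto simp: Let_def)
  then show ?case
  proof cases
    case skip
    then obtain e where "xmon is = nmon u v L e" "(\<Sum>i\<in>set L. e i) = length is" "\<forall>i. i \<notin> set L \<longrightarrow> e i = 0"
      using Cons by fastforce
    then show ?thesis using Cons.prems(1) by (intro exI[of _ e]) auto
  next
    case head
    then obtain e where e: "xmon js = nmon u v L e" "(\<Sum>i\<in>set L. e i) = length js" "\<forall>i. i \<notin> set L \<longrightarrow> e i = 0"
      using Cons by fastforce
    have j: "j \<notin> set L" using Cons.prems(1) by simp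
    have sum: "(\<Sum>i\<in>set L. (e(j := 1)) i) = length js"
      unfolding e(2)[symmetric] by (rule sum.cong) (use j in auto)
    have mon: "xmon is = nmon u v (j # L) (e(j := 1))"
      using e(1) by (simp only: head(1) xmon_def list.map prod_list.Cons nmon_Cons nmon_upd[OF j]
          fun_upd_same nfactor_simps One_nat_def)
    show ?thesis
    proof (intro exI conjI)
      show "(\<Sum>i\<in>set (j # L). (e(j := 1)) i) = length is" using j sum head(1) by simp
      show "\<forall>i. i \<notin> set (j # L) \<longrightarrow> (e(j := 1)) i = 0" using e(3) by simp
    qed (rule mon)
  qed
qed

lemma central_nmon:
  "distinct L \<Longrightarrow> k \<in> set L \<Longrightarrow> u k * nmon u v L e - nmon u v L (e(k := e k + 2)) \<in> J"
proof (induction L)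
  case Nil
  then show ?case by simp
next
  case (Cons j L)
  show ?case
  proof (cases "k = j")
    case True
    have j: "j \<notin> set L" using Cons.prems(1) by simp
    have eq: "u k * nmon u v (j # L) e = nmon u v (j # L) (e(k := e k + 2))"
      by (simp only: True nmon_Cons nmon_upd[OF j] fun_upd_same add_2_eq_Suc' nfactor_simps mult.assoc)
    show ?thesis unfolding eq using tsi_0[OF ideal] by (simp only: diff_self)
  next
    case False
    let ?t = "nfactor u v j (e j)"
    have comm: "u k * ?t * nmon u v L e - ?t * u k * nmon u v L e \<in> J"
      by (rule tsi_mult_right[OF ideal central])
    have "u k * nmon u v L e - nmon u v L (e(k := e k + 2)) \<in> J"
      by (rule Cons.IH) (use Cons.prems False in simp_all)
    then have "?t * (u k * nmon u v L e) - ?t * nmon u v L (e(k := e k + 2)) \<in> J"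
      by (rule tsi_mult_left[OF ideal])
    from tsi_trans[OF ideal comm[unfolded mult.assoc] this]
    show ?thesis by (simp only: nmon_Cons fun_upd_other[OF False[symmetric]] mult.assoc)
  qed
qed

lemma ordered_gens_nmon:
  assumes L: "distinct L" "set L = UNIV" and "is \<in> set (subseqs L)"
  shows "\<exists>e. ymon ks * xmon is - nmon u v L e \<in> J \<and> (\<Sum>i\<in>UNIV. e i) = 2 * length ks + length is"
proof (induction ks)
  case Nil
  obtain e where e: "xmon is = nmon u v L e" "(\<Sum>i\<in>UNIV. e i) = length is"
    using xmon_nmon[OF L(1) assms(3)] unfolding L(2) by blast
  show ?case using tsi_0[OF ideal] by (intro exI[of _ e]) (simp add: e ymon_def)
next
  case (Cons k ks)
  then obtain e where e: "ymon ks * xmon is - nmon u v L e \<in> J"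
    "(\<Sum>i\<in>UNIV. e i) = 2 * length ks + length is" by blast
  let ?e = "e(k := e k + 2)"
  have "u k * (ymon ks * xmon is) - u k * nmon u v L e \<in> J" by (rule tsi_mult_left[OF ideal e(1)])
  moreover have "u k * nmon u v L e - nmon u v L ?e \<in> J" by (rule central_nmon) (simp_all add: L)
  ultimately have "u k * (ymon ks * xmon is) - nmon u v L ?e \<in> J" by (rule tsi_trans[OF ideal])
  moreover have "(\<Sum>i\<in>UNIV. ?e i) = (\<Sum>i\<in>UNIV. e i + (if i = k then 2 else 0))"
    by (rule sum.cong) auto
  ultimately show ?case using e(2)
    by (intro exI[of _ ?e] conjI) (simp_all only: ymon_def mult.assoc sum.distrib list.map prod_list.Cons, simp_all)
qed

lemma ordered_span_nmon:
  assumes L: "distinct L" "set L = UNIV" and f: "f \<in> ordered_span L n"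
  shows "f \<in> alg.span (J \<union> nmon u v L ` {e. (\<Sum>i\<in>UNIV. e i) = n})"
proof -
  have "1 * f \<in> alg.span (J \<union> nmon u v L ` {e. (\<Sum>i\<in>UNIV. e i) = n})"
  proof (rule span_left_mult[OF _ f[unfolded ordered_span_def]])
    fix g assume "g \<in> ordered_gens L n"
    then obtain ks "is" where g: "g = ymon ks * xmon is" "is \<in> set (subseqs L)" "2 * length ks + length is = n"
      unfolding ordered_gens_def by blast
    then obtain e where e: "g - nmon u v L e \<in> J" "(\<Sum>i\<in>UNIV. e i) = n"
      using ordered_gens_nmon[OF L g(2), of ks] by auto
    have "nmon u v L e \<in> alg.span (J \<union> nmon u v L ` {e. (\<Sum>i\<in>UNIV. e i) = n})"
      using e(2) by (intro alg.span_base) blast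
    then show "1 * g \<in> alg.span (J \<union> nmon u v L ` {e. (\<Sum>i\<in>UNIV. e i) = n})"
      using span_mod[OF e(1)] by simp
  qed
  then show ?thesis by simp
qed

text \<open>
  Words in other generators \<open>x\<close> are spanned as well when these are combinations of the \<open>v i\<close>; this allows
  the \<open>v i\<close> to be eigenvectors.
\<close>

lemma generators_span:
  assumes L: "distinct L" "set L = UNIV"
    and x: "\<And>j. \<exists>B. x j = (\<Sum>i\<in>UNIV. scal (B i) * v i)"
  shows "prod_list (map x w) \<in> alg.span (J \<union> nmon u v L ` {e. (\<Sum>i\<in>UNIV. e i) = length w})"
proof -
  have "prod_list (map x w) \<in> ordered_span L (length w)"
  proof (induction w)
    case Nil
    have "[] \<in> set (subseqs L)" by (induction L) (simp_all add: Let_def)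
    then show ?case using ordered_spanI[of "[]" L "[]" 0] by (simp add: ymon_def xmon_def)
  next
    case (Cons j w)
    obtain B where B: "x j = (\<Sum>i\<in>UNIV. scal (B i) * v i)" using x by blast
    have "(\<Sum>i\<in>UNIV. scal (B i) * (v i * prod_list (map x w))) \<in> ordered_span L (Suc (length w))"
      using gen_ordered_span[OF _ Cons] L(2) unfolding ordered_span_def
      by (intro alg.span_sum alg.span_scale) simp
    then show ?case by (simp add: B sum_distrib_right mult.assoc)
  qed
  then show ?thesis by (rule ordered_span_nmon[OF L])
qed

end

section \<open>A Clifford module on the exterior algebra\<close>

text \<open>
  Functions on the subsets of \<open>'i\<close> are the coordinates of elements of the exterior algebra, with respect
  to the products of basis vectors in the order given by \<open>pos\<close>.
\<close>

locale exterior_order =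
  fixes pos :: "'i::finite \<Rightarrow> nat"
  assumes inj_pos: "inj pos"
begin

text \<open>
  The sign of moving \<open>i\<close> to its place in \<open>S\<close>.
\<close>

definition sg :: "'i \<Rightarrow> 'i set \<Rightarrow> 'a::comm_ring_1" where
  "sg i S = (- 1) ^ card {s \<in> S. pos s < pos i}"

definition wedge :: "'i \<Rightarrow> ('i set \<Rightarrow> 'a::comm_ring_1) \<Rightarrow> 'i set \<Rightarrow> 'a" where
  "wedge i m S = (if i \<in> S then sg i S * m (S - {i}) else 0)"

definition contract :: "'i \<Rightarrow> ('i set \<Rightarrow> 'a::comm_ring_1) \<Rightarrow> 'i set \<Rightarrow> 'a" where
  "contract i m S = (if i \<in> S then 0 else sg i S * m (insert i S))"

lemma sg_self: "sg i (S - {i}) = sg i S" "sg i (insert i S) = sg i S"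
proof -
  have "{s \<in> S - {i}. pos s < pos i} = {s \<in> S. pos s < pos i}"
    "{s \<in> insert i S. pos s < pos i} = {s \<in> S. pos s < pos i}" by auto
  then show "sg i (S - {i}) = sg i S" "sg i (insert i S) = sg i S" by (simp_all only: sg_def)
qed

lemma sg_square: "sg i S * (sg i S * f) = f"
  by (simp add: sg_def flip: mult.assoc power_add mult_2)

lemma sg_insert:
  assumes "i \<notin> S"
  shows "sg j (insert i S) = (if pos i < pos j then - sg j S else sg j S)"
proof (cases "pos i < pos j")
  case True
  then have "{s \<in> insert i S. pos s < pos j} = insert i {s \<in> S. pos s < pos j}" by auto
  then show ?thesis using True assms by (simp add: sg_def)
next
  case False
  then have "{s \<in> insert i S. pos s < pos j} = {s \<in> S. pos s < pos j}" by auto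
  then show ?thesis using False by (simp add: sg_def)
qed

lemma sg_remove:
  assumes "i \<in> S"
  shows "(sg j (S - {i}) :: 'a::comm_ring_1) = (if pos i < pos j then - sg j S else sg j S)"
proof -
  have "insert i (S - {i}) = S" using assms by blast
  then show ?thesis using sg_insert[of i "S - {i}" j, where 'a = 'a] by simp
qed

lemma pos_cases: "i \<noteq> j \<Longrightarrow> pos i < pos j \<and> \<not> pos j < pos i \<or> pos j < pos i \<and> \<not> pos i < pos j"
  using inj_pos by (metis injD linorder_neqE_nat not_less_iff_gr_or_eq)

lemma wedge_wedge:
  fixes m :: "'i set \<Rightarrow> 'a::comm_ring_1"
  shows "wedge i (wedge j m) S + wedge j (wedge i m) S = 0"
proof (cases "i = j")
  case True
  then show ?thesis by (simp add: wedge_def)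
next
  case False
  show ?thesis
  proof (cases "i \<in> S \<and> j \<in> S")
    case True
    have T: "S - {j} - {i} = S - {i} - {j}" by blast
    have "wedge i (wedge j m) S = sg i S * (sg j (S - {i}) * m (S - {i} - {j}))"
      "wedge j (wedge i m) S = sg j S * (sg i (S - {j}) * m (S - {i} - {j}))"
      using True False by (simp_all only: wedge_def T) simp_all
    moreover have "(sg j S * sg i (S - {j}) :: 'a) = - (sg i S * sg j (S - {i}))"
      using pos_cases[OF False] True by (auto simp only: sg_remove if_True if_False mult_minus_right mult.commute minus_minus)
    ultimately show ?thesis by (simp flip: mult.assoc)
  qed (auto simp: wedge_def)
qed

lemma contract_contract:
  fixes m :: "'i set \<Rightarrow> 'a::comm_ring_1"
  shows "contract i (contract j m) S + contract j (contract i m) S = 0"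
proof (cases "i = j")
  case True
  then show ?thesis by (simp add: contract_def)
next
  case False
  show ?thesis
  proof (cases "i \<notin> S \<and> j \<notin> S")
    case True
    have T: "insert i (insert j S) = insert j (insert i S)" by blast
    have "contract i (contract j m) S = sg i S * (sg j (insert i S) * m (insert j (insert i S)))"
      "contract j (contract i m) S = sg j S * (sg i (insert j S) * m (insert j (insert i S)))"
      using True False by (simp_all only: contract_def T) simp_all
    moreover have "(sg j S * sg i (insert j S) :: 'a) = - (sg i S * sg j (insert i S))"
      using pos_cases[OF False] True
      by (auto simp only: sg_insert if_True if_False mult_minus_right mult.commute minus_minus not_False_eq_True)
    ultimately show ?thesis by (simp flip: mult.assoc)
  qed (auto simp: contract_def)
qed

lemma wedge_contract:
  fixes m :: "'i set \<Rightarrow> 'a::comm_ring_1"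
  shows "wedge i (contract j m) S + contract j (wedge i m) S = (if i = j then m S else 0)"
proof (cases "i = j")
  case True
  then show ?thesis
    by (cases "j \<in> S") (simp_all add: contract_def wedge_def sg_self sg_square insert_absorb)
next
  case False
  show ?thesis
  proof (cases "i \<in> S \<and> j \<notin> S")
    case True
    have T: "insert j S - {i} = insert j (S - {i})" using False by blast
    have "wedge i (contract j m) S = sg i S * (sg j (S - {i}) * m (insert j (S - {i})))"
      "contract j (wedge i m) S = sg j S * (sg i (insert j S) * m (insert j (S - {i})))"
      using True False by (simp_all only: contract_def wedge_def T) simp_all
    moreover have "(sg j S * sg i (insert j S) :: 'a) = - (sg i S * sg j (S - {i}))"
      using pos_cases[OF False] True
      by (auto simp only: sg_insert sg_remove if_True if_False mult_minus_right mult.commute minus_minus not_False_eq_True)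
    ultimately show ?thesis using False by (simp flip: mult.assoc)
  qed (use False in \<open>auto simp: contract_def wedge_def\<close>)
qed

text \<open>
  The exterior product with the basis vector \<open>i\<close> plus the contraction with the form \<open>b i\<close>. The bilinear form
  \<open>b\<close> is allowed to be non-symmetric: only its symmetrisation enters the anticommutators. It can thus be
  chosen triangular, and then no contraction contributes when the operators act in increasing order.
\<close>

definition cliff_op :: "('i \<Rightarrow> 'i \<Rightarrow> 'a::comm_ring_1) \<Rightarrow> 'i \<Rightarrow> ('i set \<Rightarrow> 'a) \<Rightarrow> 'i set \<Rightarrow> 'a" where
  "cliff_op b i m S = wedge i m S + (\<Sum>l\<in>UNIV. b i l * contract l m S)"

lemma wedge_add: "wedge i (\<lambda>S. f S + g S) S = wedge i f S + wedge i g S"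
  and wedge_sum: "wedge i (\<lambda>S. \<Sum>k\<in>A. c k * h k S) S = (\<Sum>k\<in>A. c k * wedge i (h k) S)"
  by (simp_all add: wedge_def distrib_left sum_distrib_left mult.left_commute)

lemma contract_add: "contract i (\<lambda>S. f S + g S) S = contract i f S + contract i g S"
  and contract_sum: "contract i (\<lambda>S. \<Sum>k\<in>A. c k * h k S) S = (\<Sum>k\<in>A. c k * contract i (h k) S)"
  by (simp_all add: contract_def distrib_left sum_distrib_left mult.left_commute)

lemma cliff_op_sum:
  "cliff_op b i (\<lambda>S. \<Sum>k\<in>A. c k * h k S) = (\<lambda>S. \<Sum>k\<in>A. c k * cliff_op b i (h k) S)"
proof
  fix S
  have "(\<Sum>l\<in>UNIV. b i l * (\<Sum>k\<in>A. c k * contract l (h k) S))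
      = (\<Sum>k\<in>A. c k * (\<Sum>l\<in>UNIV. b i l * contract l (h k) S))"
    unfolding sum_distrib_left by (subst sum.swap) (simp add: mult.left_commute)
  then show "cliff_op b i (\<lambda>S. \<Sum>k\<in>A. c k * h k S) S = (\<Sum>k\<in>A. c k * cliff_op b i (h k) S)"
    by (simp add: cliff_op_def wedge_sum contract_sum distrib_left sum.distrib)
qed

lemma cliff_op_anticomm:
  "cliff_op b i (cliff_op b j m) S + cliff_op b j (cliff_op b i m) S = (b i j + b j i) * m S"
proof -
  let ?B = "\<lambda>i j. \<Sum>l\<in>UNIV. \<Sum>k\<in>UNIV. b i l * (b j k * contract l (contract k m) S)"
  have expand: "cliff_op b i (cliff_op b j m) S = wedge i (wedge j m) S
      + (\<Sum>l\<in>UNIV. b j l * wedge i (contract l m) S)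
      + (\<Sum>l\<in>UNIV. b i l * contract l (wedge j m) S) + ?B i j" for i j
    unfolding cliff_op_def[abs_def]
    by (simp add: wedge_add wedge_sum contract_add contract_sum distrib_left sum.distrib
        sum_distrib_left add.assoc)
  have mixed: "(\<Sum>l\<in>UNIV. b j l * wedge i (contract l m) S) + (\<Sum>l\<in>UNIV. b j l * contract l (wedge i m) S)
      = b j i * m S" for i j
  proof -
    have "(\<Sum>l\<in>UNIV. b j l * wedge i (contract l m) S) + (\<Sum>l\<in>UNIV. b j l * contract l (wedge i m) S)
        = (\<Sum>l\<in>UNIV. b j l * (if i = l then m S else 0))"
      unfolding wedge_contract[symmetric] distrib_left sum.distrib by (rule HOL.refl)
    also have "\<dots> = b j i * m S" by (simp add: if_distrib[of "(*) _"] cong: if_cong)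
    finally show ?thesis .
  qed
  have "?B j i = (\<Sum>k\<in>UNIV. \<Sum>l\<in>UNIV. b j l * (b i k * contract l (contract k m) S))" by (rule sum.swap)
  then have "?B i j + ?B j i = (\<Sum>l\<in>UNIV. \<Sum>k\<in>UNIV.
      b i l * (b j k * (contract l (contract k m) S + contract k (contract l m) S)))"
    by (simp only: mult.left_commute[of "b j _" "b i _"] distrib_left sum.distrib)
  then have BB: "?B i j + ?B j i = 0" by (simp only: contract_contract mult_zero_right sum.neutral_const)
  have "cliff_op b i (cliff_op b j m) S + cliff_op b j (cliff_op b i m) S
      = (wedge i (wedge j m) S + wedge j (wedge i m) S)
      + ((\<Sum>l\<in>UNIV. b j l * wedge i (contract l m) S) + (\<Sum>l\<in>UNIV. b j l * contract l (wedge i m) S))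
      + ((\<Sum>l\<in>UNIV. b i l * wedge j (contract l m) S) + (\<Sum>l\<in>UNIV. b i l * contract l (wedge j m) S))
      + (?B i j + ?B j i)"
    unfolding expand[of i j] expand[of j i] by (simp only: add_ac)
  then show ?thesis unfolding wedge_wedge mixed BB by (simp add: distrib_right add.commute)
qed

text \<open>
  When \<open>j\<close> precedes \<open>T\<close> and \<open>b j\<close> vanishes behind \<open>j\<close>, the operator sends the basis vector of \<open>T\<close> to that of
  \<open>insert j T\<close> without further terms.
\<close>

lemma cliff_op_order:
  fixes b :: "'i \<Rightarrow> 'i \<Rightarrow> 'a::comm_ring_1"
  assumes "\<And>s. s \<in> T \<Longrightarrow> pos j < pos s" "\<And>l. pos j < pos l \<Longrightarrow> b j l = 0"
  shows "cliff_op b j (\<lambda>S. if S = T then c else 0) S = (if S = insert j T then c else 0)"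
proof -
  have jT: "j \<notin> T" using assms(1) by blast
  have "b j l * contract l (\<lambda>S. if S = T then c else 0) S = 0" for l
  proof (cases "insert l S = T")
    case True
    then have "b j l = 0" using assms by blast
    then show ?thesis by simp
  qed (simp add: contract_def)
  moreover have "wedge j (\<lambda>S. if S = T then c else 0) S = (if S = insert j T then c else 0)"
  proof (cases "S = insert j T")
    case True
    have "{s \<in> insert j T. pos s < pos j} = {}" using assms(1) by force
    then have "(sg j (insert j T) :: 'a) = 1" unfolding sg_def by (simp only: card.empty power_0)
    then show ?thesis using True jT by (simp add: wedge_def)
  qed (use jT in \<open>auto simp: wedge_def\<close>)
  ultimately show ?thesis by (simp add: cliff_op_def)
qed

end

lemma sorted_position:
  obtains pos :: "'i::finite \<Rightarrow> nat" and L :: "'i list"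
  where "inj pos" "distinct L" "set L = UNIV" "sorted_wrt (\<lambda>i j. pos i < pos j) L"
proof -
  obtain L :: "'i list" where L: "set L = UNIV" "distinct L" using finite_distinct_list[of "UNIV :: 'i set"] by auto
  define pos where "pos i = (THE n. n < length L \<and> L ! n = i)" for i
  have pos: "pos (L ! n) = n" if "n < length L" for n
    unfolding pos_def using that L(2) by (intro the_equality) (auto simp: nth_eq_iff_index_eq)
  have "inj pos"
  proof (rule injI)
    fix i j assume "pos i = pos j"
    moreover obtain n m where "i = L ! n" "n < length L" "j = L ! m" "m < length L"
      using L(1) by (metis UNIV_I in_set_conv_nth)
    ultimately show "i = j" using pos by metis
  qed
  moreover have "sorted_wrt (\<lambda>i j. pos i < pos j) L"
    by (simp add: sorted_wrt_iff_nth_less pos)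
  ultimately show thesis using that L by blast
qed

section \<open>Independence of the normal monomials\<close>

locale clifford_module = regular_clifford P a + exterior_order pos
  for P :: "'p::prime_card itself" and a :: "nat \<Rightarrow> complex" and pos :: "'p mod_ring \<Rightarrow> nat"
begin

text \<open>
  The coefficients of the exterior algebra are polynomials in variables that represent the \<open>y\<^sub>k\<close>.
\<close>

definition mid :: "'p mod_ring \<Rightarrow> 'p mod_ring \<Rightarrow> 'p mod_ring poly_alg" where
  "mid i j = poly_var ((i + j) / 2)"

lemma mid_commute: "mid j i = mid i j"
  by (simp only: mid_def add.commute)

text \<open>
  A lower triangular form whose symmetrisation consists of the prescribed anticommutators.
\<close>

definition b :: "'p mod_ring \<Rightarrow> 'p mod_ring \<Rightarrow> 'p mod_ring poly_alg" where
  "b i l = (if l = i then scal (a 0) * mid i i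
     else if pos l < pos i then scal (\<alpha> (i - l)) * mid i l else 0)"

lemma b_sum: "b i j + b j i = scal (\<alpha> (i - j)) * mid i j"
proof (cases "i = j")
  case True
  have "scal (\<alpha> (j - j)) = (scal (a 0) + scal (a 0) :: 'p mod_ring poly_alg)"
    by (simp only: diff_self cliff_coeff_0 mult_2 scal_add)
  then show ?thesis by (simp only: True b_def simp_thms if_True distrib_right)
next
  case False
  have "\<alpha> (j - i) = \<alpha> (i - j)" using cliff_coeff_minus[of a "i - j"] by simp
  then show ?thesis using pos_cases[OF False] False not_sym[OF False]
    by (elim disjE) (simp_all only: b_def mid_commute[of j i] if_True if_False simp_thms add_0 add_0_right)
qed

abbreviation op :: "'p mod_ring \<Rightarrow> ('p mod_ring set \<Rightarrow> 'p mod_ring poly_alg) \<Rightarrow> 'p mod_ring set \<Rightarrow> 'p mod_ring poly_alg"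
  where "op \<equiv> cliff_op b"

definition word_op :: "'p mod_ring free_mon \<Rightarrow> ('p mod_ring set \<Rightarrow> 'p mod_ring poly_alg)
    \<Rightarrow> 'p mod_ring set \<Rightarrow> 'p mod_ring poly_alg" where
  "word_op w m = foldr op (letters w) m"

lemma word_op_add: "word_op (u + w) m = word_op u (word_op w m)"
  by (simp add: word_op_def plus_free_mon_def)

lemma word_op_sum:
  "word_op w (\<lambda>S. \<Sum>k\<in>A. c k * h k S) = (\<lambda>S. \<Sum>k\<in>A. c k * word_op w (h k) S)"
proof -
  have "foldr op l (\<lambda>S. \<Sum>k\<in>A. c k * h k S) = (\<lambda>S. \<Sum>k\<in>A. c k * foldr op l (h k) S)" for l
    by (induction l) (simp_all add: cliff_op_sum)
  then show ?thesis unfolding word_op_def .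
qed

definition rep :: "'p mod_ring free_alg \<Rightarrow> ('p mod_ring set \<Rightarrow> 'p mod_ring poly_alg)
    \<Rightarrow> 'p mod_ring set \<Rightarrow> 'p mod_ring poly_alg" where
  "rep f m S = monoid_lift (\<lambda>w. word_op w m S) f"

lemma rep_mult: "rep (f * g) m = rep f (rep g m)"
proof
  fix S
  let ?c = "Poly_Mapping.lookup"
  have single: "rep (Poly_Mapping.single u d * g) m S = scal d * word_op u (rep g m) S" for u d
  proof -
    have "rep (Poly_Mapping.single u d * g) m S = rep (Poly_Mapping.single u d *
        (\<Sum>w\<in>Poly_Mapping.keys g. Poly_Mapping.single w (?c g w))) m S"
      by (simp only: poly_mapping_sum_single)
    also have "\<dots> = scal d * (\<Sum>w\<in>Poly_Mapping.keys g. scal (?c g w) * word_op u (word_op w m) S)"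
      by (simp only: rep_def sum_distrib_left mult_single monoid_lift_sum monoid_lift_single word_op_add
          scal_mult mult.assoc)
    also have "(\<Sum>w\<in>Poly_Mapping.keys g. scal (?c g w) * word_op u (word_op w m) S) = word_op u (rep g m) S"
      unfolding rep_def[abs_def] monoid_lift_def word_op_sum ..
    finally show ?thesis .
  qed
  have "rep (f * g) m S = rep ((\<Sum>u\<in>Poly_Mapping.keys f. Poly_Mapping.single u (?c f u)) * g) m S"
    by (simp only: poly_mapping_sum_single)
  also have "\<dots> = (\<Sum>u\<in>Poly_Mapping.keys f. scal (?c f u) * word_op u (rep g m) S)"
    unfolding sum_distrib_right single[symmetric] unfolding rep_def monoid_lift_sum ..
  also have "\<dots> = rep f (rep g m) S" unfolding rep_def[of f] monoid_lift_def ..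
  finally show "rep (f * g) m S = rep f (rep g m) S" .
qed

lemma rep_var: "rep (x i) m = op i m"
  by (rule ext) (simp add: rep_def free_var_def word_op_def)

lemma rep_linear: "rep (f + g) m S = rep f m S + rep g m S" "rep (f - g) m S = rep f m S - rep g m S"
  "rep (scal c * f) m S = scal c * rep f m S"
  by (simp_all add: rep_def monoid_lift_add monoid_lift_diff monoid_lift_scal)

lemma rep_one: "rep 1 m = m"
proof -
  have "rep (Poly_Mapping.single 0 1) m = m"
    by (rule ext) (simp add: rep_def word_op_def zero_free_mon_def)
  then show ?thesis by simp
qed

lemma rep_zero: "rep f (\<lambda>_. 0) S = 0"
proof -
  have "word_op w (\<lambda>_. 0) S = 0" for w
    using fun_cong[OF word_op_sum[where w = w and A = "{}"], where x = S] by simp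
  then show ?thesis by (simp add: rep_def monoid_lift_def)
qed

lemma rep_anticomm:
  "rep (cliff_anticomm i j) m S = scal (\<alpha> (i - j)) * mid i j * m S"
  unfolding cliff_anticomm_def by (simp only: rep_linear rep_mult rep_var cliff_op_anticomm b_sum)

lemma rep_y: "rep (y k) m = (\<lambda>S. poly_var k * m S)"
proof
  fix S
  have "rep (y k) m S = scal (1 / \<alpha> d0) * (scal (\<alpha> d0) * poly_var k * m S)"
    unfolding y_def pair_def cliff_anticomm_commute[of "k - d0 / 2"] rep_linear rep_anticomm mid_def
      midpoint_sum midpoint_diff by (rule HOL.refl)
  then show "rep (y k) m S = poly_var k * m S"
    using coeff_d0 by (simp flip: mult.assoc scal_mult)
qed

lemma rep_ideal: "f \<in> J \<Longrightarrow> rep f m S = 0"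
proof -
  let ?K = "{f. \<forall>m S. rep f m S = 0}"
  have "two_sided_ideal ?K"
  proof -
    have "rep 0 m S = 0" for m S using rep_linear(2)[of 0 0] by simp
    moreover have "rep (f * g) m S = 0" if "f \<in> ?K" for f g m S using that by (simp add: rep_mult)
    moreover have "rep (g * f) m S = 0" if "f \<in> ?K" for f g m S
    proof -
      have "rep f m = (\<lambda>_. 0)" using that by auto
      then show ?thesis by (simp add: rep_mult rep_zero)
    qed
    ultimately show ?thesis by (simp add: two_sided_ideal_def rep_linear)
  qed
  moreover have "cliff_anticomm i j - scal (\<alpha> (i - j)) * y ((i + j) / 2) \<in> ?K" for i j
    by (simp only: mem_Collect_eq rep_linear rep_anticomm rep_y mid_def mult.assoc diff_self) simp
  ultimately have "J \<subseteq> ?K" by (rule clifford_ideal_subset)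
  then show "f \<in> J \<Longrightarrow> rep f m S = 0" by blast
qed

definition vacuum :: "'p mod_ring set \<Rightarrow> 'p mod_ring poly_alg" where
  "vacuum S = (if S = {} then 1 else 0)"

lemma rep_y_power: "rep (y k ^ n) m = (\<lambda>S. poly_var k ^ n * m S)"
  by (induction n) (simp_all add: rep_one rep_mult rep_y mult.assoc)

text \<open>
  The normal monomials map the vacuum to distinct monomials: the odd exponents are recorded by the subset,
  the halves of the exponents by the polynomial coefficient.
\<close>

lemma rep_nmon:
  assumes "sorted_wrt (\<lambda>i j. pos i < pos j) L" "distinct L"
  shows "rep (nmon y x L e) vacuum = (\<lambda>S. if S = {i \<in> set L. odd (e i)}
    then \<Prod>i\<in>set L. poly_var i ^ (e i div 2) else 0)"
  using assms
proof (induction L)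
  case Nil
  show ?case by (rule ext) (simp add: rep_one vacuum_def)
next
  case (Cons j L)
  let ?T = "{i \<in> set L. odd (e i)}" and ?c = "\<Prod>i\<in>set L. poly_var i ^ (e i div 2) :: 'p mod_ring poly_alg"
  have IH: "rep (nmon y x L e) vacuum = (\<lambda>S. if S = ?T then ?c else 0)"
    using Cons by simp
  have j: "j \<notin> set L" using Cons.prems(2) by simp
  have order: "pos j < pos s" if "s \<in> ?T" for s using Cons.prems(1) that by simp
  have bz: "b j l = 0" if "pos j < pos l" for l using that by (auto simp: b_def)
  have "rep (x j ^ (e j mod 2)) (\<lambda>S. if S = ?T then ?c else 0)
      = (\<lambda>S. if S = {i \<in> set (j # L). odd (e i)} then ?c else 0)"
  proof (cases "odd (e j)")
    case True
    then have "{i \<in> set (j # L). odd (e i)} = insert j ?T" by auto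
    moreover have "op j (\<lambda>S. if S = ?T then ?c else 0) = (\<lambda>S. if S = insert j ?T then ?c else 0)"
    proof (rule ext, rule cliff_op_order)
      show "pos j < pos s" if "s \<in> ?T" for s using that by (rule order)
      show "b j l = 0" if "pos j < pos l" for l using that by (rule bz)
    qed
    moreover have "e j mod 2 = 1" using True by presburger
    ultimately show ?thesis by (simp only: power_one_right rep_var)
  next
    case False
    then have "{i \<in> set (j # L). odd (e i)} = ?T" by auto
    moreover have "e j mod 2 = 0" using False by presburger
    ultimately show ?thesis by (simp only: power_0 rep_one)
  qed
  then have "rep (nmon y x (j # L) e) vacuum = (\<lambda>S. poly_var j ^ (e j div 2) *
      (if S = {i \<in> set (j # L). odd (e i)} then ?c else 0))"
    by (simp only: nmon_Cons nfactor_def rep_mult IH rep_y_power)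
  also have "\<dots> = (\<lambda>S. if S = {i \<in> set (j # L). odd (e i)}
      then \<Prod>i\<in>set (j # L). poly_var i ^ (e i div 2) else 0)"
    by (rule ext) (use j in simp)
  finally show ?case .
qed

definition half_mon :: "('p mod_ring \<Rightarrow> nat) \<Rightarrow> 'p mod_ring \<Rightarrow>\<^sub>0 nat" where
  "half_mon e = Abs_poly_mapping (\<lambda>i. e i div 2)"

lemma lookup_half_mon: "Poly_Mapping.lookup (half_mon e) i = e i div 2"
  by (simp add: half_mon_def)

text \<open>
  The coordinate that detects the normal monomial of \<open>e\<close>.
\<close>

definition dual :: "('p mod_ring \<Rightarrow> nat) \<Rightarrow> 'p mod_ring free_alg \<Rightarrow> complex" where
  "dual e f = Poly_Mapping.lookup (rep f vacuum {i. odd (e i)}) (half_mon e)"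

lemma dual_linear: "dual e (f + g) = dual e f + dual e g" "dual e (scal c * f) = c * dual e f"
  by (simp_all add: dual_def rep_linear lookup_add)

lemma dual_ideal: "f \<in> J \<Longrightarrow> dual e f = 0"
  by (simp add: dual_def rep_ideal)

lemma dual_nmon:
  assumes L: "sorted_wrt (\<lambda>i j. pos i < pos j) L" "distinct L" "set L = UNIV"
  shows "dual e (nmon y x L e') = (if e = e' then 1 else 0)"
proof -
  have "(\<Prod>i\<in>UNIV. poly_var i ^ (e' i div 2)) = Poly_Mapping.single (half_mon e') (1 :: complex)"
    using poly_mon_var[of "half_mon e'"] by (simp add: poly_mon_def lookup_half_mon)
  then have "dual e (nmon y x L e') = (if {i. odd (e i)} = {i. odd (e' i)} \<and> half_mon e' = half_mon e then 1 else 0)"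
    unfolding dual_def rep_nmon[OF L(1,2)] L(3) by (simp add: lookup_single when_def)
  moreover have "e = e'" if o: "{i. odd (e i)} = {i. odd (e' i)}" and h: "half_mon e' = half_mon e"
  proof
    fix i
    have "odd (e i) \<longleftrightarrow> odd (e' i)" using o by blast
    moreover have "e i div 2 = e' i div 2" 
      using arg_cong[OF h, of "\<lambda>m. Poly_Mapping.lookup m i"] by (simp only: lookup_half_mon)
    ultimately show "e i = e' i" by presburger
  qed
  ultimately show ?thesis by auto
qed

end

section \<open>Traces on quotients of spaces of polynomials\<close>

text \<open>
  A common description of the homogeneous parts of both algebras: a space \<open>W\<close> that is the image of a
  subspace \<open>S\<close> of a monoid algebra under a linear map \<open>\<pi>\<close>. Traces on \<open>W\<close> can be computed with elements of \<open>S\<close>.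
\<close>

locale graded_piece =
  fixes W :: "(complex, 'v) module" and S :: "('m::monoid_add \<Rightarrow>\<^sub>0 complex) set"
    and \<pi> :: "('m \<Rightarrow>\<^sub>0 complex) \<Rightarrow> 'v"
  assumes S: "alg.subspace S"
    and carrier: "carrier W = \<pi> ` S"
    and \<pi>_add: "\<And>f g. \<pi> f \<oplus>\<^bsub>W\<^esub> \<pi> g = \<pi> (f + g)"
    and \<pi>_scal: "\<And>c f. c \<odot>\<^bsub>W\<^esub> \<pi> f = \<pi> (scal c * f)"
    and \<pi>_zero: "\<zero>\<^bsub>W\<^esub> = \<pi> 0"
begin

lemma complex_space: "complex_space W"
proof -
  have S0: "0 \<in> S" and Sadd: "\<And>f g. f \<in> S \<Longrightarrow> g \<in> S \<Longrightarrow> f + g \<in> S" and Sscal: "\<And>c f. f \<in> S \<Longrightarrow> scal c * f \<in> S"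
    using S by (simp_all add: alg.subspace_def)
  have ab: "abelian_group W"
  proof (rule abelian_groupI)
    show "\<zero>\<^bsub>W\<^esub> \<in> carrier W" by (simp add: carrier \<pi>_zero S0)
    fix X assume X: "X \<in> carrier W"
    then obtain f where f: "f \<in> S" "X = \<pi> f" by (auto simp: carrier)
    show "\<zero>\<^bsub>W\<^esub> \<oplus>\<^bsub>W\<^esub> X = X" by (simp add: f \<pi>_zero \<pi>_add)
    have "scal (- 1) * f \<in> S" by (rule Sscal[OF f(1)])
    moreover have "\<pi> (scal (- 1) * f) \<oplus>\<^bsub>W\<^esub> X = \<zero>\<^bsub>W\<^esub>"
      by (simp add: f \<pi>_zero \<pi>_add scal_uminus)
    ultimately show "\<exists>Y\<in>carrier W. Y \<oplus>\<^bsub>W\<^esub> X = \<zero>\<^bsub>W\<^esub>" unfolding carrier by blast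
    fix Y assume Y: "Y \<in> carrier W"
    then obtain g where g: "g \<in> S" "Y = \<pi> g" by (auto simp: carrier)
    show "X \<oplus>\<^bsub>W\<^esub> Y \<in> carrier W" by (simp add: f g \<pi>_add carrier Sadd)
    show "X \<oplus>\<^bsub>W\<^esub> Y = Y \<oplus>\<^bsub>W\<^esub> X" by (simp add: f g \<pi>_add add.commute)
    fix Z assume "Z \<in> carrier W"
    then obtain h where h: "h \<in> S" "Z = \<pi> h" by (auto simp: carrier)
    show "X \<oplus>\<^bsub>W\<^esub> Y \<oplus>\<^bsub>W\<^esub> Z = X \<oplus>\<^bsub>W\<^esub> (Y \<oplus>\<^bsub>W\<^esub> Z)" by (simp add: f g h \<pi>_add add.assoc)
  qed
  have "Module.module (class_ring :: complex ring) W"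
  proof (rule module.intro)
    show "cring (class_ring :: complex ring)" by (rule class_cring.cring_axioms)
    show "module_axioms (class_ring :: complex ring) W"
      by unfold_locales
        (auto simp: carrier \<pi>_add \<pi>_scal Sscal scal_add scal_mult distrib_left distrib_right mult.assoc)
  qed (rule ab)
  then show ?thesis
    by (simp add: complex_space_def vectorspace_def class_field.field_axioms)
qed

sublocale complex_space W by (rule complex_space)

lemma \<pi>_sum_in_span:
  assumes "finite E" "\<And>e. e \<in> E \<Longrightarrow> U e \<in> S"
  shows "\<pi> (\<Sum>e\<in>E. scal (c e) * U e) \<in> span ((\<lambda>e. \<pi> (U e)) ` E)"
proof -
  let ?X = "(\<lambda>e. \<pi> (U e)) ` E"
  have X: "?X \<subseteq> carrier W" using assms(2) by (auto simp: carrier)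
  have "\<pi> (\<Sum>e\<in>F. scal (c e) * U e) \<in> span ?X" if "finite F" "F \<subseteq> E" for F
    using that
  proof (induction F)
    case empty
    show ?case using span_zero[of ?X] by (simp add: \<pi>_zero)
  next
    case (insert e F)
    have "\<pi> (U e) \<in> span ?X" using X insert.prems by (intro span_mem) auto
    then have "\<pi> (scal (c e) * U e) \<in> span ?X"
      using submodule.smult_closed[OF span_is_submodule[OF X], of "c e" "\<pi> (U e)"] by (simp add: \<pi>_scal)
    then show ?case using insert span_add1[OF X] by (simp flip: \<pi>_add)
  qed
  then show ?thesis using assms(1) by blast
qed

text \<open>
  \<open>lin_trace_spanning_eigenvectors\<close> for a map that is covered by \<open>\<sigma>\<close>, with all vectors and forms on \<open>S\<close>.
\<close>

lemma lin_trace_cover: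
  assumes E: "finite E" and U: "\<And>e. e \<in> E \<Longrightarrow> U e \<in> S"
    and gen: "\<And>f. f \<in> S \<Longrightarrow> \<exists>c. \<pi> f = \<pi> (\<Sum>e\<in>E. scal (c e) * U e)"
    and N: "\<And>e. e \<in> E \<Longrightarrow> N e \<in> S"
    and \<phi>: "\<And>e f g. \<phi> e (f + g) = \<phi> e f + \<phi> e g" "\<And>e c f. \<phi> e (scal c * f) = c * \<phi> e f"
      "\<And>e f g. f \<in> S \<Longrightarrow> g \<in> S \<Longrightarrow> \<pi> f = \<pi> g \<Longrightarrow> \<phi> e f = \<phi> e g"
    and dual: "\<And>e e'. \<phi> e (N e') = (if e = e' then 1 else (0 :: complex))"
    and \<sigma>: "\<And>f. f \<in> S \<Longrightarrow> \<sigma> f \<in> S" "\<And>f g. \<sigma> (f + g) = \<sigma> f + \<sigma> g" "\<And>c f. \<sigma> (scal c * f) = scal c * \<sigma> f"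
    and act: "\<And>f. f \<in> S \<Longrightarrow> act (\<pi> f) = \<pi> (\<sigma> f)"
    and eigen: "\<And>e. e \<in> E \<Longrightarrow> \<sigma> (U e) = scal (ev e) * U e"
  shows "lin_trace W act = (\<Sum>e\<in>E. ev e)"
proof -
  have Sadd: "\<And>f g. f \<in> S \<Longrightarrow> g \<in> S \<Longrightarrow> f + g \<in> S" and Sscal: "\<And>c f. f \<in> S \<Longrightarrow> scal c * f \<in> S"
    using S by (simp_all add: alg.subspace_def)
  define lift where "lift X = (SOME f. f \<in> S \<and> \<pi> f = X)" for X
  have lift: "lift X \<in> S" "\<pi> (lift X) = X" if "X \<in> carrier W" for X
    using someI_ex[of "\<lambda>f. f \<in> S \<and> \<pi> f = X"] that unfolding lift_def carrier by auto
  have \<phi>_lift: "\<phi> e (lift (\<pi> f)) = \<phi> e f" if "f \<in> S" for e f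
    by (rule \<phi>(3)) (use lift[of "\<pi> f"] that in \<open>auto simp: carrier\<close>)
  show ?thesis
  proof (rule lin_trace_spanning_eigenvectors[OF E, of "\<lambda>e. \<pi> (U e)" "\<lambda>e. \<pi> (N e)" "\<lambda>e X. \<phi> e (lift X)"])
    show "carrier W \<subseteq> span ((\<lambda>e. \<pi> (U e)) ` E)"
    proof
      fix X assume "X \<in> carrier W"
      then obtain f where f: "f \<in> S" "X = \<pi> f" by (auto simp: carrier)
      then obtain c where "X = \<pi> (\<Sum>e\<in>E. scal (c e) * U e)" using gen by blast
      then show "X \<in> span ((\<lambda>e. \<pi> (U e)) ` E)" using \<pi>_sum_in_span[OF E U] by simp
    qed
    show "linear_form (\<lambda>X. \<phi> e (lift X))" for e
      unfolding linear_form_def carrier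
      by (auto simp: \<pi>_add \<pi>_scal \<phi>_lift \<phi>(1,2) Sadd Sscal)
    show "act \<in> carrier W \<rightarrow> carrier W" using \<sigma>(1) act by (auto simp: carrier)
    show "act (X \<oplus>\<^bsub>W\<^esub> Y) = act X \<oplus>\<^bsub>W\<^esub> act Y" if "X \<in> carrier W" "Y \<in> carrier W" for X Y
      using that by (auto simp: carrier \<pi>_add act Sadd \<sigma>(2))
    show "act (c \<odot>\<^bsub>W\<^esub> X) = c \<odot>\<^bsub>W\<^esub> act X" if "X \<in> carrier W" for c X
      using that by (auto simp: carrier \<pi>_scal act Sscal \<sigma>(3))
    show "act (\<pi> (U e)) = ev e \<odot>\<^bsub>W\<^esub> \<pi> (U e)" if "e \<in> E" for e
      using that by (simp add: act U eigen \<pi>_scal)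
    show "\<phi> e (lift (\<pi> (N e'))) = (if e = e' then 1 else 0)" if "e' \<in> E" for e e'
      using that by (simp add: \<phi>_lift N dual)
  qed (use U N carrier in auto)
qed

end

section \<open>Eigenvectors of the Heisenberg group\<close>

definition zeta :: "'p::prime_card mod_ring \<Rightarrow> complex" where
  "zeta k = root_unity TYPE('p) ^ nat (to_int_mod_ring k)"

lemma zeta_add: "zeta (i + j) = zeta i * zeta j"
  unfolding zeta_def by (rule root_unity_power_add)

lemma zeta_0 [simp]: "zeta 0 = 1"
  by (simp add: zeta_def)

lemma zeta_1: "zeta (1 :: 'p::prime_card mod_ring) = root_unity TYPE('p)"
  unfolding zeta_def by (rule root_unity_power_one)

lemma zeta_nonzero [simp]: "zeta k \<noteq> 0"
  by (simp add: zeta_def root_unity_nonzero)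

lemma zeta_of_nat_mult: "zeta (of_nat n * k) = zeta k ^ n"
  by (induction n) (simp_all add: zeta_add distrib_right)

lemma root_unity_neq_1: "root_unity TYPE('p::prime_card) \<noteq> 1"
proof
  assume one: "root_unity TYPE('p) = 1"
  have p: "2 \<le> CARD('p)" using prime_ge_2_nat[OF prime_card[where 'a = 'p]] .
  let ?t = "2 * pi / real CARD('p)"
  have "root_unity TYPE('p) = cis ?t"
    unfolding root_unity_def cis_conv_exp by (rule arg_cong[of _ _ exp]) simp
  then have "cis ?t = 1" using one by (rule subst)
  then have "Re (cis ?t) = Re 1" by (rule arg_cong)
  then have c: "cos ?t = cos 0" by (simp only: cis.sel one_complex.sel cos_zero)
  have p': "2 \<le> real CARD('p)" using p by linarith
  have pos: "0 < ?t" using p' pi_gt_zero by (intro divide_pos_pos) linarith+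
  have "2 * pi \<le> pi * real CARD('p)" using mult_left_mono[OF p', of pi] by (simp only: mult.commute pi_ge_zero)
  then have "?t \<le> pi" using p' by (intro divide_le_eq[THEN iffD2]) simp
  then have "?t = 0" using cos_inj_pi[OF less_imp_le[OF pos] _ _ _ c] pi_ge_zero by blast
  then show False using pos by (simp only: less_irrefl)
qed

text \<open>
  For nonzero \<open>d\<close>, reindexing by multiplication with \<open>d\<close> reduces to \<open>d = 1\<close>; then reindexing by \<open>j + 1\<close> multiplies the sum
  by the nontrivial root of unity.
\<close>

lemma sum_zeta:
  fixes d :: "'p::prime_card mod_ring"
  shows "(\<Sum>j\<in>UNIV. zeta (j * d)) = (if d = 0 then of_nat CARD('p) else 0)"
proof (cases "d = 0")
  case False
  have "(j * inverse d) * d = j" "(j * d) * inverse d = j" for j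
    by (simp_all only: mult.assoc left_inverse[OF False] right_inverse[OF False] mult_1_right)
  then have "bij_betw (\<lambda>j. j * d) UNIV UNIV"
    by (intro bij_betw_byWitness[where f' = "\<lambda>j. j * inverse d"]) blast+
  then have scale: "(\<Sum>j\<in>UNIV. zeta (j * d)) = (\<Sum>j\<in>UNIV. zeta (j :: 'p mod_ring))"
    using sum.reindex_bij_betw[of "\<lambda>j. j * d" UNIV UNIV "zeta :: 'p mod_ring \<Rightarrow> complex"] by blast
  have "(j - 1) + 1 = j" "(j + 1) - 1 = j" for j :: "'p mod_ring" by simp_all
  then have "bij_betw (\<lambda>j :: 'p mod_ring. j + 1) UNIV UNIV"
    by (intro bij_betw_byWitness[where f' = "\<lambda>j. j - 1"]) blast+
  then have "(\<Sum>j\<in>UNIV. zeta (j + 1 :: 'p mod_ring)) = (\<Sum>j\<in>UNIV. zeta (j :: 'p mod_ring))"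
    using sum.reindex_bij_betw[of "\<lambda>j. j + 1" UNIV UNIV "zeta :: 'p mod_ring \<Rightarrow> complex"] by blast
  then have "(\<Sum>j\<in>UNIV. zeta (j :: 'p mod_ring)) * root_unity TYPE('p) = (\<Sum>j\<in>UNIV. zeta (j :: 'p mod_ring)) * 1"
    by (simp add: zeta_add zeta_1 sum_distrib_right)
  then have "(\<Sum>j\<in>UNIV. zeta (j :: 'p mod_ring)) = 0"
    using root_unity_neq_1[where 'p = 'p] unfolding mult_cancel_left by blast
  then show ?thesis using scale False by simp
qed simp

definition heis_coeff :: "'p::prime_card mod_ring \<Rightarrow> 'p mod_ring \<Rightarrow> 'p mod_ring \<Rightarrow> 'p mod_ring \<Rightarrow> complex" where
  "heis_coeff s b c i = zeta (c + b * (i - s))"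

text \<open>
  The family of these maps is closed under composition and contains the generators, and so it contains the
  action of the whole group.
\<close>

definition heis_map :: "'p::prime_card mod_ring \<Rightarrow> 'p mod_ring \<Rightarrow> 'p mod_ring \<Rightarrow> 'p heis_space \<Rightarrow> 'p heis_space" where
  "heis_map s b c v = (\<lambda>i. zeta (c + b * i) * v (i + s))"

lemma heis_map_comp: "heis_map s b c \<circ> heis_map s' b' c' = heis_map (s + s') (b + b') (c + c' + b' * s)"
proof (rule ext, rule ext)
  fix v :: "'a heis_space" and i
  have e: "c + b * i + (c' + b' * (i + s)) = c + c' + b' * s + (b + b') * i" by (simp add: algebra_simps)
  have "(heis_map s b c \<circ> heis_map s' b' c') v i = zeta (c + b * i + (c' + b' * (i + s))) * v (i + s + s')"
    by (simp only: heis_map_def o_apply zeta_add[of "c + b * i"] mult.assoc)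
  then show "(heis_map s b c \<circ> heis_map s' b' c') v i = heis_map (s + s') (b + b') (c + c' + b' * s) v i"
    unfolding e heis_map_def by (simp only: add.assoc)
qed

lemma heis_map_id: "heis_map 0 0 0 = id"
  by (auto simp: heis_map_def)

lemma heis_gen_map_heis_map: "\<exists>s b c. heis_gen_map g = heis_map s b c"
proof (cases g)
  case E1
  have "heis_gen_map g = heis_map 1 0 0" by (auto simp: E1 heis_map_def)
  then show ?thesis by blast
next
  case E2
  have "heis_gen_map g = heis_map 0 1 0" by (auto simp: E2 heis_map_def zeta_def)
  then show ?thesis by blast
next
  case Z
  have "heis_gen_map g = heis_map 0 0 1" by (auto simp: Z heis_map_def zeta_1)
  then show ?thesis by blast
qed

lemma heis_word_map_heis_map: "\<exists>s b c. (heis_word_map w :: 'p::prime_card heis_space \<Rightarrow> _) = heis_map s b c"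
proof (induction w)
  case Nil
  have "(heis_word_map [] :: 'p heis_space \<Rightarrow> _) = heis_map 0 0 0" by (simp add: heis_map_id)
  then show ?case by blast
next
  case (Cons l w)
  have "\<exists>s b c. (heis_letter_map l :: 'p heis_space \<Rightarrow> _) = heis_map s b c"
  proof -
    obtain g e where l: "l = (g, e)" by (cases l)
    obtain s b c where g: "(heis_gen_map g :: 'p heis_space \<Rightarrow> _) = heis_map s b c" using heis_gen_map_heis_map by blast
    have "heis_map s b c \<circ> heis_map (- s) (- b) (b * s - c) = id"
      "heis_map (- s) (- b) (b * s - c) \<circ> heis_map s b c = id"
      by (simp_all add: heis_map_comp heis_map_id)
    then have inverse: "inv_into UNIV (heis_map s b c) = heis_map (- s) (- b) (b * s - c)"
      by (rule inv_unique_comp)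
    show ?thesis
    proof (cases e)
      case True
      then have "(heis_letter_map l :: 'p heis_space \<Rightarrow> _) = heis_map s b c" using g l by (simp del: heis_gen_map.simps)
      then show ?thesis by blast
    next
      case False
      then have "(heis_letter_map l :: 'p heis_space \<Rightarrow> _) = heis_map (- s) (- b) (b * s - c)"
        using g l inverse by (simp del: heis_gen_map.simps)
      then show ?thesis by blast
    qed
  qed
  then obtain s b c where "(heis_letter_map l :: 'p heis_space \<Rightarrow> _) = heis_map s b c" by blast
  moreover obtain s' b' c' where "(heis_word_map w :: 'p heis_space \<Rightarrow> _) = heis_map s' b' c'" using Cons by blast
  ultimately have "(heis_word_map (l # w) :: 'p heis_space \<Rightarrow> _) = heis_map (s + s') (b + b') (c + c' + b' * s)"
    by (simp add: heis_map_comp)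
  then show ?case by blast
qed

lemma heis_rep_heis_map: "\<exists>s b c. heis_rep g = heis_map s b c"
  unfolding heis_rep_def by (rule heis_word_map_heis_map)

lemma heis_map_x_vec: "heis_map s b c (x_vec i) = (\<lambda>j. heis_coeff s b c i * x_vec (i - s) j)"
  by (rule ext) (auto simp: heis_map_def heis_coeff_def x_vec_def)

text \<open>
  The operator \<open>x\<^sub>k \<mapsto> \<kappa>\<^sub>k x\<^sub>k\<^sub>-\<^sub>s\<close> with \<open>\<kappa>\<^sub>k = heis_coeff s b c k ^ n\<close> is diagonalised by an invertible matrix \<open>M\<close>
  with inverse \<open>N\<close>, and its eigenvalues are the \<open>n\<close>-th powers of numbers \<open>ev j\<close> that do not depend on \<open>n\<close>.
  The cases \<open>n = 1\<close> and \<open>n = 2\<close> concern the \<open>x\<^sub>k\<close> and the \<open>y\<^sub>k\<close>. For \<open>s = 0\<close> the operator is diagonal already.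
  Otherwise, the indices form a single cycle on which \<open>t\<close> counts the steps. The product of all coefficients
  on the cycle is \<open>1\<close>, so that they can be removed by rescaling with \<open>r\<close>, and the remaining cyclic shift is
  diagonalised by the Fourier matrix of the root of unity \<open>\<omega> ^ n\<close>.
\<close>

lemma (in odd_prime) eigen_matrices:
  fixes s b c :: "'p mod_ring"
  shows "\<exists>ev :: 'p mod_ring \<Rightarrow> complex. \<forall>n. (of_nat n :: 'p mod_ring) \<noteq> 0 \<longrightarrow> (\<exists>M N.
    (\<forall>j k. M j k * heis_coeff s b c k ^ n = ev j ^ n * M j (k - s)) \<and>
    (\<forall>k l. (\<Sum>j\<in>UNIV. N k j * M j l) = (if k = l then 1 else 0)))"
proof (cases "s = 0")
  case True
  let ?D = "\<lambda>j k :: 'p mod_ring. if j = k then 1 else (0 :: complex)"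
  have D: "(\<forall>j k. ?D j k * heis_coeff s b c k ^ n = heis_coeff s b c j ^ n * ?D j (k - s)) \<and>
    (\<forall>k l. (\<Sum>j\<in>UNIV. ?D k j * ?D j l) = (if k = l then 1 else 0))" for n
    using True by (simp add: if_distrib[of "\<lambda>x. x * _"] cong: if_cong)
  show ?thesis
  proof (rule exI[of _ "heis_coeff s b c"], rule allI, rule impI)
    fix n :: nat
    show "\<exists>M N. (\<forall>j k. M j k * heis_coeff s b c k ^ n = heis_coeff s b c j ^ n * M j (k - s)) \<and>
      (\<forall>k l. (\<Sum>j\<in>UNIV. N k j * M j l) = (if k = l then 1 else 0))"
      by (rule exI[of _ ?D], rule exI[of _ ?D], rule D)
  qed
next
  case False
  define t where "t k = - k / s" for k
  define r where "r t = zeta (c * t - b * s * (t * (t + 1) / 2))" for t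
  have t_shift: "t (k - s) = t k + 1" for k
    using False by (simp add: t_def diff_divide_distrib)
  \<comment> \<open>\<open>r\<close> solves the recursion imposed by the coefficients. Its exponent is a quadratic polynomial in the
    number of steps; the division by \<open>2\<close> makes it periodic since \<open>p\<close> is odd.\<close>
  have r_step: "r (t k + 1) = r (t k) * heis_coeff s b c k" for k
  proof -
    have k: "k = - (t k * s)" using False by (simp add: t_def)
    have sq: "(u + 1) * (u + 1 + 1) / 2 = u * (u + 1) / 2 + (u + 1)" for u :: "'p mod_ring"
    proof -
      have "(u + 1) * (u + 1 + 1) = u * (u + 1) + 2 * (u + 1)"
        by (simp only: distrib_left distrib_right mult_1_left mult_1_right one_add_one[symmetric] add_ac)
      then have "(u + 1) * (u + 1 + 1) / 2 = (u * (u + 1) + 2 * (u + 1)) / 2" by (rule arg_cong)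
      also have "\<dots> = u * (u + 1) / 2 + (u + 1)" unfolding add_divide_distrib by simp
      finally show ?thesis .
    qed
    have gen: "c * (u + 1) - b * s * (h + (u + 1)) = c * u - b * s * h + (c + b * (- (u * s) - s))" for u h
      by (simp add: algebra_simps)
    show ?thesis unfolding r_def sq gen zeta_add heis_coeff_def using k by simp
  qed
  show ?thesis
  proof (intro exI[of _ zeta] allI impI)
    fix n assume n: "(of_nat n :: 'p mod_ring) \<noteq> 0"
    let ?n = "of_nat n :: 'p mod_ring"
    let ?M = "\<lambda>j k. zeta (- (j * t k)) ^ n * r (t k) ^ n"
    let ?N = "\<lambda>k j. zeta (j * t k) ^ n / (of_nat CARD('p) * r (t k) ^ n)"
    have r0: "r u \<noteq> 0" for u by (simp add: r_def)
    have "?M j k * heis_coeff s b c k ^ n = zeta j ^ n * ?M j (k - s)" for j k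
    proof -
      have "zeta (- (j * t k)) = zeta j * zeta (- (j * (t k + 1)))"
        by (simp add: distrib_left flip: zeta_add)
      then show ?thesis unfolding t_shift r_step by (simp add: power_mult_distrib mult_ac)
    qed
    moreover have "(\<Sum>j\<in>UNIV. ?N k j * ?M j l) = (if k = l then 1 else 0)" for k l
    proof -
      have "?N k j * ?M j l = zeta (j * (?n * (t k - t l))) * (r (t l) ^ n / (of_nat CARD('p) * r (t k) ^ n))" for j
      proof -
        have "zeta (j * (?n * (t k - t l))) = zeta (?n * (j * t k + - (j * t l)))" by (simp add: algebra_simps)
        also have "\<dots> = zeta (j * t k) ^ n * zeta (- (j * t l)) ^ n"
          by (simp only: zeta_of_nat_mult zeta_add power_mult_distrib)
        finally show ?thesis by simp
      qed
      then have "(\<Sum>j\<in>UNIV. ?N k j * ?M j l)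
          = (\<Sum>j\<in>UNIV. zeta (j * (?n * (t k - t l)))) * (r (t l) ^ n / (of_nat CARD('p) * r (t k) ^ n))"
        by (simp only: sum_distrib_right)
      also have "\<dots> = (if k = l then 1 else 0)"
        unfolding sum_zeta using n False r0 by (auto simp: t_def)
      finally show ?thesis .
    qed
    ultimately show "\<exists>M N. (\<forall>j k. M j k * heis_coeff s b c k ^ n = zeta (j :: 'p mod_ring) ^ n * M j (k - s)) \<and>
      (\<forall>k l. (\<Sum>j\<in>UNIV. N k j * M j l) = (if k = l then 1 else 0))"
      by (intro exI[of _ ?M] exI[of _ ?N] conjI allI)
  qed
qed

section \<open>The action on the free algebra and on the Clifford algebra\<close>

lemma scal_sum: "scal (sum f A) = (\<Sum>a\<in>A. scal (f a) :: 'm::monoid_add \<Rightarrow>\<^sub>0 complex)"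
  by (induction A rule: infinite_finite_induct) (simp_all add: scal_add)

lemma free_subst_monoid_lift: "free_subst v = monoid_lift (\<lambda>w. prod_list (map v (letters w)))"
  by (rule ext) (simp add: free_subst_def monoid_lift_def)

lemma free_subst_hom:
  "free_subst v (f + g) = free_subst v f + free_subst v g"
  "free_subst v (f - g) = free_subst v f - free_subst v g"
  "free_subst v (f * g) = free_subst v f * free_subst v g"
  "free_subst v (scal c * f) = scal c * free_subst v f"
  "free_subst v (sum F A) = (\<Sum>a\<in>A. free_subst v (F a))"
  unfolding free_subst_monoid_lift
  by (simp_all add: monoid_lift_add monoid_lift_diff monoid_lift_scal monoid_lift_sum
      monoid_lift_mult plus_free_mon_def)

lemma free_subst_1: "free_subst v 1 = 1"
proof -
  have "letters (0 :: 'a free_mon) = []" by (simp add: zero_free_mon_def)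
  then show ?thesis
    using monoid_lift_single[of "\<lambda>w. prod_list (map v (letters w))" 0 1]
    by (simp add: free_subst_monoid_lift)
qed

lemma free_component_add: "f \<in> free_component n \<Longrightarrow> g \<in> free_component n \<Longrightarrow> f + g \<in> free_component n"
  using keys_add[of f g] unfolding free_component_def by blast

lemma free_component_scal: "f \<in> free_component n \<Longrightarrow> scal c * f \<in> free_component n"
  unfolding free_component_def by (simp add: in_keys_iff)

lemma free_component_0: "0 \<in> free_component n"
  by (simp add: free_component_def)

lemma free_component_sum: "(\<And>i. i \<in> A \<Longrightarrow> f i \<in> free_component n) \<Longrightarrow> sum f A \<in> free_component n"
  by (induction A rule: infinite_finite_induct) (simp_all add: free_component_0 free_component_add)

lemma free_component_mult:
  assumes "f \<in> free_component m" "g \<in> free_component n"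
  shows "f * g \<in> free_component (m + n)"
  unfolding free_component_def
proof (intro CollectI ballI)
  fix w assume "w \<in> Poly_Mapping.keys (f * g)"
  then obtain u v where "w = u + v" "u \<in> Poly_Mapping.keys f" "v \<in> Poly_Mapping.keys g"
    using keys_mult[of f g] by blast
  then show "length (letters w) = m + n" using assms by (simp add: free_component_def plus_free_mon_def)
qed

lemma free_component_1: "1 \<in> free_component 0"
  by (simp add: free_component_def zero_free_mon_def)

lemma free_component_power: "f \<in> free_component m \<Longrightarrow> f ^ k \<in> free_component (k * m)"
  by (induction k) (simp_all add: free_component_1 free_component_mult)

lemma free_component_var: "free_var i \<in> free_component 1"
  by (simp add: free_var_def free_component_def)

lemma free_component_anticomm: "cliff_anticomm i j \<in> free_component 2"
  unfolding cliff_anticomm_def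
  using free_component_mult[OF free_component_var free_component_var]
  by (intro free_component_add) (simp_all only: one_add_one)

lemma subspace_free_component: "alg.subspace (free_component n)"
  unfolding alg.subspace_def by (simp add: free_component_0 free_component_add free_component_scal)

lemma free_component_words:
  assumes "f \<in> free_component n"
  shows "f = (\<Sum>w\<in>Poly_Mapping.keys f. scal (Poly_Mapping.lookup f w) * prod_list (map free_var (letters w)))"
  by (simp add: free_word scal_single poly_mapping_sum_single)

lemma free_subst_component:
  assumes v: "\<And>i. v i \<in> free_component 1" and f: "f \<in> free_component n"
  shows "free_subst v f \<in> free_component n"
proof -
  have word: "prod_list (map v l) \<in> free_component (length l)" for l
    using free_component_mult[OF v] by (induction l) (simp_all add: free_component_1)
  show ?thesis unfolding free_subst_def
  proof (intro free_component_sum free_component_scal)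
    fix w assume "w \<in> Poly_Mapping.keys f"
    then show "prod_list (map v (letters w)) \<in> free_component n"
      using f word[of "letters w"] by (simp add: free_component_def)
  qed
qed

text \<open>
  The normal form of the action of a group element on the two algebras.
\<close>

definition heis_free :: "'p::prime_card mod_ring \<Rightarrow> 'p mod_ring \<Rightarrow> 'p mod_ring \<Rightarrow> 'p mod_ring free_alg \<Rightarrow> 'p mod_ring free_alg" where
  "heis_free s b c = free_subst (\<lambda>i. scal (heis_coeff s b c i) * free_var (i - s))"

definition heis_poly :: "'p::prime_card mod_ring \<Rightarrow> 'p mod_ring \<Rightarrow> 'p mod_ring \<Rightarrow> 'p mod_ring poly_alg \<Rightarrow> 'p mod_ring poly_alg" where
  "heis_poly s b c = poly_subst (\<lambda>i. scal (heis_coeff s b c i) * poly_var (i - s))"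

lemma heisenberg_acts:
  "\<exists>s b c. (free_act g :: 'p::prime_card mod_ring free_alg \<Rightarrow> _) = heis_free s b c
     \<and> (poly_act g :: 'p mod_ring poly_alg \<Rightarrow> _) = heis_poly s b c"
proof -
  obtain s b c where g: "(heis_rep g :: 'p heis_space \<Rightarrow> _) = heis_map s b c" using heis_rep_heis_map by blast
  have "free_act g = heis_free s b c" unfolding free_act_def heis_free_def g heis_map_x_vec sum_x_vec ..
  moreover have "poly_act g = heis_poly s b c" unfolding poly_act_def heis_poly_def g heis_map_x_vec sum_x_vec ..
  ultimately show ?thesis by blast
qed

lemmas heis_free_hom = free_subst_hom[of "\<lambda>i. scal (heis_coeff s b c i) * free_var (i - s)" for s b c,
    folded heis_free_def]

lemma heis_free_var: "heis_free s b c (free_var i) = scal (heis_coeff s b c i) * free_var (i - s)"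
  by (simp add: heis_free_def free_subst_var)

lemma heis_free_component: "f \<in> free_component n \<Longrightarrow> heis_free s b c f \<in> free_component n"
  unfolding heis_free_def
  by (rule free_subst_component) (intro free_component_scal free_component_var)

lemma mult_scal_left: "f * (scal d * g) = scal d * (f * g)"
proof -
  have "f * (scal d * g) = (f * scal d) * g" by (simp only: mult.assoc)
  also have "\<dots> = scal d * (f * g)" by (simp only: scal_commute[of f] mult.assoc)
  finally show ?thesis .
qed

lemma scal_mult_both: "(scal c * f) * (scal d * g) = scal (c * d) * (f * g)"
  by (simp only: mult.assoc mult_scal_left[of f] scal_mult)

lemma heis_free_inverse: "heis_free s b c (heis_free (- s) (- b) (b * s - c) f) = f"
proof -
  let ?v = "\<lambda>i. scal (heis_coeff (- s) (- b) (b * s - c) i) * free_var (i - - s)"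
  have var: "heis_free s b c (?v i) = free_var i" for i
  proof -
    have "b * s - c + - b * (i - - s) + (c + b * (i - - s - s)) = 0" by (simp add: algebra_simps)
    then have "heis_coeff (- s) (- b) (b * s - c) i * heis_coeff s b c (i - - s) = 1"
      unfolding heis_coeff_def by (simp only: zeta_0 flip: zeta_add)
    then have "scal (heis_coeff (- s) (- b) (b * s - c) i) * (scal (heis_coeff s b c (i - - s)) * free_var (i - - s - s)) = free_var (i - - s - s)"
      by (simp only: scal_1 mult_1_left flip: mult.assoc scal_mult)
    then show ?thesis by (simp only: heis_free_hom(4) heis_free_var) simp
  qed
  have word: "heis_free s b c (prod_list (map ?v l)) = prod_list (map free_var l)" for l
  proof (induction l)
    case Nil
    show ?case by (simp add: heis_free_def free_subst_1)
  next
    case (Cons i l)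
    have "heis_free s b c (?v i * prod_list (map ?v l))
        = heis_free s b c (?v i) * heis_free s b c (prod_list (map ?v l))"
      by (rule heis_free_hom(3))
    then show ?case by (simp only: list.map prod_list.Cons var Cons)
  qed
  have "heis_free (- s) (- b) (b * s - c) f
      = (\<Sum>w\<in>Poly_Mapping.keys f. scal (Poly_Mapping.lookup f w) * prod_list (map ?v (letters w)))"
    by (simp only: heis_free_def free_subst_def)
  then have "heis_free s b c (heis_free (- s) (- b) (b * s - c) f)
      = (\<Sum>w\<in>Poly_Mapping.keys f. scal (Poly_Mapping.lookup f w) * prod_list (map free_var (letters w)))"
    by (simp only: heis_free_hom(4,5) word)
  then show ?thesis by (simp add: free_word scal_single poly_mapping_sum_single)
qed

context odd_prime
begin

text \<open>
  The exponent of \<open>heis_coeff\<close> is an affine function of the index. This is why anticommutators with the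
  same midpoint are multiplied by the same factor, and why the ideal is preserved.
\<close>

lemma heis_coeff_mult:
  fixes s b c :: "'p mod_ring"
  shows "heis_coeff s b c i * heis_coeff s b c j = heis_coeff s b c ((i + j) / 2) ^ 2"
proof -
  let ?m = "(i + j) / 2"
  have m: "?m + ?m = i + j" by (rule half_add_half)
  have gen: "(c + b * (i' - s)) + (c + b * (j' - s)) = c + c + b * ((i' + j') - s - s)" for i' j'
    by (simp add: algebra_simps)
  have "(c + b * (i - s)) + (c + b * (j - s)) = (c + b * (?m - s)) + (c + b * (?m - s))"
    unfolding gen m by (rule HOL.refl)
  then show ?thesis unfolding heis_coeff_def power2_eq_square by (simp only: flip: zeta_add)
qed

lemma heis_free_anticomm:
  fixes s b c :: "'p mod_ring"
  shows "heis_free s b c (cliff_anticomm i j)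
    = scal (heis_coeff s b c ((i + j) / 2) ^ 2) * cliff_anticomm (i - s) (j - s)"
proof -
  have "heis_free s b c (cliff_anticomm i j) = scal (heis_coeff s b c i * heis_coeff s b c j) * (x (i - s) * x (j - s))
      + scal (heis_coeff s b c j * heis_coeff s b c i) * (x (j - s) * x (i - s))"
    by (simp only: cliff_anticomm_def heis_free_hom(1,3) heis_free_var scal_mult_both)
  then show ?thesis
    by (simp only: heis_coeff_mult add.commute[of j i] cliff_anticomm_def distrib_left)
qed

end

lemma mod_combination_subspace:
  assumes J: "two_sided_ideal J"
  shows "alg.subspace {f. \<exists>c. f - (\<Sum>e\<in>E. scal (c e) * U e) \<in> J}" (is "alg.subspace ?T")
  unfolding alg.subspace_def
proof (intro conjI ballI allI)
  show "0 \<in> ?T" by (intro CollectI exI[of _ "\<lambda>_. 0"]) (simp add: tsi_0[OF J])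
  fix f g assume "f \<in> ?T" "g \<in> ?T"
  then obtain c d where "f - (\<Sum>e\<in>E. scal (c e) * U e) \<in> J" "g - (\<Sum>e\<in>E. scal (d e) * U e) \<in> J" by auto
  from tsi_add[OF J this] have "f + g - (\<Sum>e\<in>E. scal (c e + d e) * U e) \<in> J"
    by (simp add: scal_add distrib_right sum.distrib algebra_simps)
  then show "f + g \<in> ?T" by (intro CollectI exI[of _ "\<lambda>e. c e + d e"])
next
  fix d f assume "f \<in> ?T"
  then obtain c where "f - (\<Sum>e\<in>E. scal (c e) * U e) \<in> J" by auto
  from tsi_left[OF J this, of "scal d"] have "scal d * f - (\<Sum>e\<in>E. scal (d * c e) * U e) \<in> J"
    by (simp add: scal_mult mult.assoc right_diff_distrib sum_distrib_left)
  then show "scal d * f \<in> ?T" by (intro CollectI exI[of _ "\<lambda>e. d * c e"])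
qed

lemma mod_combination_span:
  assumes J: "two_sided_ideal J" and E: "finite E" and f: "f \<in> alg.span (J \<union> U ` E)"
  shows "\<exists>c. f - (\<Sum>e\<in>E. scal (c e) * U e) \<in> J"
proof -
  let ?T = "{f. \<exists>c. f - (\<Sum>e\<in>E. scal (c e) * U e) \<in> J}"
  have "J \<union> U ` E \<subseteq> ?T"
  proof (intro Un_least subsetI)
    fix f assume "f \<in> J"
    then show "f \<in> ?T" by (intro CollectI exI[of _ "\<lambda>_. 0"]) simp
  next
    fix f assume "f \<in> U ` E"
    then obtain i where i: "i \<in> E" "f = U i" by blast
    have "(\<Sum>e\<in>E. scal (if e = i then 1 else 0) * U e) = (\<Sum>e\<in>E. if e = i then U e else 0)"
      by (rule sum.cong) auto
    also have "\<dots> = f" using i E by simp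
    finally show "f \<in> ?T" using tsi_0[OF J] by (intro CollectI exI[of _ "\<lambda>e. if e = i then 1 else 0"]) simp
  qed
  from alg.span_minimal[OF this mod_combination_subspace[OF J]] f show ?thesis by blast
qed

context regular_clifford
begin

lemma heis_free_y: "heis_free s b c (y k) = scal (heis_coeff s b c k ^ 2) * y (k - s)"
proof -
  have mid: "(k - d0 / 2 + (k + d0 / 2)) / 2 = k"
    using midpoint_sum[of k d0] by (simp only: add.commute)
  have shift: "k - h - s = k - s - h" "k + h - s = k - s + h" for h by (simp_all add: algebra_simps)
  have "heis_free s b c (pair k d0) = scal (heis_coeff s b c k ^ 2) * pair (k - s) d0"
    unfolding pair_def heis_free_anticomm mid shift ..
  then show ?thesis
    unfolding y_def heis_free_hom(4) by (simp only: alg.scale_left_commute)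
qed

lemma heis_free_ideal_subset: "f \<in> J \<Longrightarrow> heis_free s b c f \<in> J"
proof -
  let ?K = "{f. heis_free s b c f \<in> J}"
  have zero: "heis_free s b c 0 = 0" using heis_free_hom(2)[of s b c 0 0] by simp
  have "two_sided_ideal ?K"
    unfolding two_sided_ideal_def
    by (simp add: zero heis_free_hom tsi_0[OF J] tsi_add[OF J] tsi_left[OF J] tsi_right[OF J])
  moreover have "cliff_anticomm i j - scal (\<alpha> (i - j)) * y ((i + j) / 2) \<in> ?K" for i j
  proof -
    let ?k = "scal (heis_coeff s b c ((i + j) / 2) ^ 2)"
    have d: "i - s - (j - s) = i - j" by simp
    have "(i + j) / 2 - s = (i + j) / 2 - (s / 2 + s / 2)" by (simp only: half_add_half)
    then have m: "(i + j) / 2 - s = (i - s + (j - s)) / 2"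
      by (simp only: add_divide_distrib diff_divide_distrib) (simp only: diff_conv_add_uminus minus_add_distrib add_ac)
    have "?k * (cliff_anticomm (i - s) (j - s) - scal (\<alpha> (i - s - (j - s))) * y ((i - s + (j - s)) / 2)) \<in> J"
      by (rule tsi_left[OF J anticomm_y])
    then have "heis_free s b c (cliff_anticomm i j - scal (\<alpha> (i - j)) * y ((i + j) / 2)) \<in> J"
      by (simp only: heis_free_hom(2,4) heis_free_anticomm heis_free_y m d right_diff_distrib
          alg.scale_left_commute[of "\<alpha> (i - j)"])
    then show ?thesis by simp
  qed
  ultimately have "J \<subseteq> ?K" by (rule clifford_ideal_subset)
  then show "f \<in> J \<Longrightarrow> heis_free s b c f \<in> J" by blast
qed

lemma y_component: "y k \<in> free_component 2"
  unfolding y_def pair_def by (intro free_component_scal free_component_anticomm)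

lemma y_central_all: "y k * f - f * y k \<in> J"
proof -
  have word: "y k * prod_list (map x l) - prod_list (map x l) * y k \<in> J" for l
  proof (induction l)
    case Nil
    show ?case using tsi_0[OF J] by simp
  next
    case (Cons j l)
    let ?w = "prod_list (map x l)"
    have "y k * x j * ?w - x j * y k * ?w \<in> J" by (rule tsi_mult_right[OF J y_central])
    moreover have "x j * (y k * ?w) - x j * (?w * y k) \<in> J" by (rule tsi_mult_left[OF J Cons])
    ultimately have "y k * x j * ?w - x j * (?w * y k) \<in> J" unfolding mult.assoc by (rule tsi_trans[OF J])
    then show ?case by (simp only: list.map prod_list.Cons mult.assoc)
  qed
  let ?c = "Poly_Mapping.lookup f" and ?K = "Poly_Mapping.keys f"
  have "(\<Sum>w\<in>?K. scal (?c w) * (y k * prod_list (map x (letters w)) - prod_list (map x (letters w)) * y k)) \<in> J"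
    by (intro tsi_sum[OF J] tsi_left[OF J] word)
  moreover have "(\<Sum>w\<in>?K. scal (?c w) * (y k * prod_list (map x (letters w)) - prod_list (map x (letters w)) * y k))
      = y k * (\<Sum>w\<in>?K. scal (?c w) * prod_list (map x (letters w)))
      - (\<Sum>w\<in>?K. scal (?c w) * prod_list (map x (letters w))) * y k"
    by (simp only: right_diff_distrib sum_subtractf sum_distrib_left sum_distrib_right mult.assoc
        mult_scal_left[of "y k"])
  moreover have "(\<Sum>w\<in>?K. scal (?c w) * prod_list (map x (letters w))) = f"
    by (simp add: free_word scal_single poly_mapping_sum_single)
  ultimately show ?thesis by simp
qed

text \<open>
  Combinations of the \<open>x\<^sub>k\<close> and of the \<open>y\<^sub>k\<close> satisfy the assumptions of the sorting argument if the latter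
  span all \<open>y\<^sub>k\<close>.
\<close>

lemma linear_generators:
  fixes u v :: "'p mod_ring \<Rightarrow> 'p mod_ring free_alg"
  assumes v: "\<And>j. v j = (\<Sum>k\<in>UNIV. scal (M j k) * x k)"
    and u: "\<And>j. u j = (\<Sum>k\<in>UNIV. scal (M' j k) * y k)"
    and y: "\<And>k. y k = (\<Sum>j\<in>UNIV. scal (N' k j) * u j)"
  shows "clifford_generators J u v"
proof
  show "two_sided_ideal J" by (rule J)
  show "u i * f - f * u i \<in> J" for i f
  proof -
    have "(\<Sum>k\<in>UNIV. scal (M' i k) * (y k * f - f * y k)) \<in> J"
      by (intro tsi_sum[OF J] tsi_left[OF J] y_central_all)
    then show ?thesis
      unfolding u by (simp only: right_diff_distrib sum_subtractf sum_distrib_left sum_distrib_right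
          mult.assoc mult_scal_left[of f])
  qed
  let ?T = "alg.span (J \<union> range u)"
  have T: "alg.subspace ?T" by (rule alg.subspace_span)
  have J_T: "f \<in> ?T" if "f \<in> J" for f
    using that by (intro alg.span_base) blast
  have u_T: "u j \<in> ?T" for j by (intro alg.span_base) blast
  have y_T: "y k \<in> ?T" for k
    unfolding y[of k] by (intro alg.subspace_sum[OF T] alg.subspace_scale[OF T] u_T)
  have anti: "cliff_anticomm i j \<in> ?T" for i j
    using alg.subspace_add[OF T J_T[OF anticomm_y[of i j]]
        alg.subspace_scale[OF T y_T[of "(i + j) / 2"], of "\<alpha> (i - j)"]]
    by (simp only: diff_add_cancel)
  have expand: "v i * v j + v j * v i = (\<Sum>k\<in>UNIV. \<Sum>l\<in>UNIV. scal (M i k * M j l) * cliff_anticomm k l)" for i j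
  proof -
    have "v j * v i = (\<Sum>l\<in>UNIV. \<Sum>k\<in>UNIV. scal (M j l * M i k) * (x l * x k))"
      unfolding v by (simp only: sum_product scal_mult_both)
    also have "\<dots> = (\<Sum>k\<in>UNIV. \<Sum>l\<in>UNIV. scal (M i k * M j l) * (x l * x k))"
      by (subst sum.swap) (simp only: mult.commute[of "M j _" "M i _"])
    finally show ?thesis
      unfolding v by (simp only: sum_product scal_mult_both cliff_anticomm_def distrib_left sum.distrib)
  qed
  show "\<exists>E. v i * v j + v j * v i - (\<Sum>k\<in>UNIV. scal (E k) * u k) \<in> J" for i j
  proof -
    have "v i * v j + v j * v i \<in> ?T"
      unfolding expand by (intro alg.subspace_sum[OF T] alg.subspace_scale[OF T] anti)
    then show ?thesis by (rule mod_combination_span[OF J finite])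
  qed
qed

end

lemma eigen_combination:
  fixes z :: "'p::prime_card mod_ring \<Rightarrow> ('m::monoid_add \<Rightarrow>\<^sub>0 complex)"
  assumes lin: "\<And>f g. \<sigma> (f + g) = \<sigma> f + \<sigma> g" "\<And>c f. \<sigma> (scal c * f) = scal c * \<sigma> f"
    and z: "\<And>k. \<sigma> (z k) = scal (\<kappa> k) * z (k - s)"
    and M: "\<And>j k. M j k * \<kappa> k = ev j * M j (k - s)"
  shows "\<sigma> (\<Sum>k\<in>UNIV. scal (M j k) * z k) = scal (ev j) * (\<Sum>k\<in>UNIV. scal (M j k) * z k)"
proof -
  have sum: "\<sigma> (\<Sum>k\<in>A. F k) = (\<Sum>k\<in>A. \<sigma> (F k))" for A :: "'p mod_ring set" and F
  proof (induction A rule: infinite_finite_induct)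
    case empty
    show ?case using lin(2)[of 0 0] by simp
  next
    case (infinite A)
    then show ?case using lin(2)[of 0 0] by simp
  qed (simp add: lin(1))
  have "\<sigma> (\<Sum>k\<in>UNIV. scal (M j k) * z k) = (\<Sum>k\<in>UNIV. scal (ev j * M j (k - s)) * z (k - s))"
    by (simp only: sum lin(2) z M flip: mult.assoc scal_mult)
  also have "\<dots> = (\<Sum>k\<in>UNIV. scal (ev j * M j k) * z k)"
  proof -
    have "(k - s) + s = k" "(k + s) - s = k" for k by simp_all
    then have "bij_betw (\<lambda>k. k - s) UNIV UNIV"
      by (intro bij_betw_byWitness[where f' = "\<lambda>k. k + s"]) blast+
    then show ?thesis
      using sum.reindex_bij_betw[of "\<lambda>k. k - s" UNIV UNIV "\<lambda>k. scal (ev j * M j k) * z k"] by blast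
  qed
  finally show ?thesis by (simp only: sum_distrib_left scal_mult mult.assoc)
qed

lemma inverse_combination:
  fixes z :: "'p::prime_card mod_ring \<Rightarrow> ('m::monoid_add \<Rightarrow>\<^sub>0 complex)"
  assumes NM: "\<And>k l. (\<Sum>j\<in>UNIV. N k j * M j l) = (if k = l then 1 else 0)"
  shows "z k = (\<Sum>j\<in>UNIV. scal (N k j) * (\<Sum>l\<in>UNIV. scal (M j l) * z l))"
proof -
  have "(\<Sum>j\<in>UNIV. scal (N k j) * (\<Sum>l\<in>UNIV. scal (M j l) * z l))
      = (\<Sum>l\<in>UNIV. (\<Sum>j\<in>UNIV. scal (N k j * M j l)) * z l)"
    unfolding sum_distrib_left sum_distrib_right by (subst sum.swap) (simp only: scal_mult mult.assoc)
  also have "\<dots> = (\<Sum>l\<in>UNIV. scal (if k = l then 1 else 0) * z l)"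
    by (simp only: NM scal_sum[symmetric])
  also have "\<dots> = (\<Sum>l\<in>UNIV. if k = l then z l else 0)" by (rule sum.cong) auto
  finally show ?thesis by simp
qed

section \<open>Traces on the Clifford algebra\<close>

definition exponents :: "nat \<Rightarrow> ('i::finite \<Rightarrow> nat) set" where
  "exponents n = {e. (\<Sum>i\<in>UNIV. e i) = n}"

lemma finite_exponents: "finite (exponents n :: ('i::finite \<Rightarrow> nat) set)"
proof (rule finite_subset)
  show "exponents n \<subseteq> (\<Pi>\<^sub>E i\<in>(UNIV :: 'i set). {..n})"
  proof
    fix e :: "'i \<Rightarrow> nat" assume "e \<in> exponents n"
    then have "e i \<le> n" for i using member_le_sum[of i UNIV e] by (simp add: exponents_def)
    then show "e \<in> (\<Pi>\<^sub>E i\<in>(UNIV :: 'i set). {..n})" by (simp add: PiE_iff)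
  qed
qed (simp add: finite_PiE)

lemma nmon_component:
  assumes u: "\<And>i. u i \<in> free_component 2" and v: "\<And>i. v i \<in> free_component 1" and L: "distinct L"
  shows "nmon u v L e \<in> free_component (\<Sum>i\<in>set L. e i)"
  using L
proof (induction L)
  case Nil
  show ?case by (simp add: free_component_1)
next
  case (Cons i L)
  have "nfactor u v i (e i) \<in> free_component (e i div 2 * 2 + e i mod 2 * 1)"
    unfolding nfactor_def by (intro free_component_mult free_component_power u v)
  then have "nfactor u v i (e i) \<in> free_component (e i)" by simp
  from free_component_mult[OF this Cons.IH] show ?case using Cons.prems by simp
qed

text \<open>
  Replacing two factors \<open>v i\<close> by one \<open>u i\<close> does not affect the eigenvalue, because that of \<open>u i\<close> is a square.
\<close>

lemma nmon_eigen:
  assumes hom: "\<And>f g. \<sigma> (f * g) = \<sigma> f * \<sigma> g" "\<sigma> 1 = 1"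
    and u: "\<And>i. \<sigma> (u i) = scal (ev i ^ 2) * u i" and v: "\<And>i. \<sigma> (v i) = scal (ev i) * v i"
    and L: "distinct L"
  shows "\<sigma> (nmon u v L e) = scal (\<Prod>i\<in>set L. ev i ^ e i) * (nmon u v L e :: 'm::monoid_add \<Rightarrow>\<^sub>0 complex)"
  using L
proof (induction L)
  case Nil
  show ?case by (simp add: hom)
next
  case (Cons i L)
  have pow: "\<sigma> (f ^ n) = scal (d ^ n) * f ^ n" if "\<sigma> f = scal d * f" for f d n
    by (induction n) (simp_all only: power_0 power_Suc hom that scal_mult_both scal_1 mult_1_left)
  have "\<sigma> (nfactor u v i (e i)) = scal ((ev i ^ 2) ^ (e i div 2) * ev i ^ (e i mod 2)) * nfactor u v i (e i)"
    unfolding nfactor_def hom pow[OF u] pow[OF v] by (rule scal_mult_both)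
  also have "(ev i ^ 2) ^ (e i div 2) * ev i ^ (e i mod 2) = ev i ^ (2 * (e i div 2) + e i mod 2)"
    by (simp only: power_add power_mult)
  also have "2 * (e i div 2) + e i mod 2 = e i" by simp
  finally have i: "\<sigma> (nfactor u v i (e i)) = scal (ev i ^ e i) * nfactor u v i (e i)" .
  have "\<sigma> (nmon u v L e) = scal (\<Prod>i\<in>set L. ev i ^ e i) * nmon u v L e" using Cons by simp
  then have "\<sigma> (nmon u v (i # L) e) = scal (ev i ^ e i * (\<Prod>i\<in>set L. ev i ^ e i)) * nmon u v (i # L) e"
    by (simp only: nmon_Cons hom i scal_mult_both)
  then show ?case using Cons.prems by simp
qed

context regular_clifford
begin

definition coset :: "'p mod_ring free_alg \<Rightarrow> 'p mod_ring free_alg set" where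
  "coset f = J +>\<^bsub>monoid_algebra\<^esub> f"

lemma mem_coset: "g \<in> coset f \<longleftrightarrow> g - f \<in> J"
proof -
  have "g = h + f \<longleftrightarrow> h = g - f" for h by auto
  then show ?thesis by (auto simp: coset_def a_r_coset_def' monoid_algebra_def)
qed

lemma coset_eq_iff: "coset f = coset g \<longleftrightarrow> f - g \<in> J"
proof
  assume "coset f = coset g"
  then show "f - g \<in> J" using mem_coset[of f f] mem_coset[of f g] tsi_0[OF J] by simp
next
  assume fg: "f - g \<in> J"
  have eq: "h - f \<in> J \<longleftrightarrow> h - g \<in> J" for h
    using tsi_trans[OF J _ fg, of h] tsi_trans[OF J _ tsi_sym[OF J fg], of h] by blast
  show "coset f = coset g" by (rule Set.set_eqI) (simp only: mem_coset eq)
qed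

lemma clifford_graded_piece:
  "graded_piece ((clifford a :: (complex, 'p mod_ring free_alg set) module)\<lparr>carrier := clifford_component a n\<rparr>)
     (free_component n) coset"
proof
  interpret I: ideal J "monoid_algebra :: (complex, 'p mod_ring free_alg) module"
    unfolding ideal_monoid_algebra_iff by (rule J)
  show "alg.subspace (free_component n)" by (rule subspace_free_component)
  show "carrier ((clifford a)\<lparr>carrier := clifford_component a n\<rparr>) = coset ` free_component n"
    by (simp add: clifford_component_def quot_component_def coset_def)
  show "coset f \<oplus>\<^bsub>(clifford a)\<lparr>carrier := clifford_component a n\<rparr>\<^esub> coset g = coset (f + g)" for f g
    using I.a_rcos_sum[of f g]
    by (simp add: clifford_def quot_algebra_def FactRing_def coset_def) (simp add: monoid_algebra_def)
  show "c \<odot>\<^bsub>(clifford a)\<lparr>carrier := clifford_component a n\<rparr>\<^esub> coset f = coset (scal c * f)" for c f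
  proof -
    have "coset (scal c * h) = coset (scal c * f)" if "h \<in> coset f" for h
      using that tsi_left[OF J, of "h - f" "scal c"] by (simp add: mem_coset coset_eq_iff right_diff_distrib)
    moreover have "f \<in> coset f" by (simp add: mem_coset tsi_0[OF J])
    ultimately have "(\<Union>h\<in>coset f. coset (scal c * h)) = coset (scal c * f)" by blast
    then show ?thesis
      by (simp add: clifford_def quot_algebra_def coset_def[symmetric]) (simp add: monoid_algebra_def coset_def)
  qed
  have "coset 0 = J" by (rule Set.set_eqI) (simp add: mem_coset)
  then show "\<zero>\<^bsub>(clifford a)\<lparr>carrier := clifford_component a n\<rparr>\<^esub> = coset 0"
    by (simp add: clifford_def quot_algebra_def FactRing_def)
qed

text \<open>
  The image of a coset is a subset of the other coset since the ideal is preserved, and all of it since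
  the inverse preserves the ideal, too.
\<close>

lemma clifford_act_coset:
  assumes g: "free_act g = heis_free s b c"
  shows "clifford_act g (coset f) = coset (heis_free s b c f)"
proof (rule Set.set_eqI, rule iffI)
  fix h assume "h \<in> clifford_act g (coset f)"
  then obtain k where k: "k - f \<in> J" "h = heis_free s b c k" by (auto simp: clifford_act_def g mem_coset)
  show "h \<in> coset (heis_free s b c f)"
    using heis_free_ideal_subset[OF k(1), of s b c] by (simp add: k(2) mem_coset heis_free_hom)
next
  fix h assume h: "h \<in> coset (heis_free s b c f)"
  let ?k = "f + heis_free (- s) (- b) (b * s - c) (h - heis_free s b c f)"
  have "?k \<in> coset f" using heis_free_ideal_subset h by (simp add: mem_coset)
  moreover have "heis_free s b c ?k = h" by (simp add: heis_free_hom(1) heis_free_inverse)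
  ultimately show "h \<in> clifford_act g (coset f)" unfolding clifford_act_def g by (metis image_eqI)
qed

text \<open>
  The eigenvectors are the normal monomials in the eigenvectors \<open>u\<close> and \<open>v\<close>, which span. The dual forms come
  from the exterior module and belong to the normal monomials in the original generators.
\<close>

lemma clifford_trace:
  fixes M N M' N' :: "'p mod_ring \<Rightarrow> 'p mod_ring \<Rightarrow> complex"
  assumes g: "free_act g = heis_free s b c"
    and M: "\<And>j k. M j k * heis_coeff s b c k = ev j * M j (k - s)"
    and NM: "\<And>k l. (\<Sum>j\<in>UNIV. N k j * M j l) = (if k = l then 1 else 0)"
    and M': "\<And>j k. M' j k * heis_coeff s b c k ^ 2 = ev j ^ 2 * M' j (k - s)"
    and NM': "\<And>k l. (\<Sum>j\<in>UNIV. N' k j * M' j l) = (if k = l then 1 else 0)"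
  shows "lin_trace ((clifford a :: (complex, 'p mod_ring free_alg set) module)\<lparr>carrier := clifford_component a n\<rparr>)
      (clifford_act g) = (\<Sum>e\<in>exponents n. \<Prod>i\<in>UNIV. ev i ^ e i)"
proof -
  define v where "v j = (\<Sum>k\<in>UNIV. scal (M j k) * x k)" for j
  define u where "u j = (\<Sum>k\<in>UNIV. scal (M' j k) * y k)" for j
  have xv: "x k = (\<Sum>j\<in>UNIV. scal (N k j) * v j)" for k unfolding v_def by (rule inverse_combination[OF NM])
  have yu: "y k = (\<Sum>j\<in>UNIV. scal (N' k j) * u j)" for k unfolding u_def by (rule inverse_combination[OF NM'])
  have v_eigen: "heis_free s b c (v j) = scal (ev j) * v j" for j
    unfolding v_def
  proof (rule eigen_combination[where \<kappa> = "heis_coeff s b c" and s = s])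
    show "heis_free s b c (f + h) = heis_free s b c f + heis_free s b c h"
      "heis_free s b c (scal d * f) = scal d * heis_free s b c f" for f h d by (rule heis_free_hom)+
    show "heis_free s b c (x k) = scal (heis_coeff s b c k) * x (k - s)" for k by (rule heis_free_var)
  qed (rule M)
  have u_eigen: "heis_free s b c (u j) = scal (ev j ^ 2) * u j" for j
    unfolding u_def
  proof (rule eigen_combination[where \<kappa> = "\<lambda>k. heis_coeff s b c k ^ 2" and s = s])
    show "heis_free s b c (f + h) = heis_free s b c f + heis_free s b c h"
      "heis_free s b c (scal d * f) = scal d * heis_free s b c f" for f h d by (rule heis_free_hom)+
    show "heis_free s b c (y k) = scal (heis_coeff s b c k ^ 2) * y (k - s)" for k by (rule heis_free_y)
  qed (rule M')
  have v1: "v j \<in> free_component 1" for j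
    unfolding v_def by (intro free_component_sum free_component_scal free_component_var)
  have u2: "u j \<in> free_component 2" for j
    unfolding u_def by (intro free_component_sum free_component_scal y_component)
  interpret clifford_generators J u v by (rule linear_generators[OF v_def u_def yu])
  obtain pos :: "'p mod_ring \<Rightarrow> nat" and L where L: "inj pos" "distinct L" "set L = UNIV"
    "sorted_wrt (\<lambda>i j. pos i < pos j) L" by (rule sorted_position)
  interpret clifford_module P a pos by unfold_locales (rule L(1))
  interpret graded_piece "(clifford a :: (complex, 'p mod_ring free_alg set) module)\<lparr>carrier := clifford_component a n\<rparr>"
    "free_component n" coset by (rule clifford_graded_piece)
  show ?thesis
  proof (rule lin_trace_cover[where U = "nmon u v L" and N = "nmon y x L" and \<phi> = dual and \<sigma> = "heis_free s b c"])
    have ex: "\<exists>B. x j = (\<Sum>i\<in>UNIV. scal (B i) * v i)" for j using xv[of j] by (rule exI[of _ "N j"])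
    show "finite (exponents n :: ('p mod_ring \<Rightarrow> nat) set)" by (rule finite_exponents)
    show "nmon u v L e \<in> free_component n" if "e \<in> exponents n" for e
      using nmon_component[OF u2 v1 L(2), where e = e] that by (simp add: L(3) exponents_def)
    show "nmon y x L e \<in> free_component n" if "e \<in> exponents n" for e
      using nmon_component[OF y_component free_component_var L(2), where e = e] that by (simp add: L(3) exponents_def)
    show "\<exists>d. coset f = coset (\<Sum>e\<in>exponents n. scal (d e) * nmon u v L e)" if f: "f \<in> free_component n" for f
    proof -
      have "(\<Sum>w\<in>Poly_Mapping.keys f. scal (Poly_Mapping.lookup f w) * prod_list (map x (letters w)))
          \<in> alg.span (J \<union> nmon u v L ` exponents n)"
      proof (intro alg.span_sum alg.span_scale)
        fix w assume "w \<in> Poly_Mapping.keys f"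
        then have "length (letters w) = n" using f by (simp add: free_component_def)
        then show "prod_list (map x (letters w)) \<in> alg.span (J \<union> nmon u v L ` exponents n)"
          using generators_span[OF L(2,3) ex, where w = "letters w"] by (simp only: exponents_def)
      qed
      then have "f \<in> alg.span (J \<union> nmon u v L ` exponents n)"
        using free_component_words[OF f] by simp
      then show ?thesis unfolding coset_eq_iff by (rule mod_combination_span[OF J finite_exponents])
    qed
    show "dual e (f + h) = dual e f + dual e h" "dual e (scal d * f) = d * dual e f" for e f h d
      by (rule dual_linear)+
    show "dual e f = dual e h" if "coset f = coset h" for e f h
      using dual_ideal[of "f - h" e] dual_linear(1)[of e "f - h" h] that by (simp add: coset_eq_iff)
    show "dual e (nmon y x L e') = (if e = e' then 1 else 0)" for e e' by (rule dual_nmon[OF L(4,2,3)])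
    show "heis_free s b c f \<in> free_component n" if "f \<in> free_component n" for f
      using that by (rule heis_free_component)
    show "heis_free s b c (f + h) = heis_free s b c f + heis_free s b c h"
      "heis_free s b c (scal d * f) = scal d * heis_free s b c f" for f h d by (rule heis_free_hom)+
    show "clifford_act g (coset f) = coset (heis_free s b c f)" for f by (rule clifford_act_coset[OF g])
    show "heis_free s b c (nmon u v L e) = scal (\<Prod>i\<in>UNIV. ev i ^ e i) * nmon u v L e" for e
      using nmon_eigen[of "heis_free s b c" u ev v L e, OF heis_free_hom(3) _ u_eigen v_eigen L(2)]
      by (simp add: L(3) heis_free_def free_subst_1)
  qed
qed

end

section \<open>Traces on the polynomial ring\<close>

lemma poly_subst_1: "poly_subst v 1 = 1"
  using poly_subst_of_scal[of v 1] by simp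

lemma poly_subst_power: "poly_subst v (f ^ n) = poly_subst v f ^ n"
  by (induction n) (simp_all only: power_0 power_Suc poly_subst_1 poly_subst_hom(3))

lemma poly_subst_prod: "poly_subst v (prod F A) = (\<Prod>a\<in>A. poly_subst v (F a))"
  by (induction A rule: infinite_finite_induct)
    (simp_all only: prod.infinite prod.empty prod.insert poly_subst_1 poly_subst_hom(3) not_False_eq_True)

lemma poly_subst_mon: "poly_subst v (poly_mon w m) = poly_mon (\<lambda>i. poly_subst v (w i)) m"
  by (simp only: poly_mon_def poly_subst_prod poly_subst_power)

lemma poly_subst_comp: "poly_subst v (poly_subst w f) = poly_subst (\<lambda>i. poly_subst v (w i)) f"
  unfolding poly_subst_monoid_lift[of w] poly_subst_monoid_lift[of "\<lambda>i. poly_subst v (w i)"] monoid_lift_def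
  by (simp only: poly_subst_hom(4,5) poly_subst_mon)

lemma poly_component_1: "1 \<in> poly_component 0"
  by (simp add: poly_component_def)

lemma poly_mon_component:
  assumes v: "\<And>i. v i \<in> poly_component 1"
  shows "poly_mon v m \<in> poly_component (mdeg m)"
proof -
  have pow: "v i ^ k \<in> poly_component k" for i k
    using poly_component_mult[OF v] by (induction k) (simp_all add: poly_component_1)
  have "(\<Prod>i\<in>A. v i ^ e i) \<in> poly_component (\<Sum>i\<in>A. e i)" for A e
    by (induction A rule: infinite_finite_induct) (simp_all add: poly_component_1 poly_component_mult pow)
  then show ?thesis by (simp add: poly_mon_def)
qed

lemma poly_subst_component:
  assumes v: "\<And>i. v i \<in> poly_component 1" and f: "f \<in> poly_component n"
  shows "poly_subst v f \<in> poly_component n"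
  unfolding poly_subst_monoid_lift monoid_lift_def
proof (intro poly_component_sum poly_component_scal)
  fix m assume "m \<in> Poly_Mapping.keys f"
  then have "mdeg m = n" using f by (simp add: poly_component_def)
  then show "poly_mon v m \<in> poly_component n" using poly_mon_component[OF v, where m = m] by simp
qed

lemma poly_graded_piece:
  "graded_piece ((monoid_algebra :: (complex, 'i::finite poly_alg) module)\<lparr>carrier := poly_component n\<rparr>)
     (poly_component n) (\<lambda>f. f)"
  by unfold_locales (simp_all add: alg.subspace_def poly_component_0 poly_component_add poly_component_scal
      monoid_algebra_def)

definition expo :: "('i::finite \<Rightarrow> nat) \<Rightarrow> 'i \<Rightarrow>\<^sub>0 nat" where
  "expo e = Abs_poly_mapping e"

lemma lookup_expo [simp]: "Poly_Mapping.lookup (expo e) = e"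
  by (simp add: expo_def)

lemma expo_lookup: "expo (Poly_Mapping.lookup m) = m"
  by (rule poly_mapping_eqI) simp

lemma expo_inj: "expo e = expo e' \<longleftrightarrow> e = e'"
  by (metis lookup_expo)

lemmas heis_poly_hom = poly_subst_hom[of "\<lambda>i. scal (heis_coeff s b c i) * poly_var (i - s)" for s b c,
    folded heis_poly_def]

lemma heis_poly_var: "heis_poly s b c (poly_var i) = scal (heis_coeff s b c i) * poly_var (i - s)"
  by (simp add: heis_poly_def poly_subst_var)

text \<open>
  Monomials in the eigenvectors \<open>v\<close> span since the substitution of \<open>v\<close> has a right inverse, the substitution
  of \<open>w\<close>. The dual forms are the coefficients of the ordinary monomials.
\<close>

lemma poly_trace:
  fixes M N :: "'p::prime_card mod_ring \<Rightarrow> 'p mod_ring \<Rightarrow> complex"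
  assumes g: "poly_act g = heis_poly s b c"
    and M: "\<And>j k. M j k * heis_coeff s b c k = ev j * M j (k - s)"
    and NM: "\<And>k l. (\<Sum>j\<in>UNIV. N k j * M j l) = (if k = l then 1 else 0)"
  shows "lin_trace ((monoid_algebra :: (complex, 'p mod_ring poly_alg) module)\<lparr>carrier := poly_component n\<rparr>)
      (poly_act g) = (\<Sum>e\<in>exponents n. \<Prod>i\<in>UNIV. ev i ^ e i)"
proof -
  define v where "v j = (\<Sum>k\<in>UNIV. scal (M j k) * (poly_var k :: 'p mod_ring poly_alg))" for j
  define w where "w k = (\<Sum>j\<in>UNIV. scal (N k j) * (poly_var j :: 'p mod_ring poly_alg))" for k
  have v_eigen: "heis_poly s b c (v j) = scal (ev j) * v j" for j
    unfolding v_def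
  proof (rule eigen_combination[where \<kappa> = "heis_coeff s b c" and s = s])
    show "heis_poly s b c (f + h) = heis_poly s b c f + heis_poly s b c h"
      "heis_poly s b c (scal d * f) = scal d * heis_poly s b c f" for f h d by (rule heis_poly_hom)+
    show "heis_poly s b c (poly_var k) = scal (heis_coeff s b c k) * poly_var (k - s)" for k by (rule heis_poly_var)
  qed (rule M)
  have vw: "poly_subst v (w k) = poly_var k" for k
  proof -
    have "poly_subst v (w k) = (\<Sum>j\<in>UNIV. scal (N k j) * v j)"
      unfolding w_def by (simp only: poly_subst_hom(4,5) poly_subst_var)
    also have "\<dots> = poly_var k" unfolding v_def by (rule inverse_combination[OF NM, symmetric])
    finally show ?thesis .
  qed
  have v1: "v j \<in> poly_component 1" and w1: "w j \<in> poly_component 1" for j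
    unfolding v_def w_def by (intro poly_component_sum poly_component_scal poly_var_component)+
  interpret graded_piece "(monoid_algebra :: (complex, 'p mod_ring poly_alg) module)\<lparr>carrier := poly_component n\<rparr>"
    "poly_component n" "\<lambda>f. f" by (rule poly_graded_piece)
  show ?thesis
  proof (rule lin_trace_cover[where U = "\<lambda>e. poly_mon v (expo e)" and N = "\<lambda>e. Poly_Mapping.single (expo e) 1"
        and \<phi> = "\<lambda>e f. Poly_Mapping.lookup f (expo e)" and \<sigma> = "heis_poly s b c"])
    show "finite (exponents n :: ('p mod_ring \<Rightarrow> nat) set)" by (rule finite_exponents)
    show "poly_mon v (expo e) \<in> poly_component n" if "e \<in> exponents n" for e
      using poly_mon_component[OF v1, where m = "expo e"] that by (simp add: exponents_def)
    show "Poly_Mapping.single (expo e) 1 \<in> poly_component n" if "e \<in> exponents n" for e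
      using that by (simp add: exponents_def poly_component_def)
    show "\<exists>d. f = (\<Sum>e\<in>exponents n. scal (d e) * poly_mon v (expo e))" if f: "f \<in> poly_component n" for f
    proof -
      define h where "h = poly_subst w f"
      have "h \<in> poly_component n" unfolding h_def by (rule poly_subst_component[OF w1 f])
      then have keys: "Poly_Mapping.keys h \<subseteq> expo ` exponents n"
      proof (intro subsetI)
        fix m assume "m \<in> Poly_Mapping.keys h"
        then have "Poly_Mapping.lookup m \<in> exponents n"
          using \<open>h \<in> poly_component n\<close> by (simp add: exponents_def poly_component_def)
        then show "m \<in> expo ` exponents n" using expo_lookup[of m] by (metis imageI)
      qed
      have inj: "inj_on expo (exponents n)" by (rule inj_onI) (simp only: expo_inj)
      have "f = poly_subst v h" unfolding h_def poly_subst_comp vw poly_subst_poly_var ..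
      also have "\<dots> = (\<Sum>m\<in>expo ` exponents n. scal (Poly_Mapping.lookup h m) * poly_mon v m)"
        unfolding poly_subst_monoid_lift
        by (rule monoid_lift_superset[OF finite_imageI[OF finite_exponents] keys])
      also have "\<dots> = (\<Sum>e\<in>exponents n. scal (Poly_Mapping.lookup h (expo e)) * poly_mon v (expo e))"
        by (simp only: sum.reindex[OF inj] o_def)
      finally show ?thesis by (rule exI[of _ "\<lambda>e. Poly_Mapping.lookup h (expo e)"])
    qed
    show "Poly_Mapping.lookup (f + h) (expo e) = Poly_Mapping.lookup f (expo e) + Poly_Mapping.lookup h (expo e)"
      "Poly_Mapping.lookup (scal d * f) (expo e) = d * Poly_Mapping.lookup f (expo e)"
      for e d and f h :: "'p mod_ring poly_alg" by (simp_all add: lookup_add)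
    show "Poly_Mapping.lookup f (expo e) = Poly_Mapping.lookup h (expo e)" if "f = h"
      for e and f h :: "'p mod_ring poly_alg" by (simp only: that)
    show "Poly_Mapping.lookup (Poly_Mapping.single (expo e') 1) (expo e) = (if e = e' then 1 else (0 :: complex))"
      for e e' :: "'p mod_ring \<Rightarrow> nat" by (auto simp: lookup_single when_def expo_inj)
    show "heis_poly s b c f \<in> poly_component n" if "f \<in> poly_component n" for f
      unfolding heis_poly_def
      by (rule poly_subst_component[OF _ that]) (intro poly_component_scal poly_var_component)
    show "heis_poly s b c (f + h) = heis_poly s b c f + heis_poly s b c h"
      "heis_poly s b c (scal d * f) = scal d * heis_poly s b c f" for f h d by (rule heis_poly_hom)+
    show "poly_act g f = heis_poly s b c f" for f by (simp only: g)
    show "heis_poly s b c (poly_mon v (expo e)) = scal (\<Prod>i\<in>UNIV. ev i ^ e i) * poly_mon v (expo e)" for e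
    proof -
      have "heis_poly s b c (poly_mon v (expo e)) = poly_mon (\<lambda>i. scal (ev i) * v i) (expo e)"
        using v_eigen unfolding heis_poly_def by (simp only: poly_subst_mon)
      then show ?thesis
        by (simp add: poly_mon_def power_mult_distrib prod.distrib scal_hom.hom_prod scal_hom.hom_power)
    qed
  qed
qed

section \<open>The degree one part and the character series\<close>

definition linear_part :: "'p::prime_card mod_ring free_alg \<Rightarrow> 'p mod_ring poly_alg" where
  "linear_part f = (\<Sum>i\<in>UNIV. scal (Poly_Mapping.lookup f (Free_Mon [i])) * poly_var i)"

lemma linear_part_add: "linear_part (f + g) = linear_part f + linear_part g"
  by (simp add: linear_part_def lookup_add scal_add distrib_right sum.distrib)

lemma linear_part_scal: "linear_part (scal c * f) = scal c * linear_part f"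
  by (simp add: linear_part_def sum_distrib_left scal_mult mult.assoc)

lemma linear_part_sum: "linear_part (sum F A) = (\<Sum>i\<in>A. linear_part (F i))"
proof (induction A rule: infinite_finite_induct)
  case (infinite A)
  then show ?case using linear_part_scal[of 0 0] by simp
next
  case empty
  show ?case using linear_part_scal[of 0 0] by simp
qed (simp add: linear_part_add)

lemma linear_part_var: "linear_part (free_var i) = poly_var i"
proof -
  have "linear_part (free_var i) = (\<Sum>k\<in>UNIV. if k = i then poly_var k else 0)"
    unfolding linear_part_def by (rule sum.cong) (auto simp: free_var_def lookup_single when_def)
  then show ?thesis by simp
qed

lemma linear_part_component: "linear_part f \<in> poly_component 1"
  unfolding linear_part_def by (intro poly_component_sum poly_component_scal poly_var_component)

lemma free_component_linear:
  fixes f :: "'p::prime_card mod_ring free_alg"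
  assumes "f \<in> free_component 1"
  shows "f = (\<Sum>i\<in>UNIV. scal (Poly_Mapping.lookup f (Free_Mon [i])) * free_var i)"
proof (rule poly_mapping_eqI)
  fix w
  have "Poly_Mapping.lookup (\<Sum>i\<in>UNIV. scal (Poly_Mapping.lookup f (Free_Mon [i])) * free_var i) w
      = (\<Sum>i\<in>UNIV. if Free_Mon [i] = w then Poly_Mapping.lookup f w else 0)" (is "?l = _")
    unfolding lookup_sum by (rule sum.cong) (auto simp: free_var_def lookup_single when_def)
  also have "\<dots> = Poly_Mapping.lookup f w"
  proof (cases "\<exists>k. w = Free_Mon [k]")
    case True
    then obtain k where k: "w = Free_Mon [k]" by blast
    show ?thesis by (simp add: k)
  next
    case False
    have "w \<notin> Poly_Mapping.keys f"
    proof
      assume "w \<in> Poly_Mapping.keys f"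
      then have "length (letters w) = 1" using assms by (simp add: free_component_def)
      then obtain k where "letters w = [k]" by (auto simp: length_Suc_conv)
      then have "w = Free_Mon [k]" by (cases w) simp
      then show False using False by blast
    qed
    then show ?thesis by (simp add: in_keys_iff)
  qed
  finally show "Poly_Mapping.lookup f w = ?l" by simp
qed

lemma single_one_eq_iff: "Poly_Mapping.single i (1::nat) = Poly_Mapping.single k 1 \<longleftrightarrow> i = k"
proof
  assume eq: "Poly_Mapping.single i (1::nat) = Poly_Mapping.single k 1"
  have "Poly_Mapping.lookup (Poly_Mapping.single i (1::nat)) k = 1" unfolding eq by simp
  then show "i = k" by (simp add: lookup_single when_def split: if_splits)
qed simp

lemma poly_component_linear:
  fixes h :: "'i::finite poly_alg"
  assumes "h \<in> poly_component 1"
  shows "h = (\<Sum>i\<in>UNIV. scal (Poly_Mapping.lookup h (Poly_Mapping.single i 1)) * poly_var i)"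
proof (rule poly_mapping_eqI)
  fix m :: "'i \<Rightarrow>\<^sub>0 nat"
  have "Poly_Mapping.lookup (\<Sum>i\<in>UNIV. scal (Poly_Mapping.lookup h (Poly_Mapping.single i 1)) * poly_var i) m
      = (\<Sum>i\<in>UNIV. if Poly_Mapping.single i 1 = m then Poly_Mapping.lookup h m else 0)" (is "?l = _")
    unfolding lookup_sum by (rule sum.cong) (auto simp: poly_var_def lookup_single when_def)
  also have "\<dots> = Poly_Mapping.lookup h m"
  proof (cases "\<exists>k. m = Poly_Mapping.single k 1")
    case True
    then obtain k where k: "m = Poly_Mapping.single k 1" by blast
    show ?thesis unfolding k single_one_eq_iff by simp
  next
    case False
    have "m \<notin> Poly_Mapping.keys h"
    proof
      assume "m \<in> Poly_Mapping.keys h"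
      then have "(\<Sum>i\<in>UNIV. Poly_Mapping.lookup m i) = 1" using assms by (simp add: poly_component_def)
      then obtain k where k: "Poly_Mapping.lookup m k = 1" "\<forall>j. k \<noteq> j \<longrightarrow> Poly_Mapping.lookup m j = 0"
        unfolding sum_eq_1_iff[OF finite] by blast
      have "m = Poly_Mapping.single k 1"
        by (rule poly_mapping_eqI) (use k in \<open>auto simp: lookup_single when_def\<close>)
      then show False using False by blast
    qed
    then show ?thesis using False by (simp add: in_keys_iff)
  qed
  finally show "Poly_Mapping.lookup h m = ?l" by simp
qed

context regular_clifford
begin

text \<open>
  The relations are quadratic, and so the ideal contains only elements of order at least two. The
  generators therefore remain independent in the Clifford algebra.
\<close>

lemma ideal_lookup_low_degree:
  assumes f: "f \<in> J" and w: "length (letters w) \<le> 1"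
  shows "Poly_Mapping.lookup f w = 0"
proof -
  define K :: "'p mod_ring free_alg set" where "K = {f. \<forall>w\<in>Poly_Mapping.keys f. 2 \<le> length (letters w)}"
  have "two_sided_ideal K"
    unfolding two_sided_ideal_def
  proof (intro conjI ballI allI)
    show "0 \<in> K" by (simp add: K_def)
    show "g + h \<in> K" if "g \<in> K" "h \<in> K" for g h
      using that keys_add[of g h] unfolding K_def by blast
    show "g * h \<in> K" "h * g \<in> K" if h: "h \<in> K" for g h
    proof -
      have "2 \<le> length (letters (u + v))" "2 \<le> length (letters (v + u))" if "v \<in> Poly_Mapping.keys h" for u v
        using h that by (auto simp: K_def plus_free_mon_def)
      then show "g * h \<in> K" "h * g \<in> K"
        using keys_mult[of g h] keys_mult[of h g] unfolding K_def by blast+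
    qed
  qed
  moreover have "cliff_anticomm i j - scal (\<alpha> (i - j)) * y ((i + j) / 2) \<in> K" for i j
  proof -
    have "cliff_anticomm i j + scal (- \<alpha> (i - j)) * y ((i + j) / 2) \<in> free_component 2"
      by (intro free_component_add free_component_scal y_component free_component_anticomm)
    then show ?thesis by (simp add: scal_uminus free_component_def K_def)
  qed
  ultimately have "J \<subseteq> K" by (rule clifford_ideal_subset)
  then have "f \<in> K" using f by blast
  then have "w \<notin> Poly_Mapping.keys f" using w unfolding K_def by force
  then show ?thesis by (simp add: in_keys_iff)
qed

text \<open>
  By \<open>ideal_lookup_low_degree\<close> all representatives of a coset have the same linear part.
\<close>

definition generator_map :: "'p mod_ring free_alg set \<Rightarrow> 'p mod_ring poly_alg" where
  "generator_map X = linear_part (SOME f. f \<in> X)"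

lemma generator_map_coset: "generator_map (coset f) = linear_part f"
proof -
  define h where "h = (SOME h. h \<in> coset f)"
  have "f \<in> coset f" by (simp add: mem_coset tsi_0[OF J])
  then have "h \<in> coset f" unfolding h_def by (rule someI)
  then have "h - f \<in> J" by (simp add: mem_coset)
  then have "Poly_Mapping.lookup (h - f) (Free_Mon [i]) = 0" for i by (rule ideal_lookup_low_degree) simp
  then have "Poly_Mapping.lookup h (Free_Mon [i]) = Poly_Mapping.lookup f (Free_Mon [i])" for i
    by (simp add: lookup_minus)
  then have "linear_part h = linear_part f" unfolding linear_part_def by simp
  then show ?thesis by (simp add: generator_map_def h_def)
qed

lemma generator_map_equivariant:
  fixes s b c :: "'p mod_ring"
  assumes g: "free_act g = heis_free s b c" "poly_act g = heis_poly s b c" and f: "f \<in> free_component 1"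
  shows "generator_map (clifford_act g (coset f)) = poly_act g (generator_map (coset f))"
proof -
  define d where "d i = Poly_Mapping.lookup f (Free_Mon [i])" for i
  have f_eq: "f = (\<Sum>i\<in>UNIV. scal (d i) * x i)" unfolding d_def by (rule free_component_linear[OF f])
  have "linear_part (heis_free s b c f)
      = (\<Sum>i\<in>UNIV. scal (d i) * (scal (heis_coeff s b c i) * poly_var (i - s)))"
    unfolding f_eq
    by (simp only: heis_free_hom(4,5) heis_free_var linear_part_sum linear_part_scal linear_part_var)
  moreover have "heis_poly s b c (linear_part f)
      = (\<Sum>i\<in>UNIV. scal (d i) * (scal (heis_coeff s b c i) * poly_var (i - s)))"
    unfolding linear_part_def d_def[symmetric]
    by (simp only: heis_poly_hom(4,5) heis_poly_var)
  ultimately show ?thesis by (simp only: clifford_act_coset[OF g(1)] generator_map_coset g(2))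
qed

lemma clifford_degree_one:
  "isomorphic_reps (heisenberg CARD('p))
    ((clifford a :: (complex, 'p mod_ring free_alg set) module)\<lparr>carrier := clifford_component a 1\<rparr>) clifford_act
    ((monoid_algebra :: (complex, 'p mod_ring poly_alg) module)\<lparr>carrier := poly_component 1\<rparr>) poly_act"
    (is "isomorphic_reps ?G ?V _ ?W _")
proof -
  interpret V: graded_piece ?V "free_component 1" coset by (rule clifford_graded_piece)
  interpret W: graded_piece ?W "poly_component 1" "\<lambda>f. f" by (rule poly_graded_piece)
  have map: "generator_map \<in> carrier ?V \<rightarrow> carrier ?W"
    by (rule Pi_I) (auto simp only: V.carrier W.carrier generator_map_coset linear_part_component image_ident)
  have "linear_map class_ring ?V ?W generator_map"
  proof -
    have "mod_hom_axioms class_ring ?V ?W generator_map"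
      unfolding mod_hom_axioms_def module_hom_def
    proof (intro CollectI conjI allI impI)
      show "generator_map \<in> carrier ?V \<rightarrow> carrier ?W" by (rule map)
      show "generator_map (X \<oplus>\<^bsub>?V\<^esub> Y) = generator_map X \<oplus>\<^bsub>?W\<^esub> generator_map Y"
        if XY: "X \<in> carrier ?V \<and> Y \<in> carrier ?V" for X Y
      proof -
        obtain f h where "X = coset f" "Y = coset h" using XY unfolding V.carrier by blast
        then show ?thesis by (simp only: V.\<pi>_add W.\<pi>_add generator_map_coset linear_part_add)
      qed
      show "generator_map (d \<odot>\<^bsub>?V\<^esub> X) = d \<odot>\<^bsub>?W\<^esub> generator_map X"
        if X: "d \<in> carrier class_ring \<and> X \<in> carrier ?V" for d X
      proof -
        obtain f where "X = coset f" using X unfolding V.carrier by blast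
        then show ?thesis by (simp only: V.\<pi>_scal W.\<pi>_scal generator_map_coset linear_part_scal)
      qed
    qed
    then show ?thesis
      using V.vectorspace_axioms W.vectorspace_axioms
      unfolding linear_map_def mod_hom_def vectorspace_def by blast
  qed
  moreover have "bij_betw generator_map (carrier ?V) (carrier ?W)"
  proof (rule bij_betw_imageI, rule inj_onI)
    fix X Y assume X: "X \<in> carrier ?V" and Y: "Y \<in> carrier ?V" and eq: "generator_map X = generator_map Y"
    obtain f h where f: "f \<in> free_component 1" "X = coset f" and h: "h \<in> free_component 1" "Y = coset h"
      using X Y unfolding V.carrier by blast
    have lin: "linear_part f = linear_part h" using eq by (simp only: f h generator_map_coset)
    have coeff: "Poly_Mapping.lookup (linear_part k) (Poly_Mapping.single i 1) = Poly_Mapping.lookup k (Free_Mon [i])"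
      for k :: "'p mod_ring free_alg" and i
    proof -
      have "Poly_Mapping.lookup (linear_part k) (Poly_Mapping.single i 1)
          = (\<Sum>j\<in>UNIV. if j = i then Poly_Mapping.lookup k (Free_Mon [j]) else 0)"
        unfolding linear_part_def lookup_sum
        by (intro sum.cong) (auto simp: poly_var_def lookup_single when_def single_one_eq_iff simp del: One_nat_def)
      then show ?thesis by simp
    qed
    have "f = h"
    proof -
      have "f = (\<Sum>i\<in>UNIV. scal (Poly_Mapping.lookup f (Free_Mon [i])) * x i)"
        by (rule free_component_linear[OF f(1)])
      also have "\<dots> = (\<Sum>i\<in>UNIV. scal (Poly_Mapping.lookup h (Free_Mon [i])) * x i)"
        by (simp only: coeff[symmetric] lin)
      also have "\<dots> = h" by (rule free_component_linear[OF h(1), symmetric])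
      finally show ?thesis .
    qed
    then show "X = Y" by (simp only: f h)
  next
    have "k \<in> generator_map ` carrier ?V" if "k \<in> carrier ?W" for k
    proof -
      from that
      have k: "k \<in> poly_component 1" by simp
      define f where "f = (\<Sum>i\<in>UNIV. scal (Poly_Mapping.lookup k (Poly_Mapping.single i 1)) * x i)"
      have "f \<in> free_component 1"
        unfolding f_def by (intro free_component_sum free_component_scal free_component_var)
      then have "coset f \<in> carrier ?V" unfolding V.carrier by (rule imageI)
      moreover have "generator_map (coset f) = k"
        unfolding generator_map_coset f_def
        by (simp only: linear_part_sum linear_part_scal linear_part_var) (rule poly_component_linear[OF k, symmetric])
      ultimately show ?thesis by blast
    qed
    then show "generator_map ` carrier ?V = carrier ?W" using map by blast
  qed
  moreover have "generator_map (clifford_act g X) = poly_act g (generator_map X)" if X: "X \<in> carrier ?V" for g X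
  proof -
    obtain s b c where g: "(free_act g :: 'p mod_ring free_alg \<Rightarrow> _) = heis_free s b c"
      "(poly_act g :: 'p mod_ring poly_alg \<Rightarrow> _) = heis_poly s b c" using heisenberg_acts by blast
    obtain f where "f \<in> free_component 1" "X = coset f" using X unfolding V.carrier by blast
    then show ?thesis by (simp only: generator_map_equivariant[OF g])
  qed
  ultimately show ?thesis unfolding isomorphic_reps_def by blast
qed

lemma clifford_char_series:
  "char_series (clifford a :: (complex, 'p mod_ring free_alg set) module) (clifford_component a) clifford_act g =
   char_series (monoid_algebra :: (complex, 'p mod_ring poly_alg) module) poly_component poly_act g"
proof -
  obtain s b c where g: "(free_act g :: 'p mod_ring free_alg \<Rightarrow> _) = heis_free s b c"
    "(poly_act g :: 'p mod_ring poly_alg \<Rightarrow> _) = heis_poly s b c" using heisenberg_acts by blast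
  obtain ev :: "'p mod_ring \<Rightarrow> complex" where ev: "\<And>n. (of_nat n :: 'p mod_ring) \<noteq> 0 \<Longrightarrow> \<exists>M N.
      (\<forall>j k. M j k * heis_coeff s b c k ^ n = ev j ^ n * M j (k - s)) \<and>
      (\<forall>k l. (\<Sum>j\<in>UNIV. N k j * M j l) = (if k = l then 1 else 0))"
    using eigen_matrices[of s b c] by blast
  obtain M N where M: "\<forall>j k. M j k * heis_coeff s b c k ^ 1 = ev j ^ 1 * M j (k - s)"
    and N: "\<forall>k l. (\<Sum>j\<in>UNIV. N k j * M j l) = (if k = l then 1 else 0)"
    using ev[of 1] by (auto simp del: power_one_right)
  have "(of_nat 2 :: 'p mod_ring) \<noteq> 0" by simp
  from ev[OF this] obtain M' N' where M': "\<forall>j k. M' j k * heis_coeff s b c k ^ 2 = ev j ^ 2 * M' j (k - s)"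
    and N': "\<forall>k l. (\<Sum>j\<in>UNIV. N' k j * M' j l) = (if k = l then 1 else 0)"
    by blast
  show ?thesis unfolding char_series_def
  proof (rule arg_cong[where f = Abs_fps], rule ext)
    fix n
    have "lin_trace ((clifford a :: (complex, 'p mod_ring free_alg set) module)\<lparr>carrier := clifford_component a n\<rparr>)
        (clifford_act g) = (\<Sum>e\<in>exponents n. \<Prod>i\<in>UNIV. ev i ^ e i)"
      by (rule clifford_trace[OF g(1) M[unfolded power_one_right, rule_format] N[rule_format]
            M'[rule_format] N'[rule_format]])
    also have "\<dots> = lin_trace ((monoid_algebra :: (complex, 'p mod_ring poly_alg) module)\<lparr>carrier := poly_component n\<rparr>)
        (poly_act g)"
      by (rule poly_trace[OF g(2) M[unfolded power_one_right, rule_format] N[rule_format], symmetric])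
    finally show "lin_trace ((clifford a :: (complex, 'p mod_ring free_alg set) module)\<lparr>carrier := clifford_component a n\<rparr>)
        (clifford_act g)
      = lin_trace ((monoid_algebra :: (complex, 'p mod_ring poly_alg) module)\<lparr>carrier := poly_component n\<rparr>) (poly_act g)" .
  qed
qed

end

theorem theorem1p3:
  fixes a :: "nat \<Rightarrow> complex"
  assumes "CARD('p::prime_card) \<ge> 5"
    and "projective_coords TYPE('p) a"
    and "clifford_regular TYPE('p) a"
  shows "isomorphic_reps (heisenberg CARD('p))
           ((clifford a :: (complex, 'p mod_ring free_alg set) module)
              \<lparr>carrier := clifford_component a 1\<rparr>) clifford_act
           ((monoid_algebra :: (complex, 'p mod_ring poly_alg) module)
              \<lparr>carrier := poly_component 1\<rparr>) poly_act \<and>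
         (\<forall>g \<in> carrier (heisenberg CARD('p)).
           char_series (clifford a :: (complex, 'p mod_ring free_alg set) module)
             (clifford_component a) clifford_act g =
           char_series (monoid_algebra :: (complex, 'p mod_ring poly_alg) module)
             poly_component poly_act g)"
proof -
  interpret regular_clifford "TYPE('p)" a
    by unfold_locales (use assms in simp_all)
  show ?thesis using clifford_degree_one clifford_char_series by blast
qed

end
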